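(* Let $d\ge2$ and let $\overline{\mathscr L}_t$ be the length of the typical edge of an isotropic Poisson hypersphere tessellation of intensity $t>0$ on $\mathbb S^d$. Then, as $t\to\infty$, the distribution of $\frac t\pi\overline{\mathscr L}_t$ converges in total variation to the exponential distribution with parameter $1$.
   Context: $\mathbb S^d\subset\mathbb R^{d+1}$ is the unit sphere; $\mathcal H^1$ is one-dimensional Hausdorff measure (length). Isotropic Poisson hypersphere tessellation: let $\eta_t$ be a Poisson point process on $\mathbb S^d$ with intensity measure $t\sigma_d$, $\sigma_d$ the normalized (probability) spherical Lebesgue measure. $X_t$ is the partition of $\mathbb S^d$ into spherical polytopes (closures of the connected components of the complement of $\bigcup_{u\in\eta_t}u^\perp\cap\mathbb S^d$). $\mathcal F_1(X_t)$ is the set of all one-dimensional faces (edges) of cells of $X_t$, each counted once (a full great circle is allowed as an edge, which occurs if $|\eta_t|=d-1$; $k$-faces of a spherical polytope are intersections of $\mathbb S^d$ with $(k+1)$-dimensional faces of the corresponding polyhedral cone). The length of the typical edge has distribution $\mathbf P(\overline{\mathscr L}_t\in\cdot)=\frac{1}{\mathbf E|\mathcal F_1(X_t)|}\mathbf E\sum_{e\in\mathcal F_1(X_t)}\mathbf 1\{\mathcal H^1(e)\in\cdot\}$. *)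

theory Defs
  imports "HOL-Probability.Probability"
begin

(* Normalised spherical Lebesgue measure: the law of the direction of a uniform random point of
   the unit ball.  Since sgn 0 = 0 lies off the sphere, the centre (a null set) is discarded by
   the restriction. *)
definition sphere_measure :: "'a::euclidean_space measure" where
  "sphere_measure =
     restrict_space (distr (uniform_measure lborel (ball 0 1)) borel sgn) (sphere 0 1)"

(* Poisson processes with finite intensity measure L.  As L is finite, a realisation is a finite
   integer-valued measure, i.e. a finite multiset of points.  Note that 0 ^ 0 = 1, so sets of
   L-measure 0 almost surely contain no point. *)
definition poisson_process ::
  "'w measure \<Rightarrow> 'a measure \<Rightarrow> ('w \<Rightarrow> 'a multiset) \<Rightarrow> bool" where
  "poisson_process M L \<eta> \<longleftrightarrow>
     prob_space M \<and> finite_measure L \<and>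
     (\<forall>\<omega>\<in>space M. set_mset (\<eta> \<omega>) \<subseteq> space L) \<and>
     (\<forall>A\<in>sets L.
        (\<lambda>\<omega>. size {#x \<in># \<eta> \<omega>. x \<in> A#}) \<in> M \<rightarrow>\<^sub>M count_space UNIV \<and>
        (\<forall>k. measure M {\<omega>\<in>space M. size {#x \<in># \<eta> \<omega>. x \<in> A#} = k} =
             measure L A ^ k / fact k * exp (- measure L A))) \<and>
     (\<forall>(n::nat) A. (\<forall>i<n. A i \<in> sets L) \<and> disjoint_family_on A {..<n} \<longrightarrow>
        prob_space.indep_vars M (\<lambda>_. count_space UNIV)
          (\<lambda>i \<omega>. size {#x \<in># \<eta> \<omega>. x \<in> A i#}) {..<n})"

definition tessellation_cells :: "'a::euclidean_space set \<Rightarrow> 'a set set" where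
  "tessellation_cells U = closure ` components (sphere 0 1 - (\<Union>u\<in>U. {x. u \<bullet> x = 0}))"

(* One-dimensional faces of the cells, i.e. intersections of the sphere with two-dimensional faces
   of the cones spanned by the cells.  Two-dimensional lineality spaces (full great circles) are
   included, and an edge shared by several cells occurs once. *)
definition tessellation_edges :: "'a::euclidean_space set \<Rightarrow> 'a set set" where
  "tessellation_edges U =
     {sphere 0 1 \<inter> F | F C. C \<in> tessellation_cells U \<and> F face_of (cone hull C) \<and> aff_dim F = 2}"

(* Boundedness is required because diameter has no meaningful value on unbounded sets. *)
definition hausdorff1_content :: "real \<Rightarrow> 'a::metric_space set \<Rightarrow> ennreal" where
  "hausdorff1_content \<delta> A =
     (INF U\<in>{U :: nat \<Rightarrow> 'a set.
               A \<subseteq> (\<Union>i. U i) \<and> (\<forall>i. bounded (U i) \<and> diameter (U i) \<le> \<delta>)}.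
        \<Sum>i. ennreal (diameter (U i)))"

definition hausdorff1 :: "'a::metric_space set \<Rightarrow> ennreal" where
  "hausdorff1 A = (SUP \<delta>\<in>{0<..}. hausdorff1_content \<delta> A)"

(* Edges have finite length, so enn2real loses nothing. *)
definition typical_edge_length_law ::
  "'w measure \<Rightarrow> ('w \<Rightarrow> 'a::euclidean_space multiset) \<Rightarrow> real measure" where
  "typical_edge_length_law M \<eta> =
     measure_of UNIV (sets borel)
       (\<lambda>B. (\<integral>\<^sup>+\<omega>. (\<Sum>e\<in>tessellation_edges (set_mset (\<eta> \<omega>)).
                    indicator B (enn2real (hausdorff1 e))) \<partial>M) /
            (\<integral>\<^sup>+\<omega>. of_nat (card (tessellation_edges (set_mset (\<eta> \<omega>)))) \<partial>M))"

definition tv_dist :: "'a measure \<Rightarrow> 'a measure \<Rightarrow> real" where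
  "tv_dist P Q = (SUP A\<in>sets P. \<bar>measure P A - measure Q A\<bar>)"

end

theory Submission
  imports Defs
begin

text \<open>
  Condition on the number \<open>n\<close> of points: ordered uniformly, a Poisson process with \<open>n\<close> points is a
  vector of \<open>n\<close> independent uniform points, which are almost surely in general position. Then the
  edges lie on the great circles cut out by \<open>d - 1\<close> of the hyperplanes, and on each such circle the
  remaining hyperplanes cut out antipodal pairs of independent uniform points. So every edge is
  the arc from such a point to its successor, and its length exceeds \<open>s < pi\<close> with probability
  \<open>(1 - s / pi) ^ (n - d)\<close>. Summing the Poisson weights over \<open>n\<close> gives the law of the typical edge
  length exactly: it is the mixture of \<open>min Y pi\<close>, where \<open>Y\<close> is exponential with parameter
  \<open>t / pi\<close>, and of the point mass at \<open>2 * pi\<close> (the event that there are only \<open>d - 1\<close> points) with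
  weights proportional to \<open>2 * t\<close> and \<open>exp (- t)\<close>. The total variation distance is therefore of
  order \<open>exp (- t)\<close>.
\<close>

section \<open>The Janossy formula for Poisson processes\<close>

text \<open>A finite multiset carries no measurable enumeration, and the definition of a Poisson
  process speaks only of counts in measurable sets. The passage to ordered points is therefore
  derived from counts: on boxes, the number of fitting orderings cancels the factorials in the
  Poisson probabilities, and measure theory extends the identity to all functions of n points.

  The exponent n - d arises because d - 1 points determine the circle and one more fixes where the
  arc starts. For each of the other n - d points the angle from the start to its next crossing is
  uniform on (0, pi): rotations in the plane of the circle preserve the spherical measure and shift
  this angle modulo pi. There are n choose d - 1 circles, n - d + 1 lines on each and two antipodal
  starts per line, so the Poisson weights sum to 2 t^d / (d - 1)! times exp (- t s / pi); a lone
  full circle contributes t^(d - 1) / (d - 1)! times exp (- t). Their ratio gives the weights 2 t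
  and exp (- t).

  The ambient dimension is d + 1, so d - 1 appears as \<open>DIM('a) - 2\<close>.\<close>

definition bijections :: "'i set \<Rightarrow> 'j set \<Rightarrow> ('i \<Rightarrow> 'j) set" where
  "bijections A B = {p \<in> A \<rightarrow>\<^sub>E B. bij_betw p A B}"

lemma finite_bijections: "finite A \<Longrightarrow> finite B \<Longrightarrow> finite (bijections A B)"
  by (rule finite_subset[of _ "A \<rightarrow>\<^sub>E B"]) (auto simp: bijections_def intro: finite_PiE)

lemma bijections_insert:
  assumes "a \<notin> A"
  shows "bij_betw (\<lambda>(b, p). p(a := b)) (SIGMA b:B. bijections A (B - {b})) (bijections (insert a A) B)"
proof (rule bij_betwI[where g = "\<lambda>p. (p a, restrict p A)"])
  show "(\<lambda>(b, p). p(a := b)) \<in> (SIGMA b:B. bijections A (B - {b})) \<rightarrow> bijections (insert a A) B"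
  proof safe
    fix b p assume b: "b \<in> B" and p: "p \<in> bijections A (B - {b})"
    have "bij_betw (p(a := b)) (insert a A) (insert b (B - {b}))"
    proof -
      have "bij_betw (p(a := b)) A (B - {b}) = bij_betw p A (B - {b})"
        using assms by (intro bij_betw_cong) auto
      then have "bij_betw (p(a := b)) A (B - {b})" using p by (simp add: bijections_def)
      then show ?thesis using assms notIn_Un_bij_betw[of a A "p(a := b)" "B - {b}"] by simp
    qed
    moreover have "insert b (B - {b}) = B" using b by auto
    ultimately show "p(a := b) \<in> bijections (insert a A) B"
      using p b assms by (auto simp: bijections_def PiE_def extensional_def Pi_iff)
  qed
  show "(\<lambda>p. (p a, restrict p A)) \<in> bijections (insert a A) B \<rightarrow> (SIGMA b:B. bijections A (B - {b}))"
  proof safe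
    fix p assume p: "p \<in> bijections (insert a A) B"
    then show "p a \<in> B" by (auto simp: bijections_def bij_betw_def)
    have "bij_betw p A (B - {p a})"
      using p assms by (auto simp: bijections_def bij_betw_def inj_on_def)
    then have "bij_betw (restrict p A) A (B - {p a})"
      by (simp add: bij_betw_restrict_eq)
    then show "restrict p A \<in> bijections A (B - {p a})"
      by (auto simp: bijections_def bij_betw_def)
  qed
  show "(\<lambda>p. (p a, restrict p A)) ((\<lambda>(b, p). p(a := b)) x) = x"
    if "x \<in> (SIGMA b:B. bijections A (B - {b}))" for x
    using that assms by (auto simp: bijections_def PiE_def extensional_def fun_eq_iff)
  show "(\<lambda>(b, p). p(a := b)) ((\<lambda>p. (p a, restrict p A)) p) = p"
    if "p \<in> bijections (insert a A) B" for p
    using that assms by (auto simp: bijections_def PiE_def extensional_def fun_eq_iff)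
qed

text \<open>Peel off a point \<open>a\<close>: it can go to any point of its own colour, and
  deleting both ends keeps the two colour counts equal. Each class of size k thus contributes k!,
  which will cancel the k! in a Poisson probability.\<close>

lemma card_colour_preserving_bijections:
  assumes "finite A" "finite B" "finite C" "col ` B \<subseteq> C" "\<phi> ` A \<subseteq> C"
    and "\<And>J. J \<in> C \<Longrightarrow> card {b \<in> B. col b = J} = card {a \<in> A. \<phi> a = J}"
  shows "card {p \<in> bijections A B. \<forall>a\<in>A. col (p a) = \<phi> a} = (\<Prod>J\<in>C. fact (card {a \<in> A. \<phi> a = J}))"
  using assms(1,2,4-)
proof (induction A arbitrary: B rule: finite_induct)
  case empty
  have "B = {}"
  proof (rule ccontr)
    assume "B \<noteq> {}"
    then obtain b where b: "b \<in> B" by auto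
    then have "col b \<in> C" using empty by auto
    from empty(4)[OF this] have "{b' \<in> B. col b' = col b} = {}" using empty by auto
    with b show False by auto
  qed
  then show ?case by (simp add: bijections_def bij_betw_def)
next
  case (insert a A)
  let ?G = "\<lambda>A B. {p \<in> bijections A B. \<forall>a\<in>A. col (p a) = \<phi> a}"
  let ?B = "{b \<in> B. col b = \<phi> a}"
  have \<phi>a: "\<phi> a \<in> C" using insert by auto
  have eq: "?G (insert a A) B = (\<lambda>(b, p). p(a := b)) ` (SIGMA b:?B. ?G A (B - {b}))"
  proof (intro set_eqI iffI)
    fix q assume q: "q \<in> ?G (insert a A) B"
    then have "q \<in> bijections (insert a A) B" by auto
    then have "q \<in> (\<lambda>(b, p). p(a := b)) ` (SIGMA b:B. bijections A (B - {b}))"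
      by (simp only: bij_betw_imp_surj_on[OF bijections_insert[OF insert(2), of B]])
    then obtain b p where bp: "b \<in> B" "p \<in> bijections A (B - {b})" "q = p(a := b)"
      by auto
    show "q \<in> (\<lambda>(b, p). p(a := b)) ` (SIGMA b:?B. ?G A (B - {b}))"
    proof (rule image_eqI[of _ _ "(b, p)"])
      have "col (q a') = \<phi> a'" if "a' \<in> insert a A" for a' using q that by blast
      then have "col b = \<phi> a" "\<And>a'. a' \<in> A \<Longrightarrow> col (p a') = \<phi> a'"
        unfolding bp(3) using insert(2) by (metis fun_upd_same insertI1, metis fun_upd_other insertI2)
      then show "(b, p) \<in> (SIGMA b:?B. ?G A (B - {b}))" using bp by simp
    qed (simp add: bp)
  next
    fix q assume "q \<in> (\<lambda>(b, p). p(a := b)) ` (SIGMA b:?B. ?G A (B - {b}))"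
    then obtain b p where bp: "b \<in> ?B" "p \<in> ?G A (B - {b})" "q = p(a := b)" by auto
    then have "q \<in> (\<lambda>(b, p). p(a := b)) ` (SIGMA b:B. bijections A (B - {b}))"
      by (intro image_eqI[of _ _ "(b, p)"]) auto
    then have "q \<in> bijections (insert a A) B"
      by (simp only: bij_betw_imp_surj_on[OF bijections_insert[OF insert(2), of B]])
    then show "q \<in> ?G (insert a A) B" using bp insert(2) by auto
  qed
  have inj: "inj_on (\<lambda>(b, p). p(a := b)) (SIGMA b:?B. ?G A (B - {b}))"
    by (rule inj_on_subset[OF bij_betw_imp_inj_on[OF bijections_insert[OF insert(2), of B]]]) auto
  have cardG: "card (?G A (B - {b})) = (\<Prod>J\<in>C. fact (card {a \<in> A. \<phi> a = J}))" if b: "b \<in> ?B" for b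
  proof (rule insert.IH)
    show "finite (B - {b})" "col ` (B - {b}) \<subseteq> C" "\<phi> ` A \<subseteq> C" using insert by auto
    fix J assume J: "J \<in> C"
    show "card {b' \<in> B - {b}. col b' = J} = card {a \<in> A. \<phi> a = J}"
    proof (cases "J = \<phi> a")
      case True
      have "{b' \<in> B - {b}. col b' = J} = {b \<in> B. col b = J} - {b}" by auto
      moreover have "{x \<in> insert a A. \<phi> x = J} = insert a {a \<in> A. \<phi> a = J}" using True by auto
      ultimately show ?thesis using insert.prems(4)[OF J] True b insert.hyps insert.prems by simp
    next
      case False
      have "{b' \<in> B - {b}. col b' = J} = {b \<in> B. col b = J}" using False b by auto
      moreover have "{x \<in> insert a A. \<phi> x = J} = {a \<in> A. \<phi> a = J}" using False by auto
      ultimately show ?thesis using insert.prems(4)[OF J] by simp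
    qed
  qed
  have cB: "card ?B = Suc (card {x \<in> A. \<phi> x = \<phi> a})"
  proof -
    have "{x \<in> insert a A. \<phi> x = \<phi> a} = insert a {x \<in> A. \<phi> x = \<phi> a}" by auto
    then show ?thesis using insert.prems(4)[OF \<phi>a] insert.hyps by simp
  qed
  have fin: "finite (?G A (B - {b}))" for b
    using insert finite_bijections[of A "B - {b}"] by simp
  have "card (?G (insert a A) B) = (\<Sum>b\<in>?B. card (?G A (B - {b})))"
    unfolding eq using insert.prems fin by (subst card_image[OF inj]) (simp add: card_SigmaI)
  also have "\<dots> = card ?B * (\<Prod>J\<in>C. fact (card {a \<in> A. \<phi> a = J}))"
    by (simp add: cardG)
  also have "\<dots> = (\<Prod>J\<in>C. fact (card {x \<in> insert a A. \<phi> x = J}))"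
  proof -
    have e1: "{x \<in> insert a A. \<phi> x = J} = {x \<in> A. \<phi> x = J}" if "J \<noteq> \<phi> a" for J using that by auto
    have e2: "{x \<in> insert a A. \<phi> x = \<phi> a} = insert a {x \<in> A. \<phi> x = \<phi> a}" by auto
    have "(\<Prod>J\<in>C. fact (card {x \<in> insert a A. \<phi> x = J})) = (
        fact (card {x \<in> insert a A. \<phi> x = \<phi> a}) * (\<Prod>J\<in>C-{\<phi> a}. fact (card {x \<in> insert a A. \<phi> x = J})) :: nat)"
      using \<open>finite C\<close> \<phi>a by (rule prod.remove)
    also have "(\<Prod>J\<in>C-{\<phi> a}. fact (card {x \<in> insert a A. \<phi> x = J})) = (\<Prod>J\<in>C-{\<phi> a}. fact (card {x \<in> A. \<phi> x = J}))"
    proof (intro prod.cong refl)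
      fix J assume "J \<in> C - {\<phi> a}"
      then show "fact (card {x \<in> insert a A. \<phi> x = J}) = fact (card {x \<in> A. \<phi> x = J})"
        by (subst e1) auto
    qed
    also have "fact (card {x \<in> insert a A. \<phi> x = \<phi> a}) = card ?B * fact (card {x \<in> A. \<phi> x = \<phi> a})"
      unfolding e2 cB using insert.hyps by simp
    finally show ?thesis
      using prod.remove[OF \<open>finite C\<close> \<phi>a, of "\<lambda>J. fact (card {x \<in> A. \<phi> x = J}) :: nat"]
      by (simp only: mult.assoc)
  qed
  finally show ?case .
qed

lemma card_bijections:
  assumes "finite A"
  shows "card (bijections A A) = fact (card A)"
proof -
  have "card {p \<in> bijections A A. \<forall>a\<in>A. (\<lambda>_. ()) (p a) = (\<lambda>_. ()) a} =
      (\<Prod>J\<in>{()}. fact (card {a \<in> A. (\<lambda>_. ()) a = J}))"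
    by (rule card_colour_preserving_bijections) (use assms in auto)
  then show ?thesis by simp
qed

text \<open>An arbitrary enumeration, in general not measurable as a function of a random multiset; only
  sums over all orderings are.\<close>

definition enum :: "'a multiset \<Rightarrow> nat \<Rightarrow> 'a" where
  "enum X = (!) (SOME xs. mset xs = X)"

text \<open>Orderings are permutations of indices, so \<open>n\<close> points always give
  \<open>fact n\<close> terms, even if some of them coincide. The value 0 for other sizes lets a
  series over \<open>n\<close> pick out the actual number of points.\<close>

definition sum_orderings :: "nat \<Rightarrow> ((nat \<Rightarrow> 'a) \<Rightarrow> ennreal) \<Rightarrow> 'a multiset \<Rightarrow> ennreal" where
  "sum_orderings n f X =
     (if size X = n then \<Sum>p\<in>bijections {..<n} {..<n}. f (\<lambda>i\<in>{..<n}. enum X (p i)) else 0)"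

lemma enumE:
  obtains xs where "mset xs = X" "enum X = (!) xs" "length xs = size X"
proof -
  have "mset (SOME xs. mset xs = X) = X" by (rule someI_ex) (rule ex_mset)
  then show ?thesis by (intro that[of "SOME xs. mset xs = X"]) (auto simp: enum_def simp flip: size_mset)
qed

lemma size_filter_enum: "size {#x \<in># X. P x#} = card {i \<in> {..<size X}. P (enum X i)}"
proof -
  obtain xs where xs: "mset xs = X" "enum X = (!) xs" "length xs = size X" by (rule enumE)
  have "size (filter_mset P (mset xs)) = length (filter P xs)"
    by (simp flip: mset_filter)
  also have "\<dots> = card {i. i < length xs \<and> P (xs ! i)}" by (rule length_filter_conv_card)
  finally show ?thesis using xs by simp
qed

lemma set_mset_enum: "set_mset X = enum X ` {..<size X}"
proof -
  obtain xs where xs: "mset xs = X" "enum X = (!) xs" "length xs = size X" by (rule enumE)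
  have "set_mset X = set xs" using xs(1) by auto
  also have "\<dots> = (!) xs ` {..<length xs}" by (auto simp: set_conv_nth)
  finally show ?thesis using xs by simp
qed

context
  fixes M :: "'w measure" and L :: "'a measure" and \<eta> :: "'w \<Rightarrow> 'a multiset"
  assumes PP: "poisson_process M L \<eta>"
begin

lemma poisson_prob: "prob_space M" and poisson_finite: "finite_measure L"
  using PP by (auto simp: poisson_process_def)

lemma poisson_in_space: "\<omega> \<in> space M \<Longrightarrow> x \<in># \<eta> \<omega> \<Longrightarrow> x \<in> space L"
  using PP by (auto simp: poisson_process_def)

lemma poisson_enum_in_space: "\<omega> \<in> space M \<Longrightarrow> i < size (\<eta> \<omega>) \<Longrightarrow> enum (\<eta> \<omega>) i \<in> space L"
  by (rule poisson_in_space) (auto simp: set_mset_enum)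

lemma poisson_count_measurable:
  "A \<in> sets L \<Longrightarrow> (\<lambda>\<omega>. size {#x \<in># \<eta> \<omega>. x \<in> A#}) \<in> M \<rightarrow>\<^sub>M count_space UNIV"
  using PP by (auto simp: poisson_process_def)

text \<open>The colours split the space into finitely many cells with independent Poisson counts.
  Orderings that fit the box exist only if every cell has the prescribed count, and there are then
  as many as the product of the factorials of the counts. These factorials cancel those in the
  Poisson probabilities, and the exponentials multiply to the void probability of the whole
  space.\<close>

lemma sum_orderings_box:
  fixes n m :: nat
  assumes col: "\<And>x. x \<in> space L \<Longrightarrow> col x < m" "\<And>J. {x \<in> space L. col x = J} \<in> sets L"
    and \<phi>: "\<And>i. i < n \<Longrightarrow> \<phi> i < m" and m: "m > 0"
  defines "D \<equiv> Pi\<^sub>E {..<n} (\<lambda>i. {x \<in> space L. col x = \<phi> i})"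
  shows "(\<lambda>\<omega>. sum_orderings n (indicator D) (\<eta> \<omega>)) \<in> borel_measurable M"
    and "(\<integral>\<^sup>+\<omega>. sum_orderings n (indicator D) (\<eta> \<omega>) \<partial>M) =
         ennreal (exp (- measure L (space L))) * emeasure (\<Pi>\<^sub>M i\<in>{..<n}. L) D"
proof -
  interpret M: prob_space M by (rule poisson_prob)
  interpret L: finite_measure L by (rule poisson_finite)
  interpret P: product_sigma_finite "\<lambda>_::nat. L" ..
  define B where "B J = {x \<in> space L. col x = J}" for J
  define k where "k J = card {i \<in> {..<n}. \<phi> i = J}" for J
  define cnt where "cnt J \<omega> = size {#x \<in># \<eta> \<omega>. x \<in> B J#}" for J \<omega>
  define E where "E = (\<Inter>J\<in>{..<m}. cnt J -` {k J} \<inter> space M)"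
  have B[measurable]: "B J \<in> sets L" for J unfolding B_def by (rule col)
  have cnt[measurable]: "cnt J \<in> M \<rightarrow>\<^sub>M count_space UNIV" for J
    unfolding cnt_def by (rule poisson_count_measurable[OF B])
  have E[measurable]: "E \<in> sets M"
    unfolding E_def using m by (intro sets.finite_INT) auto
  have E_iff: "\<omega> \<in> E \<longleftrightarrow> (\<forall>J<m. cnt J \<omega> = k J)" if "\<omega> \<in> space M" for \<omega>
    unfolding E_def using that by (auto simp del: INT_simps)
  have sumk: "(\<Sum>J<m. k J) = n"
  proof -
    have "(\<Sum>J<m. k J) = card (\<Union>J<m. {i \<in> {..<n}. \<phi> i = J})"
      unfolding k_def by (subst card_UN_disjoint) auto
    also have "(\<Union>J<m. {i \<in> {..<n}. \<phi> i = J}) = {..<n}" using \<phi> by auto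
    finally show ?thesis by simp
  qed
  have disj: "disjoint_family_on B X" for X by (auto simp: disjoint_family_on_def B_def)
  have UB: "(\<Union>J<m. B J) = space L" using col(1) by (auto simp: B_def)
  have cnte: "cnt J \<omega> = card {i \<in> {..<size (\<eta> \<omega>)}. col (enum (\<eta> \<omega>) i) = J}" if "\<omega> \<in> space M" for J \<omega>
    unfolding cnt_def size_filter_enum
    by (rule arg_cong[of _ _ card]) (use that in \<open>auto simp: B_def poisson_enum_in_space\<close>)
  have sumcnt: "(\<Sum>J<m. cnt J \<omega>) = size (\<eta> \<omega>)" if "\<omega> \<in> space M" for \<omega>
  proof -
    have "(\<Sum>J<m. cnt J \<omega>) = card (\<Union>J<m. {i \<in> {..<size (\<eta> \<omega>)}. col (enum (\<eta> \<omega>) i) = J})"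
      unfolding cnte[OF that] by (subst card_UN_disjoint) auto
    also have "(\<Union>J<m. {i \<in> {..<size (\<eta> \<omega>)}. col (enum (\<eta> \<omega>) i) = J}) = {..<size (\<eta> \<omega>)}"
      using that col(1) by (auto simp: poisson_enum_in_space)
    finally show ?thesis by simp
  qed
  have main: "sum_orderings n (indicator D) (\<eta> \<omega>) = of_nat (\<Prod>J<m. fact (k J)) * indicator E \<omega>"
    if \<omega>: "\<omega> \<in> space M" for \<omega>
  proof (cases "size (\<eta> \<omega>) = n")
    case False
    then have "\<omega> \<notin> E"
      using sumcnt[OF \<omega>] sumk E_iff[OF \<omega>] by auto
    with False show ?thesis by (simp add: sum_orderings_def)
  next
    case True
    let ?e = "enum (\<eta> \<omega>)"
    let ?G = "{p \<in> bijections {..<n} {..<n}. \<forall>i\<in>{..<n}. col (?e (p i)) = \<phi> i}"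
    have fin: "finite (bijections {..<n} {..<n})" by (simp add: finite_bijections)
    have ind: "indicator D (\<lambda>i\<in>{..<n}. ?e (p i)) = (if p \<in> ?G then 1 else 0 :: ennreal)"
      if p: "p \<in> bijections {..<n} {..<n}" for p
    proof -
      have "p i < n" if "i < n" for i using p that by (auto simp: bijections_def bij_betw_def)
      then have "?e (p i) \<in> space L" if "i < n" for i using that True \<omega> by (auto intro: poisson_enum_in_space)
      then show ?thesis using p by (auto simp: D_def indicator_def)
    qed
    have "sum_orderings n (indicator D) (\<eta> \<omega>) = (\<Sum>p\<in>bijections {..<n} {..<n}. if p \<in> ?G then 1 else 0 :: ennreal)"
      unfolding sum_orderings_def using True by (simp add: ind cong: sum.cong)
    also have "\<dots> = of_nat (card ?G)"
      using fin by (simp add: sum.If_cases Int_def)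
    finally have 1: "sum_orderings n (indicator D) (\<eta> \<omega>) = of_nat (card ?G)" .
    show ?thesis
    proof (cases "\<omega> \<in> E")
      case True': True
      have "card ?G = (\<Prod>J\<in>{..<m}. fact (card {a \<in> {..<n}. \<phi> a = J}))"
      proof (rule card_colour_preserving_bijections[where col = "\<lambda>i. col (?e i)"])
        show "(\<lambda>i. col (?e i)) ` {..<n} \<subseteq> {..<m}"
          using True \<omega> col(1) by (auto intro: poisson_enum_in_space)
        fix J assume "J \<in> {..<m}"
        then have "cnt J \<omega> = k J" using True' E_iff[OF \<omega>] by auto
        then show "card {b \<in> {..<n}. col (?e b) = J} = card {a \<in> {..<n}. \<phi> a = J}"
          using cnte[OF \<omega>, of J] True by (simp add: k_def)
      qed (use \<phi> in auto)
      then show ?thesis using 1 True' by (simp add: k_def)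
    next
      case False
      \<comment> \<open>A fitting ordering maps the positions of each colour onto the points of that
        colour, so it would force all the counts.\<close>
      have "?G = {}"
      proof (rule ccontr)
        assume "?G \<noteq> {}"
        then obtain p where p: "bij_betw p {..<n} {..<n}" "\<And>i. i < n \<Longrightarrow> col (?e (p i)) = \<phi> i"
          by (auto simp: bijections_def)
        have "cnt J \<omega> = k J" for J
        proof -
          have "bij_betw p {i \<in> {..<n}. \<phi> i = J} {i \<in> {..<n}. col (?e i) = J}"
          proof (rule bij_betw_subset[OF p(1)])
            show "p ` {i \<in> {..<n}. \<phi> i = J} = {i \<in> {..<n}. col (?e i) = J}"
            proof (intro equalityI subsetI)
              fix j assume "j \<in> p ` {i \<in> {..<n}. \<phi> i = J}"
              then show "j \<in> {i \<in> {..<n}. col (?e i) = J}"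
                using p(2) bij_betwE[OF p(1)] by auto
            next
              fix j assume j: "j \<in> {i \<in> {..<n}. col (?e i) = J}"
              then have "j \<in> p ` {..<n}" by (simp add: bij_betw_imp_surj_on[OF p(1)])
              then obtain i where "i < n" "p i = j" by auto
              with j p(2)[of i] show "j \<in> p ` {i \<in> {..<n}. \<phi> i = J}" by auto
            qed
          qed auto
          then show ?thesis unfolding cnte[OF \<omega>] k_def True by (simp add: bij_betw_same_card)
        qed
        with False E_iff[OF \<omega>] show False by auto
      qed
      then show ?thesis using 1 False by (metis (no_types, lifting) card.empty indicator_simps(2) mult_zero_right of_nat_0)
    qed
  qed
  have "(\<lambda>\<omega>. of_nat (\<Prod>J<m. fact (k J)) * indicator E \<omega> :: ennreal) \<in> borel_measurable M" by measurable
  then show "(\<lambda>\<omega>. sum_orderings n (indicator D) (\<eta> \<omega>)) \<in> borel_measurable M"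
    by (simp add: main cong: measurable_cong)
  have ind: "M.indep_vars (\<lambda>_. count_space UNIV) cnt {..<m}"
  proof -
    have "(\<forall>i<m. B i \<in> sets L) \<and> disjoint_family_on B {..<m}" using disj B by auto
    with PP show ?thesis unfolding poisson_process_def cnt_def by blast
  qed
  have pr: "M.prob (cnt J -` {k J} \<inter> space M) = measure L (B J) ^ k J / fact (k J) * exp (- measure L (B J))" for J
  proof -
    have "cnt J -` {k J} \<inter> space M = {\<omega>\<in>space M. size {#x \<in># \<eta> \<omega>. x \<in> B J#} = k J}"
      by (auto simp: cnt_def)
    with PP B show ?thesis unfolding poisson_process_def by simp
  qed
  have prE: "M.prob E = (\<Prod>J<m. measure L (B J) ^ k J / fact (k J) * exp (- measure L (B J)))"
    unfolding E_def using m by (subst M.indep_varsD_finite[OF ind]) (auto simp: pr)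
  have "(\<integral>\<^sup>+\<omega>. sum_orderings n (indicator D) (\<eta> \<omega>) \<partial>M) =
      (\<integral>\<^sup>+\<omega>. of_nat (\<Prod>J<m. fact (k J)) * indicator E \<omega> \<partial>M)"
    by (intro nn_integral_cong main)
  also have "\<dots> = of_nat (\<Prod>J<m. fact (k J)) * emeasure M E"
    by (rule nn_integral_cmult_indicator) simp
  also have "\<dots> = ennreal (real (\<Prod>J<m. fact (k J)) * M.prob E)"
    by (simp add: M.emeasure_eq_measure ennreal_of_nat_eq_real_of_nat ennreal_mult del: of_nat_prod)
  also have "real (\<Prod>J<m. fact (k J)) * M.prob E = (\<Prod>J<m. measure L (B J) ^ k J * exp (- measure L (B J)))"
    unfolding prE by (simp flip: prod.distrib)
  also have "\<dots> = (\<Prod>J<m. measure L (B J) ^ k J) * exp (- (\<Sum>J<m. measure L (B J)))"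
    by (simp add: prod.distrib exp_sum sum_negf flip: sum_negf)
  also have "(\<Sum>J<m. measure L (B J)) = measure L (\<Union>J<m. B J)"
    by (subst L.finite_measure_finite_Union) (auto simp: disj)
  also have "(\<Prod>J<m. measure L (B J) ^ k J) = (\<Prod>i<n. measure L (B (\<phi> i)))"
  proof -
    have "(\<Prod>i<n. measure L (B (\<phi> i))) = (\<Prod>J<m. \<Prod>i\<in>{i \<in> {..<n}. \<phi> i = J}. measure L (B (\<phi> i)))"
      by (subst prod.group) (use \<phi> in auto)
    also have "\<dots> = (\<Prod>J<m. measure L (B J) ^ k J)" by (simp add: k_def)
    finally show ?thesis by simp
  qed
  also have "ennreal ((\<Prod>i<n. measure L (B (\<phi> i))) * exp (- measure L (\<Union>J<m. B J))) =
     ennreal (exp (- measure L (space L))) * (\<Prod>i<n. emeasure L (B (\<phi> i)))"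
    by (simp add: UB ennreal_mult prod_nonneg prod_ennreal L.emeasure_eq_measure mult.commute)
  also have "(\<Prod>i<n. emeasure L (B (\<phi> i))) = emeasure (\<Pi>\<^sub>M i\<in>{..<n}. L) D"
    unfolding D_def by (subst P.emeasure_PiM) (auto simp: B_def[symmetric])
  finally show "(\<integral>\<^sup>+\<omega>. sum_orderings n (indicator D) (\<eta> \<omega>) \<partial>M) =
         ennreal (exp (- measure L (space L))) * emeasure (\<Pi>\<^sub>M i\<in>{..<n}. L) D" .
qed

lemma sum_orderings_sum:
  "sum_orderings n (\<lambda>x. \<Sum>k\<in>K. f k x) X = (\<Sum>k\<in>K. sum_orderings n (f k) X)"
  unfolding sum_orderings_def by (simp add: sum.swap[of _ K])

lemma sum_orderings_cong:
  assumes \<omega>: "\<omega> \<in> space M" and fg: "\<And>x. x \<in> space (\<Pi>\<^sub>M i\<in>{..<n}. L) \<Longrightarrow> f x = g x"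
  shows "sum_orderings n f (\<eta> \<omega>) = sum_orderings n g (\<eta> \<omega>)"
proof (cases "size (\<eta> \<omega>) = n")
  case True
  have "(\<lambda>i\<in>{..<n}. enum (\<eta> \<omega>) (p i)) \<in> space (\<Pi>\<^sub>M i\<in>{..<n}. L)" if p: "p \<in> bijections {..<n} {..<n}" for p
  proof -
    have "p i < n" if "i < n" for i using p that by (auto simp: bijections_def bij_betw_def)
    then have "enum (\<eta> \<omega>) (p i) \<in> space L" if "i < n" for i using that True \<omega> by (auto intro: poisson_enum_in_space)
    then show ?thesis by (auto simp: space_PiM)
  qed
  then show ?thesis by (auto simp: sum_orderings_def fg intro!: sum.cong)
qed (simp add: sum_orderings_def)

definition janossy :: "nat \<Rightarrow> ((nat \<Rightarrow> 'a) \<Rightarrow> ennreal) \<Rightarrow> bool" where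
  "janossy n f \<longleftrightarrow> (\<lambda>\<omega>. sum_orderings n f (\<eta> \<omega>)) \<in> borel_measurable M \<and>
     (\<integral>\<^sup>+\<omega>. sum_orderings n f (\<eta> \<omega>) \<partial>M) =
       ennreal (exp (- measure L (space L))) * (\<integral>\<^sup>+x. f x \<partial>(\<Pi>\<^sub>M i\<in>{..<n}. L))"

lemma janossy_cong:
  assumes "\<And>x. x \<in> space (\<Pi>\<^sub>M i\<in>{..<n}. L) \<Longrightarrow> f x = g x"
  shows "janossy n f \<longleftrightarrow> janossy n g"
  unfolding janossy_def using assms
  by (simp add: sum_orderings_cong[where f=f and g=g] cong: measurable_cong nn_integral_cong)

lemma janossy_sum:
  assumes "\<And>k. k \<in> K \<Longrightarrow> janossy n (f k)" "\<And>k. k \<in> K \<Longrightarrow> f k \<in> borel_measurable (\<Pi>\<^sub>M i\<in>{..<n}. L)"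
  shows "janossy n (\<lambda>x. \<Sum>k\<in>K. f k x)"
  using assms unfolding janossy_def sum_orderings_sum
  by (auto simp: nn_integral_sum sum_distrib_left intro!: borel_measurable_sum)

lemma sum_orderings_suminf:
  "sum_orderings n (\<lambda>x. \<Sum>k. f k x) X = (\<Sum>k. sum_orderings n (f k) X)"
  unfolding sum_orderings_def by (simp add: suminf_sum[OF summableI])

lemma janossy_suminf:
  assumes "\<And>k. janossy n (f k)" "\<And>k. f k \<in> borel_measurable (\<Pi>\<^sub>M i\<in>{..<n}. L)"
  shows "janossy n (\<lambda>x. \<Sum>k. f k x)"
  using assms unfolding janossy_def sum_orderings_suminf
  by (auto simp: nn_integral_suminf intro!: borel_measurable_suminf_order)

text \<open>The map \<open>col\<close> sends a point to the atom, of the algebra generated by the sides, that contains it;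
  so a box splits into boxes with equal or disjoint sides.\<close>

lemma janossy_box:
  assumes A: "\<And>i. i < n \<Longrightarrow> A i \<in> sets L"
  shows "janossy n (indicator (Pi\<^sub>E {..<n} A))"
proof -
  \<comment> \<open>\<open>set_encode\<close> turns the set of sides that contain a point into a
    natural number, as the colours of \<open>sum_orderings_box\<close> are natural numbers.\<close>
  define col where "col x = set_encode {i \<in> {..<n}. x \<in> A i}" for x
  have "finite (range col)"
    by (rule finite_subset[of _ "set_encode ` Pow {..<n}"]) (auto simp: col_def)
  then obtain m where m: "\<And>x. col x < m"
    by (auto simp: finite_nat_iff_bounded)
  have m0: "m > 0" using m[of undefined] by simp
  have dec: "i \<in> set_decode (col x) \<longleftrightarrow> x \<in> A i" if "i < n" for i x
    using that by (simp add: col_def set_encode_inverse)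
  have col: "{x \<in> space L. col x = J} \<in> sets L" for J
  proof -
    have "{x \<in> space L. {i \<in> {..<n}. x \<in> A i} = I} \<in> sets L" for I
    proof -
      have "{x \<in> space L. {i \<in> {..<n}. x \<in> A i} = I} =
        (if I \<subseteq> {..<n} then {x \<in> space L. \<forall>i\<in>{..<n}. x \<in> A i \<longleftrightarrow> i \<in> I} else {})" by auto
      moreover have "{x \<in> space L. \<forall>i\<in>{..<n}. x \<in> A i \<longleftrightarrow> i \<in> I} \<in> sets L"
      proof (rule sets.sets_Collect_finite_All)
        fix i assume "i \<in> {..<n}"
        then have "A i \<in> sets L" using A by auto
        then show "{x \<in> space L. x \<in> A i \<longleftrightarrow> i \<in> I} \<in> sets L" by measurable
      qed simp
      ultimately show ?thesis by simp
    qed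
    moreover have "{x \<in> space L. col x = J} = {x \<in> space L. {i \<in> {..<n}. x \<in> A i} = set_decode J}"
    proof -
      have "col x = J \<longleftrightarrow> {i \<in> {..<n}. x \<in> A i} = set_decode J" for x
      proof -
        define I where "I = {i \<in> {..<n}. x \<in> A i}"
        have "finite I" by (simp add: I_def)
        then show ?thesis unfolding col_def I_def[symmetric]
          using set_encode_inverse[of I] set_decode_inverse[of J] by metis
      qed
      then show ?thesis by simp
    qed
    ultimately show ?thesis by simp
  qed
  define \<Phi> where "\<Phi> = {\<phi> \<in> {..<n} \<rightarrow>\<^sub>E {..<m}. \<forall>i<n. i \<in> set_decode (\<phi> i)}"
  have fin: "finite \<Phi>" unfolding \<Phi>_def by (rule finite_subset[of _ "{..<n} \<rightarrow>\<^sub>E {..<m}"]) (auto intro: finite_PiE)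
  define D where "D \<phi> = Pi\<^sub>E {..<n} (\<lambda>i. {x \<in> space L. col x = \<phi> i})" for \<phi>
  have D: "janossy n (indicator (D \<phi>))" "D \<phi> \<in> sets (\<Pi>\<^sub>M i\<in>{..<n}. L)" if "\<phi> \<in> \<Phi>" for \<phi>
  proof -
    have \<phi>: "\<And>i. i < n \<Longrightarrow> \<phi> i < m" using that by (auto simp: \<Phi>_def)
    show D2: "D \<phi> \<in> sets (\<Pi>\<^sub>M i\<in>{..<n}. L)"
      unfolding D_def by (intro sets_PiM_I_finite col) auto
    show "janossy n (indicator (D \<phi>))"
      using sum_orderings_box[of col m, OF m col \<phi> m0, where n=n] D2
      unfolding janossy_def D_def by simp
  qed
  have "(indicator (Pi\<^sub>E {..<n} A) x :: ennreal) = (\<Sum>\<phi>\<in>\<Phi>. indicator (D \<phi>) x)"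
    if x: "x \<in> space (\<Pi>\<^sub>M i\<in>{..<n}. L)" for x
  proof -
    let ?\<phi> = "\<lambda>i\<in>{..<n}. col (x i)"
    have "x \<in> D \<phi> \<longleftrightarrow> \<phi> = ?\<phi>" if "\<phi> \<in> \<Phi>" for \<phi>
      using x that by (fastforce simp: D_def space_PiM \<Phi>_def PiE_def Pi_iff extensional_def fun_eq_iff)
    then have "(\<Sum>\<phi>\<in>\<Phi>. indicator (D \<phi>) x) = (\<Sum>\<phi>\<in>\<Phi>. if \<phi> = ?\<phi> then 1 else 0 :: ennreal)"
      by (intro sum.cong) (auto simp: indicator_def)
    also have "\<dots> = (if ?\<phi> \<in> \<Phi> then 1 else 0)" using fin by (simp add: sum.delta)
    also have "?\<phi> \<in> \<Phi> \<longleftrightarrow> x \<in> Pi\<^sub>E {..<n} A"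
      using x m by (auto simp: \<Phi>_def dec space_PiM PiE_def)
    finally show ?thesis by (simp add: indicator_def)
  qed
  then have "janossy n (indicator (Pi\<^sub>E {..<n} A)) \<longleftrightarrow> janossy n (\<lambda>x. \<Sum>\<phi>\<in>\<Phi>. indicator (D \<phi>) x)"
    by (rule janossy_cong)
  also have "\<dots>" using D by (intro janossy_sum) auto
  finally show ?thesis .
qed

lemma sum_orderings_finite: "sum_orderings n (indicator A) X < \<top>"
  unfolding sum_orderings_def by (auto simp: ennreal_indicator[symmetric] sum_ennreal less_top[symmetric])

text \<open>Boxes are stable under intersection and generate the product sets, so it remains to pass
  to complements and disjoint unions. Complements need a subtraction, hence the finiteness of the
  sum over orderings and of the mass of the product.\<close>

lemma janossy_indicator:
  assumes "A \<in> sets (\<Pi>\<^sub>M i\<in>{..<n}. L)"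
  shows "janossy n (indicator A)"
proof -
  interpret M: prob_space M by (rule poisson_prob)
  interpret L: finite_measure L by (rule poisson_finite)
  interpret P: product_sigma_finite "\<lambda>_::nat. L" ..
  let ?P = "\<Pi>\<^sub>M i\<in>{..<n}. L"
  let ?\<Omega> = "\<Pi>\<^sub>E i\<in>{..<n}. space L"
  have \<Omega>: "janossy n (indicator ?\<Omega>)" by (rule janossy_box) auto
  have Pfin: "emeasure ?P ?\<Omega> < \<top>"
    by (subst P.emeasure_PiM) (auto simp: L.emeasure_eq_measure ennreal_power less_top[symmetric])
  have "A \<in> sigma_sets ?\<Omega> (prod_algebra {..<n} (\<lambda>_. L))" using assms by (simp add: sets_PiM)
  with Int_stable_prod_algebra prod_algebra_sets_into_space show ?thesis
  proof (induction rule: sigma_sets_induct_disjoint)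
    case (basic A)
    then obtain E where "A = Pi\<^sub>E {..<n} E" "E \<in> (\<Pi> i\<in>{..<n}. sets L)" by (rule prod_algebraE_all)
    then show ?case by (auto intro!: janossy_box)
  next
    case empty
    have "sum_orderings n (\<lambda>_. 0) X = 0" for X :: "'a multiset"
      unfolding sum_orderings_def by auto
    moreover have "indicator {} = (\<lambda>_::nat \<Rightarrow> 'a. 0 :: ennreal)" by auto
    ultimately show ?case unfolding janossy_def by simp
  next
    case (compl A)
    then have A[measurable]: "A \<in> sets ?P" by (simp add: sets_PiM)
    have A': "A \<subseteq> ?\<Omega>" using sets.sets_into_space[OF A] by (simp add: space_PiM)
    have \<Omega>m[measurable]: "?\<Omega> \<in> sets ?P" by (rule sets_PiM_I_finite) auto
    let ?f = "\<lambda>A \<omega>. sum_orderings n (indicator A) (\<eta> \<omega>)"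
    have add: "?f (?\<Omega> - A) \<omega> + ?f A \<omega> = ?f ?\<Omega> \<omega>" for \<omega>
    proof -
      have "(indicator (?\<Omega> - A) x + indicator A x :: ennreal) = indicator ?\<Omega> x" for x
        using A' by (auto simp: indicator_def)
      then show ?thesis by (simp add: sum_orderings_def flip: sum.distrib)
    qed
    have eq: "?f (?\<Omega> - A) \<omega> = ?f ?\<Omega> \<omega> - ?f A \<omega>" for \<omega>
      using sum_orderings_finite[of n A "\<eta> \<omega>"] by (simp flip: add)
    have [measurable]: "?f A \<in> borel_measurable M" "?f ?\<Omega> \<in> borel_measurable M"
      using compl \<Omega> by (auto simp: janossy_def)
    have m[measurable]: "?f (?\<Omega> - A) \<in> borel_measurable M" unfolding eq by measurable
    let ?c = "ennreal (exp (- measure L (space L)))"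
    have IA: "(\<integral>\<^sup>+\<omega>. ?f A \<omega> \<partial>M) = ?c * emeasure ?P A" using compl by (simp add: janossy_def)
    have "(\<integral>\<^sup>+\<omega>. ?f (?\<Omega> - A) \<omega> \<partial>M) + (\<integral>\<^sup>+\<omega>. ?f A \<omega> \<partial>M) = (\<integral>\<^sup>+\<omega>. ?f ?\<Omega> \<omega> \<partial>M)"
      by (subst nn_integral_add[symmetric]) (auto simp: add)
    also have "\<dots> = ?c * emeasure ?P ?\<Omega>" using \<Omega> by (simp add: janossy_def)
    also have "emeasure ?P ?\<Omega> = emeasure ?P (?\<Omega> - A) + emeasure ?P A"
      using A' by (subst plus_emeasure) (auto intro!: arg_cong[of _ _ "emeasure ?P"])
    finally have *: "(\<integral>\<^sup>+\<omega>. ?f (?\<Omega> - A) \<omega> \<partial>M) + ?c * emeasure ?P A = ?c * emeasure ?P (?\<Omega> - A) + ?c * emeasure ?P A"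
      by (simp add: IA distrib_left)
    have "emeasure ?P A \<le> emeasure ?P ?\<Omega>" using A' by (intro emeasure_mono) auto
    then have "?c * emeasure ?P A \<noteq> \<top>" using Pfin by (auto simp: ennreal_mult_eq_top_iff)
    with * have "(\<integral>\<^sup>+\<omega>. ?f (?\<Omega> - A) \<omega> \<partial>M) = ?c * emeasure ?P (?\<Omega> - A)"
      by (metis ennreal_add_diff_cancel_right)
    with m show ?case by (simp add: janossy_def)
  next
    case (union A)
    have A[measurable]: "A i \<in> sets ?P" for i using union by (auto simp: sets_PiM)
    have "indicator (\<Union>i. A i) = (\<lambda>x. \<Sum>i. indicator (A i) x :: ennreal)"
      using union by (auto simp: suminf_indicator)
    then show ?case using janossy_suminf[of n "\<lambda>i. indicator (A i)"] union by simp
  qed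
qed

text \<open>All \<open>fact n\<close> orderings are summed, so no factor 1 / n! appears here; it
  enters when the sum is divided by the number of orderings.\<close>

theorem janossy_formula:
  assumes "f \<in> borel_measurable (\<Pi>\<^sub>M i\<in>{..<n}. L)"
  shows "(\<lambda>\<omega>. sum_orderings n f (\<eta> \<omega>)) \<in> borel_measurable M"
    and "(\<integral>\<^sup>+\<omega>. sum_orderings n f (\<eta> \<omega>) \<partial>M) =
       ennreal (exp (- measure L (space L))) * (\<integral>\<^sup>+x. f x \<partial>(\<Pi>\<^sub>M i\<in>{..<n}. L))"
proof -
  have "janossy n f"
    using assms
  proof (induction rule: borel_measurable_induct)
    case (cong f g)
    then show ?case using janossy_cong by blast
  next
    case (set A)
    then show ?case by (rule janossy_indicator)
  next
    case (mult u c)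
    then have eq: "sum_orderings n (\<lambda>x. c * u x) X = c * sum_orderings n u X" for X
      by (simp add: sum_orderings_def sum_distrib_left)
    have [measurable]: "(\<lambda>\<omega>. sum_orderings n u (\<eta> \<omega>)) \<in> borel_measurable M" using mult by (simp add: janossy_def)
    have "(\<lambda>\<omega>. c * sum_orderings n u (\<eta> \<omega>)) \<in> borel_measurable M" by measurable
    then show ?case using mult unfolding janossy_def eq by (simp add: nn_integral_cmult mult.left_commute)
  next
    case (add u v)
    then have eq: "sum_orderings n (\<lambda>x. v x + u x) X = sum_orderings n v X + sum_orderings n u X" for X
      by (simp add: sum_orderings_def sum.distrib)
    have "(\<lambda>\<omega>. sum_orderings n v (\<eta> \<omega>) + sum_orderings n u (\<eta> \<omega>)) \<in> borel_measurable M"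
      using add by (intro borel_measurable_add) (auto simp: janossy_def)
    then show ?case using add unfolding janossy_def eq by (simp add: nn_integral_add distrib_left)
  next
    case (seq U)
    have eq: "sum_orderings n (\<lambda>x. SUP i. U i x) X = (SUP i. sum_orderings n (U i) X)" for X
      using seq(3) unfolding sum_orderings_def
      by (auto simp: incseq_def le_fun_def intro!: incseq_sumI2 ennreal_SUP_sum[symmetric])
    have inc: "incseq (\<lambda>i \<omega>. sum_orderings n (U i) (\<eta> \<omega>))"
      using seq(3) by (auto simp: sum_orderings_def incseq_def le_fun_def intro!: sum_mono)
    have m: "(\<lambda>\<omega>. sum_orderings n (U i) (\<eta> \<omega>)) \<in> borel_measurable M" for i
      using seq by (simp add: janossy_def)
    have SU: "Sup (range U) = (\<lambda>x. SUP i. U i x)" by (auto simp: fun_eq_iff image_comp)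
    show ?case unfolding janossy_def SU eq
      using seq m by (auto simp: nn_integral_monotone_convergence_SUP[OF inc] 
         nn_integral_monotone_convergence_SUP[OF seq(3)] janossy_def SUP_mult_left_ennreal)
  qed
  then show "(\<lambda>\<omega>. sum_orderings n f (\<eta> \<omega>)) \<in> borel_measurable M"
    "(\<integral>\<^sup>+\<omega>. sum_orderings n f (\<eta> \<omega>) \<partial>M) =
       ennreal (exp (- measure L (space L))) * (\<integral>\<^sup>+x. f x \<partial>(\<Pi>\<^sub>M i\<in>{..<n}. L))"
    by (auto simp: janossy_def)
qed

end

section \<open>Rotation invariance of the spherical measure\<close>

lemma nn_integral_lborel_translation:
  fixes f :: "'a::euclidean_space \<Rightarrow> ennreal"
  assumes [measurable]: "f \<in> borel_measurable borel"
  shows "(\<integral>\<^sup>+x. f (c + x) \<partial>lborel) = (\<integral>\<^sup>+x. f x \<partial>lborel)"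
  by (subst (2) lborel_distr_plus[of c, symmetric]) (simp add: nn_integral_distr)

lemma emeasure_unit_ball:
  "emeasure lborel (ball (0::'a::euclidean_space) 1) \<noteq> 0" "emeasure lborel (ball (0::'a) 1) \<noteq> \<top>"
proof -
  show fin: "emeasure lborel (ball (0::'a) 1) \<noteq> \<top>"
    using emeasure_lborel_ball_finite[of "0::'a" 1] by simp
  have "measure lborel (ball (0::'a) 1) > 0" by (rule content_ball_pos) simp
  then show "emeasure lborel (ball (0::'a) 1) \<noteq> 0"
    by (auto simp: measure_def)
qed

text \<open>Weil's argument for the uniqueness of invariant measures: evaluate
  \<open>\<integral>\<integral> 1_A (T x) * 1_B (y - T x)\<close> in both orders, where \<open>B\<close> is the unit ball.\<close>

lemma lborel_distr_isometry:
  fixes T :: "'a::euclidean_space \<Rightarrow> 'a"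
  assumes T: "linear T" and iso: "\<And>x. norm (T x) = norm x"
  shows "distr lborel borel T = lborel"
proof (rule measure_eqI)
  have [measurable]: "T \<in> borel_measurable borel"
    using linear_continuous_on[of T UNIV] T by (simp add: linear_conv_bounded_linear borel_measurable_continuous_onI)
  have inj: "inj T"
    using iso by (subst linear_injective_0[OF T]) (metis norm_eq_zero)
  then have "surj T" using T by (simp add: linear_injective_imp_surjective)
  then obtain T' where T': "T (T' y) = y" for y by (metis surjD)
  fix A assume "A \<in> sets (distr lborel borel T)"
  then have A[measurable]: "A \<in> sets borel" by simp
  let ?B = "ball 0 1 :: 'a set"
  have [measurable]: "?B \<in> sets borel" by simp
  have shift: "(\<integral>\<^sup>+x. f (y + T x) \<partial>lborel) = (\<integral>\<^sup>+x. f (T x) \<partial>lborel)"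
    if [measurable]: "f \<in> borel_measurable borel" for f :: "'a \<Rightarrow> ennreal" and y
    using nn_integral_lborel_translation[of "\<lambda>x. f (T x)" "T' y"]
    by (simp add: linear_add[OF T] T')
  have "(\<integral>\<^sup>+x. indicator A (T x) \<partial>lborel) * emeasure lborel ?B =
      (\<integral>\<^sup>+x. indicator A (T x) * (\<integral>\<^sup>+y. indicator ?B y \<partial>lborel) \<partial>lborel)"
    by (simp add: nn_integral_multc)
  also have "\<dots> = (\<integral>\<^sup>+x. indicator A (T x) * (\<integral>\<^sup>+y. indicator ?B (- T x + y) \<partial>lborel) \<partial>lborel)"
    by (subst nn_integral_lborel_translation) (auto intro!: borel_measurable_indicator)
  also have "\<dots> = (\<integral>\<^sup>+x. \<integral>\<^sup>+y. indicator A (T x) * indicator ?B (- T x + y) \<partial>lborel \<partial>lborel)"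
    by (subst nn_integral_cmult) measurable
  also have "\<dots> = (\<integral>\<^sup>+y. \<integral>\<^sup>+x. indicator A (T x) * indicator ?B (- T x + y) \<partial>lborel \<partial>lborel)"
    by (rule lborel_pair.Fubini') measurable
  \<comment> \<open>Translating \<open>x\<close> by a preimage of \<open>y\<close> under
    \<open>T\<close> replaces \<open>T x\<close> by \<open>y + T x\<close> and frees the ball
    indicator from \<open>y\<close>.\<close>
  also have "\<dots> = (\<integral>\<^sup>+y. \<integral>\<^sup>+x. indicator A (y + T x) * indicator ?B (- T x) \<partial>lborel \<partial>lborel)"
  proof (rule nn_integral_cong)
    fix y
    have "(\<lambda>u. indicator A u * indicator ?B (- u + y) :: ennreal) \<in> borel_measurable borel" by measurable
    from shift[OF this, of y]
    show "(\<integral>\<^sup>+x. indicator A (T x) * indicator ?B (- T x + y) \<partial>lborel) =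
      (\<integral>\<^sup>+x. indicator A (y + T x) * indicator ?B (- T x) \<partial>lborel)" by simp
  qed
  also have "\<dots> = (\<integral>\<^sup>+x. \<integral>\<^sup>+y. indicator A (y + T x) * indicator ?B (- T x) \<partial>lborel \<partial>lborel)"
    by (rule lborel_pair.Fubini') measurable
  \<comment> \<open>The isometry enters here: the ball is symmetric and preserved by
    \<open>T\<close>, so its indicator at \<open>- T x\<close> is that at \<open>x\<close>.\<close>
  also have "\<dots> = (\<integral>\<^sup>+x. (\<integral>\<^sup>+y. indicator A (T x + y) \<partial>lborel) * indicator ?B x \<partial>lborel)"
    by (subst nn_integral_multc) (auto simp: indicator_def iso add.commute)
  also have "\<dots> = (\<integral>\<^sup>+x. emeasure lborel A * indicator ?B x \<partial>lborel)"
    by (subst nn_integral_lborel_translation) (auto intro!: borel_measurable_indicator)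
  also have "\<dots> = emeasure lborel A * emeasure lborel ?B"
    by (subst nn_integral_cmult) auto
  finally have *: "(\<integral>\<^sup>+x. indicator A (T x) \<partial>lborel) * emeasure lborel ?B = emeasure lborel A * emeasure lborel ?B" .
  have "emeasure (distr lborel borel T) A = (\<integral>\<^sup>+x. indicator A (T x) \<partial>lborel)"
    by (subst nn_integral_indicator[symmetric]) (auto simp: nn_integral_distr simp del: nn_integral_indicator)
  with * show "emeasure (distr lborel borel T) A = emeasure lborel A"
    using emeasure_unit_ball[where 'a='a]
    by (metis ennreal_mult_cancel_left mult.commute)
qed simp

text \<open>Shifting by multiples of the period brings the window to a start \<open>r\<close> in [0,
  p); the part beyond \<open>p\<close> is then moved back by one period. Used to move a window of
  angles to where \<open>arctan (tan x) = x\<close>, or to centre it at a given angle.\<close>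

lemma nn_integral_periodic:
  fixes g :: "real \<Rightarrow> ennreal"
  assumes [measurable]: "g \<in> borel_measurable borel" and p: "p > 0" and per: "\<And>x. g (x + p) = g x"
  shows "(\<integral>\<^sup>+x\<in>{a..<a+p}. g x \<partial>lborel) = (\<integral>\<^sup>+x\<in>{b..<b+p}. g x \<partial>lborel)"
proof -
  have per_nat: "g (x + real k * p) = g x" for x k
  proof (induction k)
    case (Suc k)
    then show ?case using per[of "x + real k * p"] by (simp add: algebra_simps)
  qed simp
  have per_int: "g (x + of_int k * p) = g x" for x k
  proof (cases k)
    case (nonneg n) then show ?thesis using per_nat by simp
  next
    case (neg n)
    then have "real_of_int k = - real (Suc n)" by simp
    moreover have "x + of_int k * p + real (Suc n) * p = x + (of_int k + real (Suc n)) * p"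
      by (simp only: distrib_right add.assoc)
    ultimately have "x + of_int k * p + real (Suc n) * p = x" by simp
    then show ?thesis using per_nat[of "x + of_int k * p" "Suc n"] by metis
  qed
  have sh: "(\<integral>\<^sup>+x\<in>{a + of_int k * p..<b + of_int k * p}. g x \<partial>lborel) = (\<integral>\<^sup>+x\<in>{a..<b}. g x \<partial>lborel)" for a b k
  proof -
    have "(\<integral>\<^sup>+x\<in>{a + of_int k * p..<b + of_int k * p}. g x \<partial>lborel) =
       (\<integral>\<^sup>+x. g (of_int k * p + x) * indicator {a + of_int k * p..<b + of_int k * p} (of_int k * p + x) \<partial>lborel)"
      by (subst nn_integral_lborel_translation) (auto intro!: borel_measurable_indicator)
    also have "\<dots> = (\<integral>\<^sup>+x\<in>{a..<b}. g x \<partial>lborel)"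
      using per_int[of _ k] by (intro nn_integral_cong) (auto simp: indicator_def add.commute)
    finally show ?thesis .
  qed
  have split: "(\<integral>\<^sup>+x\<in>{a..<c}. g x \<partial>lborel) = (\<integral>\<^sup>+x\<in>{a..<b}. g x \<partial>lborel) + (\<integral>\<^sup>+x\<in>{b..<c}. g x \<partial>lborel)"
    if "a \<le> b" "b \<le> c" for a b c
    by (subst nn_integral_add[symmetric]) (use that in \<open>auto intro!: nn_integral_cong simp: indicator_def\<close>)
  have base: "(\<integral>\<^sup>+x\<in>{a..<a+p}. g x \<partial>lborel) = (\<integral>\<^sup>+x\<in>{0..<p}. g x \<partial>lborel)" for a
  proof -
    define k where "k = \<lfloor>a / p\<rfloor>"
    define r where "r = a - of_int k * p"
    have k: "of_int k \<le> a / p" "a / p < of_int k + 1" by (auto simp: k_def)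
    have r: "0 \<le> r" "r < p" using p k by (auto simp: r_def field_simps)
    have "(\<integral>\<^sup>+x\<in>{a..<a+p}. g x \<partial>lborel) = (\<integral>\<^sup>+x\<in>{r..<r+p}. g x \<partial>lborel)"
      using sh[of r k "r + p"] by (simp add: r_def add.commute add.left_commute)
    also have "\<dots> = (\<integral>\<^sup>+x\<in>{r..<p}. g x \<partial>lborel) + (\<integral>\<^sup>+x\<in>{p..<r+p}. g x \<partial>lborel)"
      using r by (intro split) auto
    also have "(\<integral>\<^sup>+x\<in>{p..<r+p}. g x \<partial>lborel) = (\<integral>\<^sup>+x\<in>{0..<r}. g x \<partial>lborel)"
      using sh[of 0 1 r] by simp
    also have "(\<integral>\<^sup>+x\<in>{r..<p}. g x \<partial>lborel) + (\<integral>\<^sup>+x\<in>{0..<r}. g x \<partial>lborel) = (\<integral>\<^sup>+x\<in>{0..<p}. g x \<partial>lborel)"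
      using r by (subst split[of 0 r p]) (auto simp: add.commute)
    finally show ?thesis .
  qed
  show ?thesis using base[of a] base[of b] by simp
qed

text \<open>For orthonormal \<open>v, w\<close>, the rotation by \<open>\<theta>\<close> in their
  plane that fixes the orthogonal complement. Written as \<open>z\<close> plus a correction in the
  plane, it needs no basis and is visibly measurable in \<open>z\<close> and \<open>\<theta>\<close>
  jointly, as the use of Fubini requires.\<close>

definition rotation :: "'a::real_inner \<Rightarrow> 'a \<Rightarrow> real \<Rightarrow> 'a \<Rightarrow> 'a" where
  "rotation v w \<theta> z = z + ((z \<bullet> v) * (cos \<theta> - 1) - (z \<bullet> w) * sin \<theta>) *\<^sub>R v
                     + ((z \<bullet> v) * sin \<theta> + (z \<bullet> w) * (cos \<theta> - 1)) *\<^sub>R w"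

lemma rotation_inner:
  assumes "norm v = 1" "norm w = 1" "v \<bullet> w = 0"
  shows "rotation v w \<theta> z \<bullet> v = (z \<bullet> v) * cos \<theta> - (z \<bullet> w) * sin \<theta>"
    and "rotation v w \<theta> z \<bullet> w = (z \<bullet> v) * sin \<theta> + (z \<bullet> w) * cos \<theta>"
proof -
  have "v \<bullet> v = 1" "w \<bullet> w = 1" "w \<bullet> v = 0" "v \<bullet> w = 0"
    using assms by (auto simp: dot_square_norm inner_commute)
  then show "rotation v w \<theta> z \<bullet> v = (z \<bullet> v) * cos \<theta> - (z \<bullet> w) * sin \<theta>"
    "rotation v w \<theta> z \<bullet> w = (z \<bullet> v) * sin \<theta> + (z \<bullet> w) * cos \<theta>"
    by (auto simp: rotation_def inner_add_left algebra_simps)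
qed

lemma linear_rotation: "linear (rotation v w \<theta>)"
  by (rule linearI) (auto simp: rotation_def inner_add_left algebra_simps)

lemma norm_rotation:
  assumes "norm v = 1" "norm w = 1" "v \<bullet> w = 0"
  shows "norm (rotation v w \<theta> z) = norm z"
proof -
  have o: "v \<bullet> v = 1" "w \<bullet> w = 1" "w \<bullet> v = 0" "v \<bullet> w = 0"
    using assms by (auto simp: dot_square_norm inner_commute)
  define p where "p = (z \<bullet> v) * (cos \<theta> - 1) - (z \<bullet> w) * sin \<theta>"
  define q where "q = (z \<bullet> v) * sin \<theta> + (z \<bullet> w) * (cos \<theta> - 1)"
  have "rotation v w \<theta> z \<bullet> rotation v w \<theta> z = z \<bullet> z + 2 * p * (z \<bullet> v) + 2 * q * (z \<bullet> w) + p\<^sup>2 + q\<^sup>2"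
    unfolding rotation_def p_def[symmetric] q_def[symmetric]
    by (simp add: inner_add_left inner_add_right o inner_commute[of v z] inner_commute[of w z] power2_eq_square algebra_simps)
  also have "2 * p * (z \<bullet> v) + 2 * q * (z \<bullet> w) + p\<^sup>2 + q\<^sup>2 = 0"
  proof -
    have "2 * p * (z \<bullet> v) + 2 * q * (z \<bullet> w) + p\<^sup>2 + q\<^sup>2 =
      ((z \<bullet> v)\<^sup>2 + (z \<bullet> w)\<^sup>2) * ((sin \<theta>)\<^sup>2 + (cos \<theta>)\<^sup>2 - 1)"
      unfolding p_def q_def by (simp only: power2_eq_square) algebra
    then show ?thesis by simp
  qed
  then have "z \<bullet> z + 2 * p * (z \<bullet> v) + 2 * q * (z \<bullet> w) + p\<^sup>2 + q\<^sup>2 = z \<bullet> z" by simp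
  finally show ?thesis by (simp add: norm_eq_sqrt_inner)
qed

lemma rotation_measurable[measurable]:
  "(\<lambda>(z, \<theta>). rotation (v :: 'a::euclidean_space) w \<theta> z) \<in> borel_measurable (borel \<Otimes>\<^sub>M borel)"
  unfolding rotation_def by measurable

section \<open>Uniform angles in the unit ball\<close>

lemma AE_lborel_not_in_hyperplane:
  fixes v :: "'a::euclidean_space"
  assumes "v \<noteq> 0"
  shows "AE z in lborel. z \<bullet> v \<noteq> 0"
proof -
  have "{z. v \<bullet> z = 0} \<in> null_sets lebesgue"
    using negligible_hyperplane[of v 0] assms by (simp add: negligible_iff_null_sets)
  moreover have "{z. v \<bullet> z = 0} \<in> sets lborel" by measurable
  ultimately have "{z. v \<bullet> z = 0} \<in> null_sets lborel" using null_sets_completion_iff by blast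
  then show ?thesis by (rule AE_I') (auto simp: inner_commute)
qed

text \<open>The function \<open>pi / 2 + arctan (tan x)\<close> has period pi and equals
  \<open>pi / 2 + x\<close> on (-pi/2, pi/2): over any period it is uniform on (0, pi).\<close>

lemma nn_integral_arctan_tan:
  assumes s: "0 \<le> s" "s < pi"
  shows "(\<integral>\<^sup>+x\<in>{a..<a+pi}. indicator {x. pi / 2 + arctan (tan x) > s} x \<partial>lborel) = ennreal (pi - s)"
proof -
  let ?K = "\<lambda>x. indicator {x. pi / 2 + arctan (tan x) > s} x :: ennreal"
  have [measurable]: "(tan :: real \<Rightarrow> real) \<in> borel_measurable borel"
    unfolding tan_def[abs_def] by measurable
  have "(\<integral>\<^sup>+x\<in>{a..<a+pi}. ?K x \<partial>lborel) = (\<integral>\<^sup>+x\<in>{-pi/2..<-pi/2+pi}. ?K x \<partial>lborel)"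
    by (rule nn_integral_periodic) (auto simp: indicator_def)
  also have "\<dots> = (\<integral>\<^sup>+x. indicator {s - pi/2<..<pi/2} x \<partial>lborel)"
  proof (rule nn_integral_cong_AE)
    have "AE x in lborel. x \<noteq> - pi/2" by (rule AE_lborel_singleton)
    then show "AE x in lborel. ?K x * indicator {-pi/2..<-pi/2+pi} x = indicator {s - pi/2<..<pi/2} x"
    proof eventually_elim
      case (elim x)
      show ?case
      proof (cases "-pi/2 < x \<and> x < pi/2")
        case True
        then have "arctan (tan x) = x" by (intro arctan_tan) auto
        then show ?thesis using True s by (auto simp: indicator_def)
      next
        case False
        then show ?thesis using elim s by (auto simp: indicator_def)
      qed
    qed
  qed
  also have "\<dots> = ennreal (pi - s)" using s by simp
  finally show ?thesis .
qed

text \<open>The measure of the set does not change under rotations in the plane of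
  \<open>v, w\<close>, so it equals its average over the angles in [0, pi). After exchanging the
  integrals, a fixed point \<open>z\<close> only has its polar angle shifted by
  \<open>\<theta>\<close>, and the average is one-dimensional. Half a turn is enough as the angle
  matters modulo pi.\<close>

lemma ball_angle_measure:
  fixes v w :: "'a::euclidean_space"
  assumes o: "norm v = 1" "norm w = 1" "v \<bullet> w = 0" and s: "0 \<le> s" "s < pi"
  shows "emeasure lborel {z \<in> ball 0 1. pi / 2 + arctan ((z \<bullet> w) / (z \<bullet> v)) > s} =
    ennreal (1 - s / pi) * emeasure lborel (ball 0 1 :: 'a set)"
proof -
  let ?B = "ball 0 1 :: 'a set"
  have [measurable]: "?B \<in> sets borel" by simp
  define A where "A = {z :: 'a. pi / 2 + arctan ((z \<bullet> w) / (z \<bullet> v)) > s}"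
  have A[measurable]: "A \<in> sets borel" unfolding A_def by measurable
  have rot: "emeasure lborel (?B \<inter> A) = (\<integral>\<^sup>+z. indicator ?B z * indicator A (rotation v w \<theta> z) \<partial>lborel)" for \<theta>
  proof -
    have [measurable]: "rotation v w \<theta> \<in> borel_measurable borel"
      unfolding rotation_def by measurable
    have "emeasure lborel (?B \<inter> A) = emeasure (distr lborel borel (rotation v w \<theta>)) (?B \<inter> A)"
      by (simp add: lborel_distr_isometry linear_rotation norm_rotation o)
    also have "\<dots> = (\<integral>\<^sup>+z. indicator (?B \<inter> A) (rotation v w \<theta> z) \<partial>lborel)"
      by (subst nn_integral_indicator[symmetric], simp, subst nn_integral_distr) measurable
    also have "\<dots> = (\<integral>\<^sup>+z. indicator ?B z * indicator A (rotation v w \<theta> z) \<partial>lborel)"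
      by (intro nn_integral_cong) (auto simp: indicator_def norm_rotation o)
    finally show ?thesis .
  qed
  have "emeasure lborel (?B \<inter> A) * ennreal pi = (\<integral>\<^sup>+\<theta>\<in>{0..<pi}. emeasure lborel (?B \<inter> A) \<partial>lborel)"
    by (subst nn_integral_cmult) (auto simp del: mult_cancel_left)
  also have "\<dots> = (\<integral>\<^sup>+\<theta>. \<integral>\<^sup>+z. indicator ?B z * indicator A (rotation v w \<theta> z) * indicator {0..<pi} \<theta> \<partial>lborel \<partial>lborel)"
  proof (rule nn_integral_cong)
    fix \<theta> :: real
    show "emeasure lborel (?B \<inter> A) * indicator {0..<pi} \<theta> =
      (\<integral>\<^sup>+z. indicator ?B z * indicator A (rotation v w \<theta> z) * indicator {0..<pi} \<theta> \<partial>lborel)"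
      by (subst rot[of \<theta>], subst nn_integral_multc) measurable
  qed
  also have "\<dots> = (\<integral>\<^sup>+z. \<integral>\<^sup>+\<theta>. indicator ?B z * indicator A (rotation v w \<theta> z) * indicator {0..<pi} \<theta> \<partial>lborel \<partial>lborel)"
    by (rule lborel_pair.Fubini') measurable
  also have "\<dots> = (\<integral>\<^sup>+z. indicator ?B z * ennreal (pi - s) \<partial>lborel)"
  proof (rule nn_integral_cong_AE)
    \<comment> \<open>Off this null hyperplane the projection of \<open>z\<close> to the plane is
      nonzero and has a polar angle.\<close>
    have "AE z in lborel. z \<bullet> v \<noteq> 0" using o by (intro AE_lborel_not_in_hyperplane) auto
    then show "AE z in lborel. (\<integral>\<^sup>+\<theta>. indicator ?B z * indicator A (rotation v w \<theta> z) * indicator {0..<pi} \<theta> \<partial>lborel)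
      = indicator ?B z * ennreal (pi - s)"
    proof eventually_elim
      case (elim z)
      define r where "r = cmod (Complex (z \<bullet> v) (z \<bullet> w))"
      define \<phi> where "\<phi> = Arg (Complex (z \<bullet> v) (z \<bullet> w))"
      have r: "r > 0" using elim by (auto simp: r_def complex_eq_iff)
      have "Complex (z \<bullet> v) (z \<bullet> w) = rcis r \<phi>" by (simp add: r_def \<phi>_def rcis_cmod_Arg)
      then have zv: "z \<bullet> v = r * cos \<phi>" "z \<bullet> w = r * sin \<phi>" by (auto simp: complex_eq_iff)
      have "rotation v w \<theta> z \<in> A \<longleftrightarrow> pi / 2 + arctan (tan (\<phi> + \<theta>)) > s" for \<theta>
      proof -
        have "rotation v w \<theta> z \<bullet> v = r * cos (\<phi> + \<theta>)" "rotation v w \<theta> z \<bullet> w = r * sin (\<phi> + \<theta>)"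
          by (auto simp: rotation_inner o zv cos_add sin_add algebra_simps)
        then show ?thesis using r by (simp add: A_def tan_def)
      qed
      then have "(\<integral>\<^sup>+\<theta>. indicator ?B z * indicator A (rotation v w \<theta> z) * indicator {0..<pi} \<theta> \<partial>lborel) =
        (\<integral>\<^sup>+\<theta>. indicator ?B z * (indicator {x. pi / 2 + arctan (tan x) > s} (\<phi> + \<theta>) * indicator {\<phi>..<\<phi>+pi} (\<phi> + \<theta>)) \<partial>lborel)"
        by (intro nn_integral_cong) (auto simp: indicator_def)
      also have "\<dots> = indicator ?B z * (\<integral>\<^sup>+\<theta>. indicator {x. pi / 2 + arctan (tan x) > s} \<theta> * indicator {\<phi>..<\<phi>+pi} \<theta> \<partial>lborel)"
        unfolding tan_def
        by (subst nn_integral_cmult, measurable, subst nn_integral_lborel_translation) auto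
      also have "\<dots> = indicator ?B z * ennreal (pi - s)" using nn_integral_arctan_tan[OF s, of \<phi>] by simp
      finally show ?case .
    qed
  qed
  also have "\<dots> = emeasure lborel ?B * ennreal (pi - s)"
    by (subst nn_integral_multc) auto
  finally have *: "emeasure lborel (?B \<inter> A) * ennreal pi = emeasure lborel ?B * ennreal (pi - s)" .
  have "emeasure lborel (?B \<inter> A) = emeasure lborel (?B \<inter> A) * (ennreal pi * ennreal (1 / pi))"
    by (simp flip: ennreal_mult)
  also have "\<dots> = emeasure lborel ?B * (ennreal (pi - s) * ennreal (1 / pi))"
    by (simp add: * flip: mult.assoc)
  also have "ennreal (pi - s) * ennreal (1 / pi) = ennreal (1 - s / pi)"
    using s by (simp add: diff_divide_distrib flip: ennreal_mult)
  finally show ?thesis by (simp add: A_def Int_def mult.commute)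
qed

section \<open>The normalised spherical measure\<close>

lemma space_sphere_measure[simp]: "space (sphere_measure :: 'a::euclidean_space measure) = sphere 0 1"
  by (auto simp: sphere_measure_def space_restrict_space)

lemma measurable_sphere_measure[measurable]: "(\<lambda>x. x) \<in> (sphere_measure :: 'a::euclidean_space measure) \<rightarrow>\<^sub>M borel"
  by (simp add: sphere_measure_def measurable_restrict_space1)

text \<open>For a set that is invariant under positive scaling, the preimage under
  \<open>sgn\<close> is the set itself up to the centre, so the spherical measure becomes a ratio of
  volumes in the ball.\<close>

lemma emeasure_sphere_measure:
  fixes A :: "'a::euclidean_space set"
  assumes A[measurable]: "A \<in> sets borel"
    and sgnA: "\<And>z. z \<noteq> 0 \<Longrightarrow> sgn z \<in> A \<longleftrightarrow> z \<in> A"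
  shows "emeasure sphere_measure (sphere 0 1 \<inter> A) = emeasure lborel (ball 0 1 \<inter> A) / emeasure lborel (ball 0 1 :: 'a set)"
proof -
  let ?U = "uniform_measure lborel (ball 0 1 :: 'a set)"
  have [measurable]: "(sgn :: 'a \<Rightarrow> 'a) \<in> borel_measurable borel" unfolding sgn_div_norm[abs_def] by measurable
  have S[measurable]: "sphere (0::'a) 1 \<in> sets borel" by simp
  have "emeasure sphere_measure (sphere 0 1 \<inter> A) = emeasure (distr ?U borel sgn) (sphere 0 1 \<inter> A)"
    unfolding sphere_measure_def by (rule emeasure_restrict_space) auto
  also have "\<dots> = emeasure ?U (sgn -` (sphere 0 1 \<inter> A))"
    by (subst emeasure_distr) (auto cong: measurable_cong_sets)
  also have "\<dots> = emeasure lborel (ball 0 1 \<inter> sgn -` (sphere 0 1 \<inter> A)) / emeasure lborel (ball 0 1 :: 'a set)"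
  proof (rule emeasure_uniform_measure)
    show "sgn -` (sphere 0 1 \<inter> A) \<in> sets lborel"
      using measurable_sets[of sgn borel borel "sphere 0 1 \<inter> A"] by simp
  qed simp
  also have "emeasure lborel (ball 0 1 \<inter> sgn -` (sphere 0 1 \<inter> A)) = emeasure lborel (ball 0 1 \<inter> A)"
  proof (rule emeasure_eq_AE)
    have "AE z in lborel. z \<noteq> (0::'a)" by (rule AE_lborel_singleton)
    then show "AE z in lborel. z \<in> ball 0 1 \<inter> sgn -` (sphere 0 1 \<inter> A) \<longleftrightarrow> z \<in> ball 0 1 \<inter> A"
      by eventually_elim (auto simp: sgnA norm_sgn)
    show "ball 0 1 \<inter> sgn -` (sphere 0 1 \<inter> A) \<in> sets lborel"
      using measurable_sets[of sgn borel borel "sphere 0 1 \<inter> A"] by (intro sets.Int) simp_all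
  qed simp
  finally show ?thesis .
qed

lemma prob_space_sphere_measure: "prob_space (sphere_measure :: 'a::euclidean_space measure)"
proof
  show "emeasure (sphere_measure :: 'a measure) (space sphere_measure) = 1"
    using emeasure_sphere_measure[of "UNIV :: 'a set"] emeasure_unit_ball[where 'a='a]
    by (simp add: ennreal_divide_self less_top)
qed

text \<open>Applied to the span of fewer vectors than the dimension: a further random point almost
  surely avoids it.\<close>

lemma emeasure_sphere_measure_subspace:
  fixes H :: "'a::euclidean_space set"
  assumes "subspace H" "dim H < DIM('a)"
  shows "emeasure sphere_measure (sphere 0 1 \<inter> H) = 0"
proof -
  have H: "H \<in> sets borel" by (intro borel_closed closed_subspace assms)
  have "H \<in> null_sets lebesgue" using negligible_lowdim[OF assms(2)] by (simp add: negligible_iff_null_sets)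
  then have "H \<in> null_sets lborel" using H null_sets_completion_iff[of H lborel] by simp
  moreover have "emeasure lborel (ball 0 1 \<inter> H) \<le> emeasure lborel H"
    by (rule emeasure_mono) (use H in simp_all)
  ultimately have "emeasure lborel (ball 0 1 \<inter> H) = 0" by (simp add: null_setsD1)
  moreover have "sgn z \<in> H \<longleftrightarrow> z \<in> H" if "z \<noteq> 0" for z
  proof
    assume "sgn z \<in> H"
    then have "norm z *\<^sub>R sgn z \<in> H" using assms(1) by (rule subspace_scale[rotated])
    then show "z \<in> H" using that by (simp add: sgn_div_norm)
  qed (simp add: sgn_div_norm subspace_scale assms(1))
  ultimately show ?thesis using emeasure_sphere_measure[OF H] by simp
qed

lemma emeasure_sphere_measure_angle:
  fixes v w :: "'a::euclidean_space"
  assumes "norm v = norm w" "v \<noteq> 0" "v \<bullet> w = 0" and s: "0 \<le> s" "s < pi"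
  shows "emeasure sphere_measure {z \<in> sphere 0 1. pi / 2 + arctan ((z \<bullet> w) / (z \<bullet> v)) > s} = ennreal (1 - s / pi)"
proof -
  let ?B = "ball 0 1 :: 'a set"
  have [measurable]: "?B \<in> sets borel" by simp
  let ?A = "{z. pi / 2 + arctan ((z \<bullet> w) / (z \<bullet> v)) > s}"
  note fin = emeasure_unit_ball[where 'a='a]
  have eq: "(z \<bullet> w) / (z \<bullet> v) = (z \<bullet> sgn w) / (z \<bullet> sgn v)" for z
    using assms by (simp add: sgn_div_norm)
  have "emeasure sphere_measure (sphere 0 1 \<inter> ?A) = emeasure lborel (?B \<inter> ?A) / emeasure lborel ?B"
    by (rule emeasure_sphere_measure) (measurable, auto simp: sgn_div_norm)
  also have "emeasure lborel (?B \<inter> ?A) = ennreal (1 - s / pi) * emeasure lborel ?B"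
  proof -
    have "norm (sgn v) = 1" "norm (sgn w) = 1" "sgn v \<bullet> sgn w = 0"
      using assms by (auto simp: norm_sgn) (auto simp: sgn_div_norm)
    from ball_angle_measure[OF this s] show ?thesis by (simp add: Int_def flip: eq)
  qed
  also have "\<dots> / emeasure lborel ?B = ennreal (1 - s / pi)"
    using fin by (simp add: ennreal_mult_divide_eq)
  finally show ?thesis by (simp add: Int_def)
qed

section \<open>Length of circular arcs\<close>

definition circle_at :: "'a::real_inner \<Rightarrow> 'a \<Rightarrow> real \<Rightarrow> 'a" where
  "circle_at v w \<theta> = cos \<theta> *\<^sub>R v + sin \<theta> *\<^sub>R w"

lemma dist_circle_at:
  assumes "norm v = 1" "norm w = 1" "v \<bullet> w = 0"
  shows "dist (circle_at v w x) (circle_at v w y) = 2 * \<bar>sin ((x - y) / 2)\<bar>"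
proof -
  have o: "v \<bullet> v = 1" "w \<bullet> w = 1" "w \<bullet> v = 0" "v \<bullet> w = 0"
    using assms by (auto simp: dot_square_norm inner_commute)
  have "circle_at v w x - circle_at v w y = (cos x - cos y) *\<^sub>R v + (sin x - sin y) *\<^sub>R w"
    by (simp add: circle_at_def algebra_simps)
  then have "(dist (circle_at v w x) (circle_at v w y))\<^sup>2 = (cos x - cos y)\<^sup>2 + (sin x - sin y)\<^sup>2"
    unfolding dist_norm power2_norm_eq_inner
    by (simp add: inner_add_left inner_add_right o power2_eq_square)
  also have "\<dots> = 2 - 2 * cos (x - y)"
  proof -
    have "(cos x)\<^sup>2 + (sin x)\<^sup>2 = 1" "(cos y)\<^sup>2 + (sin y)\<^sup>2 = 1" by simp_all
    then show ?thesis unfolding cos_diff power2_eq_square by (simp only: algebra_simps)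
  qed
  also have "\<dots> = (2 * \<bar>sin ((x - y) / 2)\<bar>)\<^sup>2"
  proof -
    have "2 * ((x - y) / 2) = x - y" by (simp only: mult_2 field_sum_of_halves)
    then have "cos (x - y) = 1 - 2 * (sin ((x - y) / 2))\<^sup>2"
      using cos_double_sin[of "(x - y) / 2"] by (simp only:)
    then show ?thesis by (simp add: power_mult_distrib)
  qed
  finally show ?thesis by (rule power2_eq_imp_eq) auto
qed

text \<open>This is \<open>x \<le> tan x\<close> in a form that survives at pi / 2; the difference
  of the sides has derivative \<open>y * sin y\<close>.\<close>

lemma x_cos_le_sin:
  fixes x :: real
  assumes "0 \<le> x" "x \<le> pi / 2"
  shows "x * cos x \<le> sin x"
proof -
  have "sin 0 - 0 * cos 0 \<le> sin x - x * cos x"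
  proof (rule DERIV_nonneg_imp_nondecreasing[OF assms(1)])
    fix y :: real assume y: "0 \<le> y" "y \<le> x"
    have "((\<lambda>y. sin y - y * cos y) has_real_derivative y * sin y) (at y)"
      by (auto intro!: derivative_eq_intros)
    moreover have "0 \<le> y * sin y"
      using y assms pi_gt_zero by (intro mult_nonneg_nonneg sin_ge_zero) linarith+
    ultimately show "\<exists>z. ((\<lambda>y. sin y - y * cos y) has_real_derivative z) (at y) \<and> 0 \<le> z" by blast
  qed
  then show ?thesis by simp
qed

text \<open>With y = |x| / 2, a chord of at most \<open>\<delta>\<close> forces \<open>cos y\<close>
  to be at least the square root, and \<open>y * cos y \<le> sin y\<close> then bounds the arc by
  the chord. The factor tends to 1 as \<open>\<delta>\<close> tends to 0, which makes the length
  exact in the limit.\<close>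

lemma chord_arc_bound:
  assumes x: "\<bar>x\<bar> \<le> pi" and D: "2 * \<bar>sin (x / 2)\<bar> \<le> D" "D \<le> \<delta>" and \<delta>: "\<delta> \<le> 1"
  shows "\<bar>x\<bar> * sqrt (1 - (\<delta> / 2)\<^sup>2) \<le> D"
proof -
  define y where "y = \<bar>x\<bar> / 2"
  have y: "0 \<le> y" "y \<le> pi / 2" using x by (auto simp: y_def)
  have siny: "sin y = \<bar>sin (x / 2)\<bar>"
  proof (cases "x \<ge> 0")
    case True
    then show ?thesis using sin_ge_zero[of y] y by (simp add: y_def)
  next
    case False
    then have "sin (x / 2) = - sin y" by (simp add: y_def)
    then show ?thesis using sin_ge_zero[of y] y by simp
  qed
  have s: "0 \<le> sin y" "sin y \<le> \<delta> / 2" using siny D by auto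
  have c: "0 \<le> cos y" using y by (intro cos_ge_zero) auto
  have "sqrt (1 - (\<delta> / 2)\<^sup>2) \<le> cos y"
  proof (rule real_le_lsqrt)
    have "(sin y)\<^sup>2 \<le> (\<delta> / 2)\<^sup>2" using s by (intro power_mono) auto
    then show "1 - (\<delta> / 2)\<^sup>2 \<le> (cos y)\<^sup>2" using sin_squared_eq[of y] by simp
  qed (use c in auto)
  then have "y * sqrt (1 - (\<delta> / 2)\<^sup>2) \<le> y * cos y" using y by (intro mult_left_mono) auto
  also have "\<dots> \<le> sin y" using y by (rule x_cos_le_sin)
  finally show ?thesis using D siny by (simp add: y_def)
qed

section \<open>Hausdorff measure of circular arcs\<close>

lemma circle_at_periodic: "circle_at v w (\<theta> + 2 * pi) = circle_at v w \<theta>"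
  by (simp add: circle_at_def)

lemma continuous_on_circle_at[continuous_intros]: "continuous_on S (circle_at v w)"
  unfolding circle_at_def[abs_def] by (intro continuous_intros)

lemma circle_at_measurable[measurable]: "circle_at (v::'a::euclidean_space) w \<in> borel_measurable borel"
  by (intro borel_measurable_continuous_onI continuous_intros)

text \<open>Within a suitable period, the parameters of any two points of the set are no further
  apart than the claimed bound, so all of them fit in one interval of that length. The closure makes
  the set measurable without changing its diameter.\<close>

lemma circle_at_preimage_measure:
  fixes v w :: "'a::euclidean_space"
  assumes o: "norm v = 1" "norm w = 1" "v \<bullet> w = 0"
    and U: "bounded U" "diameter U \<le> \<delta>" and \<delta>: "0 < \<delta>" "\<delta> \<le> 1"
  shows "(\<integral>\<^sup>+\<theta>\<in>{a..<a+2*pi}. indicator (closure U) (circle_at v w \<theta>) \<partial>lborel)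
     \<le> ennreal (diameter U / sqrt (1 - (\<delta> / 2)\<^sup>2))"
proof (cases "\<exists>\<theta>0. circle_at v w \<theta>0 \<in> closure U")
  case False
  then have "(\<integral>\<^sup>+\<theta>\<in>{a..<a+2*pi}. indicator (closure U) (circle_at v w \<theta>) \<partial>lborel) = 0"
    by simp
  then show ?thesis by simp
next
  case True
  then obtain \<theta>0 where \<theta>0: "circle_at v w \<theta>0 \<in> closure U" by auto
  define \<kappa> where "\<kappa> = sqrt (1 - (\<delta> / 2)\<^sup>2)"
  define D where "D = diameter U"
  have "3 / 4 \<le> 1 - (\<delta> / 2)\<^sup>2"
    using \<delta> power_mono[of \<delta> 1 2] by (simp add: power_divide)
  then have \<kappa>: "\<kappa> \<ge> 3 / 4"
    unfolding \<kappa>_def by (intro real_le_rsqrt) (simp add: power2_eq_square)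
  have D: "0 \<le> D" "D \<le> \<delta>" using U diameter_ge_0 by (auto simp: D_def)
  have [measurable]: "closure U \<in> sets borel" by simp
  let ?T = "{\<theta> \<in> {\<theta>0 - pi..<\<theta>0 + pi}. circle_at v w \<theta> \<in> closure U}"
  have chord: "2 * \<bar>sin ((x - y) / 2)\<bar> \<le> D" if "circle_at v w x \<in> closure U" "circle_at v w y \<in> closure U" for x y
    using diameter_bounded_bound[of "closure U"] that U
    by (simp add: D_def diameter_closure bounded_closure flip: dist_circle_at[OF o])
  have near0: "\<bar>x - \<theta>0\<bar> \<le> D / \<kappa>" if "x \<in> ?T" for x
  proof -
    have "\<bar>x - \<theta>0\<bar> * \<kappa> \<le> D"
      using chord_arc_bound[of "x - \<theta>0" D \<delta>] chord[of x \<theta>0] \<theta>0 that D \<delta> unfolding \<kappa>_def by auto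
    then show ?thesis using \<kappa> by (simp add: pos_le_divide_eq)
  qed
  \<comment> \<open>Being within 4 / 3 of \<open>\<theta>0\<close>, two parameters are within 8 / 3
    < pi of each other, the range in which a chord controls its arc; a window of length 2 * pi alone
    would not ensure this.\<close>
  have "D / \<kappa> \<le> 4 / 3"
    using \<kappa> D \<delta> by (intro divide_le_eq[THEN iffD2]) auto
  then have D\<kappa>: "2 * (D / \<kappa>) \<le> pi" using pi_gt3 by simp
  have near: "\<bar>x - y\<bar> \<le> D / \<kappa>" if "x \<in> ?T" "y \<in> ?T" for x y
  proof -
    have "\<bar>x - y\<bar> \<le> pi" using near0[OF that(1)] near0[OF that(2)] D\<kappa> by linarith
    then have "\<bar>x - y\<bar> * \<kappa> \<le> D"
      using chord_arc_bound[of "x - y" D \<delta>] chord[of x y] that D \<delta> unfolding \<kappa>_def by auto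
    then show ?thesis using \<kappa> by (simp add: pos_le_divide_eq)
  qed
  define m where "m = Inf ?T"
  have T0: "\<theta>0 \<in> ?T" using \<theta>0 by simp
  have bd: "bdd_below ?T" by (rule bdd_belowI[of _ "\<theta>0 - pi"]) auto
  have sub: "?T \<subseteq> {m..m + D / \<kappa>}"
  proof
    fix x assume x: "x \<in> ?T"
    have "m \<le> x" unfolding m_def using x bd by (rule cInf_lower)
    moreover have "x - D / \<kappa> \<le> m" unfolding m_def
    proof (rule cInf_greatest)
      show "?T \<noteq> {}" using T0 by blast
      fix y assume "y \<in> ?T"
      from near[OF x this] show "x - D / \<kappa> \<le> y" by linarith
    qed
    ultimately show "x \<in> {m..m + D / \<kappa>}" by simp
  qed
  have "(\<integral>\<^sup>+\<theta>\<in>{a..<a+2*pi}. indicator (closure U) (circle_at v w \<theta>) \<partial>lborel) =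
     (\<integral>\<^sup>+\<theta>\<in>{\<theta>0-pi..<\<theta>0-pi+2*pi}. indicator (closure U) (circle_at v w \<theta>) \<partial>lborel)"
    by (rule nn_integral_periodic) (auto simp: circle_at_periodic)
  also have "\<dots> \<le> (\<integral>\<^sup>+\<theta>. indicator {m..m + D / \<kappa>} \<theta> \<partial>lborel)"
    by (rule nn_integral_mono) (use sub in \<open>auto simp: indicator_def\<close>)
  also have "\<dots> = ennreal (D / \<kappa>)" using D \<kappa> by simp
  finally show ?thesis by (simp add: D_def \<kappa>_def)
qed

text \<open>Integrate over the parameter the number of covering sets whose closures contain the
  point: it is at least 1 along the arc, and each set contributes at most its diameter divided by
  the square root.\<close>

lemma hausdorff1_content_arc_ge:
  fixes v w :: "'a::euclidean_space"
  assumes o: "norm v = 1" "norm w = 1" "v \<bullet> w = 0"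
    and ab: "a \<le> b" "b \<le> a + 2 * pi" and \<delta>: "0 < \<delta>" "\<delta> \<le> 1"
  shows "ennreal ((b - a) * sqrt (1 - (\<delta> / 2)\<^sup>2)) \<le> hausdorff1_content \<delta> (circle_at v w ` {a..b})"
  unfolding hausdorff1_content_def
proof (rule INF_greatest)
  fix U :: "nat \<Rightarrow> 'a set"
  assume "U \<in> {U. circle_at v w ` {a..b} \<subseteq> (\<Union>i. U i) \<and> (\<forall>i. bounded (U i) \<and> diameter (U i) \<le> \<delta>)}"
  then have U: "circle_at v w ` {a..b} \<subseteq> (\<Union>i. U i)" "\<And>i. bounded (U i)" "\<And>i. diameter (U i) \<le> \<delta>" by auto
  define \<kappa> where "\<kappa> = sqrt (1 - (\<delta> / 2)\<^sup>2)"
  have "(\<delta> / 2)\<^sup>2 < 1" using \<delta> power_mono[of \<delta> 1 2] by (simp add: power_divide)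
  then have \<kappa>: "\<kappa> > 0" by (simp add: \<kappa>_def)
  have "ennreal (b - a) = (\<integral>\<^sup>+\<theta>. indicator {a..<b} \<theta> \<partial>lborel)" using ab by simp
  also have "\<dots> \<le> (\<integral>\<^sup>+\<theta>. (\<Sum>i. indicator (closure (U i)) (circle_at v w \<theta>) * indicator {a..<a+2*pi} \<theta>) \<partial>lborel)"
  proof (rule nn_integral_mono)
    fix \<theta> :: real
    show "indicator {a..<b} \<theta> \<le> (\<Sum>i. indicator (closure (U i)) (circle_at v w \<theta>) * indicator {a..<a+2*pi} \<theta> :: ennreal)"
    proof (cases "\<theta> \<in> {a..<b}")
      case True
      then obtain j where j: "circle_at v w \<theta> \<in> U j" using U(1) by force
      have "(1::ennreal) = (\<Sum>i\<in>{j}. indicator (closure (U i)) (circle_at v w \<theta>) * indicator {a..<a+2*pi} \<theta>)"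
        using j True ab closure_subset[of "U j"] by (auto simp: indicator_def)
      also have "\<dots> \<le> (\<Sum>i. indicator (closure (U i)) (circle_at v w \<theta>) * indicator {a..<a+2*pi} \<theta>)"
        by (rule sum_le_suminf) auto
      finally show ?thesis using True by simp
    qed simp
  qed
  also have "\<dots> = (\<Sum>i. \<integral>\<^sup>+\<theta>. indicator (closure (U i)) (circle_at v w \<theta>) * indicator {a..<a+2*pi} \<theta> \<partial>lborel)"
  proof (rule nn_integral_suminf)
    fix i
    have [measurable]: "closure (U i) \<in> sets borel" by simp
    show "(\<lambda>\<theta>. indicator (closure (U i)) (circle_at v w \<theta>) * indicator {a..<a+2*pi} \<theta> :: ennreal) \<in> borel_measurable lborel"
      by measurable
  qed
  also have "\<dots> \<le> (\<Sum>i. ennreal (diameter (U i) / \<kappa>))"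
    unfolding \<kappa>_def by (intro suminf_le circle_at_preimage_measure o U \<delta>) auto
  also have "\<dots> = (\<Sum>i. ennreal (diameter (U i)) * ennreal (1 / \<kappa>))"
    using \<kappa> diameter_ge_0[OF U(2)] by (intro arg_cong[where f=suminf] ext) (simp flip: ennreal_mult)
  also have "\<dots> = (\<Sum>i. ennreal (diameter (U i))) * ennreal (1 / \<kappa>)" by (rule ennreal_suminf_multc)
  finally have "ennreal (b - a) * ennreal \<kappa> \<le> (\<Sum>i. ennreal (diameter (U i))) * ennreal (1 / \<kappa>) * ennreal \<kappa>"
    by (rule mult_right_mono) simp
  also have "\<dots> = (\<Sum>i. ennreal (diameter (U i)))"
    using \<kappa> by (simp add: mult.assoc flip: ennreal_mult)
  finally show "ennreal ((b - a) * sqrt (1 - (\<delta> / 2)\<^sup>2)) \<le> (\<Sum>i. ennreal (diameter (U i)))"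
    using \<kappa> ab by (simp add: \<kappa>_def ennreal_mult)
qed

text \<open>Cut the arc into pieces of parameter length \<open>h\<close> at most
  \<open>\<delta>\<close>; chords are no longer than arcs, so the diameters add up to at most the
  length.\<close>

lemma hausdorff1_content_arc_le:
  fixes v w :: "'a::euclidean_space"
  assumes o: "norm v = 1" "norm w = 1" "v \<bullet> w = 0" and ab: "a \<le> b" and \<delta>: "0 < \<delta>"
  shows "hausdorff1_content \<delta> (circle_at v w ` {a..b}) \<le> ennreal (b - a)"
proof -
  obtain k :: nat where k: "(b - a) / \<delta> < real k" using reals_Archimedean2 by blast
  have k0: "k > 0" using k ab \<delta> by (cases k) (auto simp: field_simps)
  define h where "h = (b - a) / real k"
  have h: "0 \<le> h" "h \<le> \<delta>" using k k0 ab \<delta> by (auto simp: h_def field_simps)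
  define U where "U i = (if i < k then circle_at v w ` {a + real i * h..a + (real i + 1) * h} else {})" for i
  have lip: "norm (circle_at v w x - circle_at v w y) \<le> \<bar>x - y\<bar>" for x y
    using dist_circle_at[OF o, of x y] abs_sin_x_le_abs_x[of "(x - y) / 2"] by (simp add: dist_norm)
  have diam: "diameter (U i) \<le> h" for i
    unfolding U_def using h
    by (auto intro!: diameter_le order_trans[OF lip] simp: algebra_simps abs_le_iff)
  have bnd: "bounded (U i)" for i
    unfolding U_def by (auto intro!: compact_imp_bounded compact_continuous_image continuous_intros)
  have cov: "circle_at v w ` {a..b} \<subseteq> (\<Union>i. U i)"
  proof safe
    fix x assume x: "x \<in> {a..b}"
    show "circle_at v w x \<in> (\<Union>i. U i)"
    proof (cases "h = 0")
      case True
      then have "x = a" using x k0 by (auto simp: h_def)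
      then have "circle_at v w x \<in> U 0" using k0 True by (simp add: U_def)
      then show ?thesis by blast
    next
      case False
      then have h0: "h > 0" using h by simp
      have kh: "real k * h = b - a" using k0 by (simp add: h_def)
      show ?thesis
      \<comment> \<open>At the right end the floor used below would be \<open>k\<close>, one past
        the last piece.\<close>
      proof (cases "x = b")
        case True
        have "real (k - 1) = real k - 1" using k0 by simp
        then have "circle_at v w x \<in> U (k - 1)" using k0 True h0 kh
          by (auto simp: U_def algebra_simps intro!: imageI)
        then show ?thesis by blast
      next
        case False
        define i where "i = nat \<lfloor>(x - a) / h\<rfloor>"
        have q: "0 \<le> (x - a) / h" using x h0 by simp
        then have i: "real i \<le> (x - a) / h" "(x - a) / h < real i + 1" by (auto simp: i_def)
        then have i': "real i * h \<le> x - a" "x - a < (real i + 1) * h"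
          using h0 by (auto simp: field_simps)
        have "real i * h < real k * h" using i' x False kh by auto
        then have "i < k" using h0 by simp
        then have "circle_at v w x \<in> U i" using i' by (auto simp: U_def intro!: imageI)
        then show ?thesis by blast
      qed
    qed
  qed
  have "hausdorff1_content \<delta> (circle_at v w ` {a..b}) \<le> (\<Sum>i. ennreal (diameter (U i)))"
    unfolding hausdorff1_content_def
    by (rule INF_lower) (use cov bnd order_trans[OF diam h(2)] in auto)
  also have "\<dots> = (\<Sum>i<k. ennreal (diameter (U i)))"
    by (rule suminf_finite) (auto simp: U_def)
  also have "\<dots> \<le> (\<Sum>i<k. ennreal h)" by (intro sum_mono ennreal_leI diam)
  also have "\<dots> = ennreal (real k * h)"
    using h by (simp add: ennreal_of_nat_eq_real_of_nat ennreal_mult)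
  also have "real k * h = b - a" using k0 by (simp add: h_def)
  finally show ?thesis .
qed

text \<open>The lower bound for the contents becomes exact as \<open>\<delta>\<close> tends to 0.
  The range of \<open>b\<close> includes the full circle, which is the edge left by d - 1
  hyperplanes.\<close>

lemma hausdorff1_arc:
  fixes v w :: "'a::euclidean_space"
  assumes o: "norm v = 1" "norm w = 1" "v \<bullet> w = 0"
    and ab: "a \<le> b" "b \<le> a + 2 * pi"
  shows "hausdorff1 (circle_at v w ` {a..b}) = ennreal (b - a)"
proof (rule antisym)
  show "hausdorff1 (circle_at v w ` {a..b}) \<le> ennreal (b - a)"
    unfolding hausdorff1_def by (intro SUP_least hausdorff1_content_arc_le o ab) auto
  have "((\<lambda>\<delta>::real. ennreal ((b - a) * sqrt (1 - (\<delta> / 2)\<^sup>2))) \<longlongrightarrow> ennreal ((b - a) * sqrt (1 - (0 / 2)\<^sup>2))) (at_right 0)"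
    by (intro tendsto_ennrealI tendsto_intros) simp_all
  then have lim: "((\<lambda>\<delta>::real. ennreal ((b - a) * sqrt (1 - (\<delta> / 2)\<^sup>2))) \<longlongrightarrow> ennreal (b - a)) (at_right 0)"
    by simp
  show "ennreal (b - a) \<le> hausdorff1 (circle_at v w ` {a..b})"
  proof (rule tendsto_upperbound[OF lim])
    have "\<forall>\<^sub>F \<delta> in at_right (0::real). \<delta> \<in> {0<..<1}" by (rule eventually_at_right_real) simp
    then show "\<forall>\<^sub>F \<delta> in at_right 0. ennreal ((b - a) * sqrt (1 - (\<delta> / 2)\<^sup>2)) \<le> hausdorff1 (circle_at v w ` {a..b})"
    proof eventually_elim
      case (elim \<delta>)
      then have "ennreal ((b - a) * sqrt (1 - (\<delta> / 2)\<^sup>2)) \<le> hausdorff1_content \<delta> (circle_at v w ` {a..b})"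
        by (intro hausdorff1_content_arc_ge o ab) auto
      also have "\<dots> \<le> hausdorff1 (circle_at v w ` {a..b})"
        unfolding hausdorff1_def by (rule SUP_upper) (use elim in auto)
      finally show ?case .
    qed
  qed simp
qed

section \<open>Edges of a tessellation in general position\<close>

text \<open>For \<open>p\<close> off all hyperplanes this is the closed chamber of the arrangement
  that contains \<open>p\<close>; comparing signs by a product makes each condition linear in
  \<open>y\<close>.\<close>

definition sign_cone :: "'a::euclidean_space set \<Rightarrow> 'a \<Rightarrow> 'a set" where
  "sign_cone U p = {y. \<forall>u\<in>U. 0 \<le> (u \<bullet> p) * (u \<bullet> y)}"

definition open_sign_cone :: "'a::euclidean_space set \<Rightarrow> 'a \<Rightarrow> 'a set" where
  "open_sign_cone U p = {y. \<forall>u\<in>U. 0 < (u \<bullet> p) * (u \<bullet> y)}"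

definition normals_perp :: "'a::euclidean_space set \<Rightarrow> 'a set" where
  "normals_perp I = {y. \<forall>u\<in>I. u \<bullet> y = 0}"

lemma convex_sign_cone: "convex (sign_cone U p)"
  unfolding convex_def sign_cone_def by (auto simp: inner_add_right distrib_left mult.left_commute)

lemma closed_sign_cone: "closed (sign_cone U p)"
proof -
  have "sign_cone U p = (\<Inter>u\<in>U. {y. 0 \<le> (u \<bullet> p) * (u \<bullet> y)})" by (auto simp: sign_cone_def)
  moreover have "closed {y. 0 \<le> (u \<bullet> p) * (u \<bullet> y)}" for u by (intro closed_Collect_le continuous_intros)
  ultimately show ?thesis by auto
qed

lemma convex_open_sign_cone: "convex (open_sign_cone U p)"
proof -
  have "open_sign_cone U p = (\<Inter>u\<in>U. {y. 0 < ((u \<bullet> p) *\<^sub>R u) \<bullet> y})" by (auto simp: open_sign_cone_def)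
  moreover have "convex {y. 0 < ((u \<bullet> p) *\<^sub>R u) \<bullet> y}" for u by (rule convex_halfspace_gt)
  ultimately show ?thesis by (metis (no_types, lifting) convex_INT)
qed

lemma open_open_sign_cone:
  assumes "finite U"
  shows "open (open_sign_cone U p)"
proof -
  have "open_sign_cone U p = (\<Inter>u\<in>U. {y. 0 < (u \<bullet> p) * (u \<bullet> y)})" by (auto simp: open_sign_cone_def)
  moreover have "open {y. 0 < (u \<bullet> p) * (u \<bullet> y)}" for u by (intro open_Collect_less continuous_intros)
  ultimately show ?thesis using assms by auto
qed

lemma sgn_in_open_sign_cone: "y \<noteq> 0 \<Longrightarrow> y \<in> open_sign_cone U p \<Longrightarrow> sgn y \<in> open_sign_cone U p"
  by (auto simp: open_sign_cone_def sgn_div_norm mult.left_commute intro!: mult_pos_pos)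

text \<open>Radial projection of a convex set that avoids 0. Without hyperplanes the set is the
  whole space, and the connectedness of the sphere itself takes over.\<close>

lemma connected_sphere_open_sign_cone:
  fixes p :: "'a::euclidean_space"
  assumes "DIM('a) \<ge> 2"
  shows "connected (sphere 0 1 \<inter> open_sign_cone U p)"
proof (cases "U = {}")
  case True
  then show ?thesis using connected_sphere[OF assms, of 0 1] by (simp add: open_sign_cone_def)
next
  case False
  then have 0: "0 \<notin> open_sign_cone U p" by (auto simp: open_sign_cone_def)
  have "connected (sgn ` open_sign_cone U p)"
    using 0 by (intro connected_continuous_image convex_connected convex_open_sign_cone)
      (auto simp: sgn_div_norm intro!: continuous_intros)
  also have "sgn ` open_sign_cone U p = sphere 0 1 \<inter> open_sign_cone U p"
  proof (intro equalityI subsetI)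
    fix y assume "y \<in> sgn ` open_sign_cone U p"
    then obtain z where "z \<in> open_sign_cone U p" "y = sgn z" by auto
    then show "y \<in> sphere 0 1 \<inter> open_sign_cone U p"
      using 0 sgn_in_open_sign_cone[of z U p] by (cases "z = 0") (auto simp: norm_sgn)
  next
    fix y assume "y \<in> sphere 0 1 \<inter> open_sign_cone U p"
    then show "y \<in> sgn ` open_sign_cone U p" by (intro image_eqI[of _ _ y]) (auto simp: sgn_div_norm)
  qed
  finally show ?thesis .
qed

text \<open>A connected set that avoids a hyperplane stays on one side of it, so nothing beyond the
  open chamber can be reached from \<open>p\<close>.\<close>

lemma connected_component_sphere_complement:
  fixes p :: "'a::euclidean_space"
  assumes "DIM('a) \<ge> 2" and p: "norm p = 1" "\<And>u. u \<in> U \<Longrightarrow> u \<bullet> p \<noteq> 0"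
  shows "connected_component_set (sphere 0 1 - (\<Union>u\<in>U. {x. u \<bullet> x = 0})) p = sphere 0 1 \<inter> open_sign_cone U p"
proof (rule connected_component_unique)
  show "p \<in> sphere 0 1 \<inter> open_sign_cone U p"
    using p by (auto simp: open_sign_cone_def zero_less_mult_iff linorder_neq_iff)
  show "connected (sphere 0 1 \<inter> open_sign_cone U p)" by (rule connected_sphere_open_sign_cone) fact
  show "sphere 0 1 \<inter> open_sign_cone U p \<subseteq> sphere 0 1 - (\<Union>u\<in>U. {x. u \<bullet> x = 0})"
    by (auto simp: open_sign_cone_def)
  fix T assume T: "p \<in> T" "T \<subseteq> sphere 0 1 - (\<Union>u\<in>U. {x. u \<bullet> x = 0})" "connected T"
  show "T \<subseteq> sphere 0 1 \<inter> open_sign_cone U p"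
  proof
    fix y assume y: "y \<in> T"
    have "0 < (u \<bullet> p) * (u \<bullet> y)" if u: "u \<in> U" for u
    proof (rule ccontr)
      assume "\<not> ?thesis"
      then have "u \<bullet> p \<le> 0 \<and> 0 \<le> u \<bullet> y \<or> u \<bullet> y \<le> 0 \<and> 0 \<le> u \<bullet> p"
        by (auto simp: not_less mult_le_0_iff)
      then obtain z where "z \<in> T" "u \<bullet> z = 0"
        using connected_ivt_hyperplane[OF T(3) T(1) y, of u 0] connected_ivt_hyperplane[OF T(3) y T(1), of u 0] by auto
      then show False using T(2) u by auto
    qed
    then show "y \<in> sphere 0 1 \<inter> open_sign_cone U p" using y T by (auto simp: open_sign_cone_def)
  qed
qed

text \<open>From a point of the closed chamber, a small step in the direction \<open>p\<close> makes
  all sign conditions strict; normalised to the sphere, these points converge back.\<close>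

lemma closure_sphere_open_sign_cone:
  fixes p :: "'a::euclidean_space"
  assumes p: "\<And>u. u \<in> U \<Longrightarrow> u \<bullet> p \<noteq> 0"
  shows "closure (sphere 0 1 \<inter> open_sign_cone U p) = sphere 0 1 \<inter> sign_cone U p"
proof (cases "U = {}")
  case True
  then show ?thesis by (simp add: open_sign_cone_def sign_cone_def closure_closed)
next
  case False
  show ?thesis
  proof (intro equalityI)
    show "closure (sphere 0 1 \<inter> open_sign_cone U p) \<subseteq> sphere 0 1 \<inter> sign_cone U p"
      by (intro closure_minimal closed_Int closed_sphere closed_sign_cone)
        (auto simp: open_sign_cone_def sign_cone_def intro: less_imp_le)
    show "sphere 0 1 \<inter> sign_cone U p \<subseteq> closure (sphere 0 1 \<inter> open_sign_cone U p)"
    proof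
      fix y assume y: "y \<in> sphere 0 1 \<inter> sign_cone U p"
      have in_cone: "y + e *\<^sub>R p \<in> open_sign_cone U p" if e: "e > 0" for e
      proof -
        have "0 < (u \<bullet> p) * (u \<bullet> (y + e *\<^sub>R p))" if u: "u \<in> U" for u
        proof -
          have "(u \<bullet> p) * (u \<bullet> (y + e *\<^sub>R p)) = (u \<bullet> p) * (u \<bullet> y) + e * (u \<bullet> p)\<^sup>2"
            by (simp add: inner_add_right power2_eq_square algebra_simps)
          moreover have "e * (u \<bullet> p)\<^sup>2 > 0" using e p[OF u] by simp
          ultimately show ?thesis using y u by (auto simp: sign_cone_def intro: add_nonneg_pos)
        qed
        then show ?thesis by (auto simp: open_sign_cone_def)
      qed
      have "((\<lambda>e. sgn (y + e *\<^sub>R p)) \<longlongrightarrow> sgn (y + 0 *\<^sub>R p)) (at_right 0)"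
        using y by (intro tendsto_intros) auto
      moreover have "sgn (y + 0 *\<^sub>R p) = y" using y by (simp add: sgn_div_norm)
      ultimately have lim: "((\<lambda>e. sgn (y + e *\<^sub>R p)) \<longlongrightarrow> y) (at_right 0)" by simp
      show "y \<in> closure (sphere 0 1 \<inter> open_sign_cone U p)"
      proof (rule Lim_in_closed_set[OF closed_closure _ _ lim])
        have "\<forall>\<^sub>F e in at_right (0::real). e \<in> {0<..<1}" by (rule eventually_at_right_real) simp
        then show "\<forall>\<^sub>F e in at_right 0. sgn (y + e *\<^sub>R p) \<in> closure (sphere 0 1 \<inter> open_sign_cone U p)"
        proof eventually_elim
          case (elim e)
          have c: "y + e *\<^sub>R p \<in> open_sign_cone U p" using in_cone elim by auto
          moreover have "y + e *\<^sub>R p \<noteq> 0" using c False by (auto simp: open_sign_cone_def)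
          ultimately have "sgn (y + e *\<^sub>R p) \<in> sphere 0 1 \<inter> open_sign_cone U p"
            using sgn_in_open_sign_cone by (auto simp: norm_sgn)
          then show ?case by (rule subsetD[OF closure_subset])
        qed
      qed simp
    qed
  qed
qed

lemma cone_hull_sphere_sign_cone:
  fixes p :: "'a::euclidean_space"
  assumes p: "norm p = 1" "\<And>u. u \<in> U \<Longrightarrow> u \<bullet> p \<noteq> 0"
  shows "cone hull (sphere 0 1 \<inter> sign_cone U p) = sign_cone U p"
proof (intro equalityI subsetI)
  fix y assume "y \<in> cone hull (sphere 0 1 \<inter> sign_cone U p)"
  then obtain c x where "y = c *\<^sub>R x" "c \<ge> 0" "x \<in> sign_cone U p" unfolding cone_hull_expl by auto
  then show "y \<in> sign_cone U p" by (auto simp: sign_cone_def mult.left_commute)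
next
  fix y assume y: "y \<in> sign_cone U p"
  show "y \<in> cone hull (sphere 0 1 \<inter> sign_cone U p)"
  proof (cases "y = 0")
    case True
    have "p \<in> sign_cone U p" by (auto simp: sign_cone_def)
    with p have "0 *\<^sub>R p \<in> {c *\<^sub>R x |c x. c \<ge> 0 \<and> x \<in> sphere 0 1 \<inter> sign_cone U p}" by force
    with True show ?thesis unfolding cone_hull_expl by simp
  next
    case False
    have "sgn y \<in> sphere 0 1 \<inter> sign_cone U p"
      using y False by (auto simp: sign_cone_def norm_sgn sgn_div_norm mult.left_commute)
    moreover have "y = norm y *\<^sub>R sgn y" using False by (simp add: sgn_div_norm)
    ultimately show ?thesis unfolding cone_hull_expl using norm_ge_zero by blast
  qed
qed

text \<open>Cells enter the definition of edges only through the cones they span. From here on these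
  cones are the closed chambers, and the argument is polyhedral.\<close>

lemma cone_hull_tessellation_cells:
  fixes U :: "'a::euclidean_space set"
  assumes "DIM('a) \<ge> 2"
  shows "(\<lambda>C. cone hull C) ` tessellation_cells U = {sign_cone U p | p. norm p = 1 \<and> (\<forall>u\<in>U. u \<bullet> p \<noteq> 0)}"
proof -
  have "cone hull closure (connected_component_set (sphere 0 1 - (\<Union>u\<in>U. {x. u \<bullet> x = 0})) p) = sign_cone U p"
    if "norm p = 1" "\<forall>u\<in>U. u \<bullet> p \<noteq> 0" for p
    using that by (simp add: connected_component_sphere_complement closure_sphere_open_sign_cone cone_hull_sphere_sign_cone assms)
  moreover have "sphere 0 1 - (\<Union>u\<in>U. {x. u \<bullet> x = 0}) = {p. norm p = 1 \<and> (\<forall>u\<in>U. u \<bullet> p \<noteq> 0)}"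
    by auto
  ultimately show ?thesis
    unfolding tessellation_cells_def components_def image_image setcompr_eq_image by (intro image_cong) auto
qed

lemma tessellation_edges_sign_cone:
  fixes U :: "'a::euclidean_space set"
  assumes "DIM('a) \<ge> 2"
  shows "tessellation_edges U =
    {sphere 0 1 \<inter> F | F p. norm p = 1 \<and> (\<forall>u\<in>U. u \<bullet> p \<noteq> 0) \<and> F face_of sign_cone U p \<and> aff_dim F = 2}"
proof -
  have "tessellation_edges U = {sphere 0 1 \<inter> F | F K. K \<in> (\<lambda>C. cone hull C) ` tessellation_cells U \<and> F face_of K \<and> aff_dim F = 2}"
    unfolding tessellation_edges_def by blast
  then show ?thesis unfolding cone_hull_tessellation_cells[OF assms] by blast
qed

section \<open>Faces of chambers and edges in general position\<close>

lemma convex_normals_perp: "convex (normals_perp I)" and subspace_normals_perp: "subspace (normals_perp I)"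
  by (auto simp: normals_perp_def subspace_def inner_add_right intro!: subspace_imp_convex)

lemma dim_normals_perp:
  fixes I :: "'a::euclidean_space set"
  shows "dim (normals_perp I) + dim I = DIM('a)"
proof -
  have "normals_perp I = {y \<in> UNIV. \<forall>x\<in>span I. orthogonal x y}"
  proof (intro equalityI subsetI)
    fix y assume y: "y \<in> normals_perp I"
    have "orthogonal y x" if "x \<in> span I" for x
      using that by (rule orthogonal_to_span) (use y in \<open>auto simp: normals_perp_def orthogonal_def inner_commute\<close>)
    then show "y \<in> {y \<in> UNIV. \<forall>x\<in>span I. orthogonal x y}" by (simp add: orthogonal_commute)
  qed (auto simp: normals_perp_def orthogonal_def span_base)
  then show ?thesis
    using dim_subspace_orthogonal_to_vectors[of "span I" UNIV] by (simp add: dim_span)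
qed

text \<open>On the chamber each \<open>(u \<bullet> p) * (u \<bullet> y)\<close> is nonnegative and
  linear in \<open>y\<close>, so it vanishes inside a segment only if it vanishes at both
  ends.\<close>

lemma sign_cone_Int_normals_perp_face:
  assumes "I \<subseteq> U" and p: "\<And>u. u \<in> U \<Longrightarrow> u \<bullet> p \<noteq> 0"
  shows "sign_cone U p \<inter> normals_perp I face_of sign_cone U p"
  unfolding face_of_def
proof (intro conjI ballI impI)
  show "convex (sign_cone U p \<inter> normals_perp I)" by (intro convex_Int convex_sign_cone convex_normals_perp)
  fix a b x assume a: "a \<in> sign_cone U p" and b: "b \<in> sign_cone U p"
    and x: "x \<in> sign_cone U p \<inter> normals_perp I" "x \<in> open_segment a b"
  then obtain t where t: "0 < t" "t < 1" "x = (1 - t) *\<^sub>R a + t *\<^sub>R b" by (auto simp: in_segment)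
  have "u \<bullet> a = 0 \<and> u \<bullet> b = 0" if u: "u \<in> I" for u
  proof -
    have uU: "u \<in> U" using u assms by auto
    have "0 = (u \<bullet> p) * (u \<bullet> x)" using x u by (simp add: normals_perp_def)
    also have "\<dots> = (1 - t) * ((u \<bullet> p) * (u \<bullet> a)) + t * ((u \<bullet> p) * (u \<bullet> b))"
      by (simp add: t inner_add_right algebra_simps)
    finally have s: "(1 - t) * ((u \<bullet> p) * (u \<bullet> a)) + t * ((u \<bullet> p) * (u \<bullet> b)) = 0" by simp
    have "0 \<le> (u \<bullet> p) * (u \<bullet> a)" "0 \<le> (u \<bullet> p) * (u \<bullet> b)" using a b uU by (auto simp: sign_cone_def)
    then have "0 \<le> (1 - t) * ((u \<bullet> p) * (u \<bullet> a))" "0 \<le> t * ((u \<bullet> p) * (u \<bullet> b))"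
      using t by auto
    with s have "(1 - t) * ((u \<bullet> p) * (u \<bullet> a)) = 0" "t * ((u \<bullet> p) * (u \<bullet> b)) = 0" by linarith+
    then show ?thesis using t p[OF uU] by simp
  qed
  then show "a \<in> sign_cone U p \<inter> normals_perp I" "b \<in> sign_cone U p \<inter> normals_perp I"
    using a b by (auto simp: normals_perp_def)
qed auto

text \<open>Take \<open>q\<close> in the relative interior of the face. A segment in the face from
  \<open>y\<close> to \<open>q\<close> can be prolonged beyond \<open>q\<close>, which forces
  \<open>u \<bullet> y = 0\<close> wherever \<open>u \<bullet> q = 0\<close>. Conversely, if a point
  \<open>y\<close> of the chamber satisfies these equations, the segment from \<open>y\<close> to
  \<open>q\<close> can be prolonged inside the chamber, and the face property puts \<open>y\<close>
  in the face.\<close>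

lemma face_of_sign_cone:
  fixes U :: "'a::euclidean_space set"
  assumes "finite U" and p: "\<And>u. u \<in> U \<Longrightarrow> u \<bullet> p \<noteq> 0"
    and F: "F face_of sign_cone U p" "F \<noteq> {}"
  obtains q where "q \<in> F" "F = sign_cone U p \<inter> normals_perp {u \<in> U. u \<bullet> q = 0}"
proof -
  have cF: "convex F" and FK: "F \<subseteq> sign_cone U p" using F by (auto simp: face_of_def)
  then obtain q where q: "q \<in> rel_interior F" using F(2) rel_interior_eq_empty by blast
  then have qF: "q \<in> F" using rel_interior_subset by blast
  let ?I = "{u \<in> U. u \<bullet> q = 0}"
  have "F \<subseteq> normals_perp ?I"
  proof
    fix y assume y: "y \<in> F"
    from convex_rel_interior_if2[OF cF q, rule_format, OF hull_inc[OF y]]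
    obtain e where e: "e > 1" "(1 - e) *\<^sub>R y + e *\<^sub>R q \<in> F" by auto
    have "u \<bullet> y = 0" if u: "u \<in> ?I" for u
    proof -
      have "0 \<le> (u \<bullet> p) * (u \<bullet> ((1 - e) *\<^sub>R y + e *\<^sub>R q))" "0 \<le> (u \<bullet> p) * (u \<bullet> y)"
        using e y FK u by (auto simp: sign_cone_def)
      moreover have "(u \<bullet> p) * (u \<bullet> ((1 - e) *\<^sub>R y + e *\<^sub>R q)) = - ((e - 1) * ((u \<bullet> p) * (u \<bullet> y)))"
        using u by (simp add: inner_add_right algebra_simps)
      moreover have "0 \<le> (e - 1) * ((u \<bullet> p) * (u \<bullet> y))"
        using e \<open>0 \<le> (u \<bullet> p) * (u \<bullet> y)\<close> by simp
      ultimately have "(e - 1) * ((u \<bullet> p) * (u \<bullet> y)) = 0" by linarith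
      then show ?thesis using e p[of u] u by simp
    qed
    then show "y \<in> normals_perp ?I" by (simp add: normals_perp_def)
  qed
  moreover have "sign_cone U p \<inter> normals_perp ?I \<subseteq> F"
  proof
    fix y assume y: "y \<in> sign_cone U p \<inter> normals_perp ?I"
    show "y \<in> F"
    proof (cases "y = q")
      case False
      \<comment> \<open>A hyperplane through \<open>q\<close> contains \<open>y\<close> too and
        stays tight; any other condition is strict at \<open>q\<close>, and a small enough step
        keeps it so.\<close>
      have "\<exists>e>0. q + e *\<^sub>R (q - y) \<in> sign_cone U p"
      proof -
        have "\<forall>\<^sub>F e in at_right (0::real). \<forall>u\<in>U. 0 \<le> (u \<bullet> p) * (u \<bullet> (q + e *\<^sub>R (q - y)))"
          unfolding eventually_ball_finite_distrib[OF \<open>finite U\<close>]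
        proof
          fix u assume u: "u \<in> U"
          show "\<forall>\<^sub>F e in at_right (0::real). 0 \<le> (u \<bullet> p) * (u \<bullet> (q + e *\<^sub>R (q - y)))"
          proof (cases "u \<bullet> q = 0")
            case True
            then have "u \<bullet> y = 0" using y u by (auto simp: normals_perp_def)
            with True show ?thesis by (simp add: inner_add_right inner_diff_right)
          next
            case False
            have "0 \<le> (u \<bullet> p) * (u \<bullet> q)" using qF FK u by (auto simp: sign_cone_def)
            then have pos: "0 < (u \<bullet> p) * (u \<bullet> q)" using False p[OF u] by (simp add: less_le)
            have "((\<lambda>e. (u \<bullet> p) * (u \<bullet> (q + e *\<^sub>R (q - y)))) \<longlongrightarrow> (u \<bullet> p) * (u \<bullet> (q + 0 *\<^sub>R (q - y)))) (at_right 0)"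
              by (intro tendsto_intros)
            then have "\<forall>\<^sub>F e in at_right (0::real). 0 < (u \<bullet> p) * (u \<bullet> (q + e *\<^sub>R (q - y)))"
              using pos by (intro order_tendstoD(1)) auto
            then show ?thesis by eventually_elim simp
          qed
        qed
        moreover have "\<forall>\<^sub>F e in at_right (0::real). e > 0" by (rule eventually_at_right_less)
        ultimately have "\<forall>\<^sub>F e in at_right (0::real). e > 0 \<and> q + e *\<^sub>R (q - y) \<in> sign_cone U p"
          by eventually_elim (auto simp: sign_cone_def)
        then show ?thesis using eventually_happens trivial_limit_at_right_real by blast
      qed
      then obtain e where e: "e > 0" "q + e *\<^sub>R (q - y) \<in> sign_cone U p" by blast
      \<comment> \<open>The segment has length 1 + e in units of \<open>q - y\<close>, and
        \<open>q\<close> lies one unit from \<open>y\<close>.\<close>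
      have "q = (1 - 1 / (1 + e)) *\<^sub>R y + (1 / (1 + e)) *\<^sub>R (q + e *\<^sub>R (q - y))"
      proof -
        have "(1 + e) *\<^sub>R ((1 - 1 / (1 + e)) *\<^sub>R y + (1 / (1 + e)) *\<^sub>R (q + e *\<^sub>R (q - y))) = (1 + e) *\<^sub>R q"
          using e by (simp add: scaleR_add_right diff_divide_eq_iff add.commute) (simp add: algebra_simps)
        then show ?thesis using e by (metis add_pos_pos less_irrefl real_vector.scale_left_imp_eq zero_less_one)
      qed
      moreover have "0 < 1 / (1 + e)" "1 / (1 + e) < 1" using e by auto
      moreover have "y \<noteq> q + e *\<^sub>R (q - y)"
      proof
        assume "y = q + e *\<^sub>R (q - y)"
        then have "(1 + e) *\<^sub>R (q - y) = 0" by (simp add: algebra_simps)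
        with False e show False by simp
      qed
      ultimately have "q \<in> open_segment y (q + e *\<^sub>R (q - y))" unfolding in_segment by blast
      then show ?thesis using face_ofD[OF F(1)] y e qF by blast
    qed (use qF in simp)
  qed
  ultimately show thesis using FK by (intro that[OF qF]) auto
qed

text \<open>The conditions from \<open>I\<close> become equations; the others are strict at
  \<open>q\<close>, hence hold near it, so the face is full-dimensional in the subspace.\<close>

lemma aff_dim_sign_cone_Int_normals_perp:
  fixes U :: "'a::euclidean_space set"
  assumes "finite U" "I \<subseteq> U" and q: "q \<in> normals_perp I" "\<And>u. u \<in> U - I \<Longrightarrow> 0 < (u \<bullet> p) * (u \<bullet> q)"
  shows "aff_dim (sign_cone U p \<inter> normals_perp I) = int (dim (normals_perp I))"
proof -
  have eq: "sign_cone U p \<inter> normals_perp I = normals_perp I \<inter> sign_cone (U - I) p"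
    using assms(2) by (auto simp: sign_cone_def normals_perp_def)
  have "q \<in> open_sign_cone (U - I) p" using q by (auto simp: open_sign_cone_def)
  moreover have "open_sign_cone (U - I) p \<subseteq> interior (sign_cone (U - I) p)"
  proof (rule interior_maximal)
    show "open (open_sign_cone (U - I) p)" using \<open>finite U\<close> by (intro open_open_sign_cone) auto
  qed (auto simp: sign_cone_def open_sign_cone_def intro: less_imp_le)
  ultimately have "normals_perp I \<inter> interior (sign_cone (U - I) p) \<noteq> {}" using q by blast
  then show ?thesis unfolding eq
    by (subst aff_dim_convex_Int_nonempty_interior) (auto simp: convex_normals_perp aff_dim_subspace subspace_normals_perp)
qed

definition general_position :: "'a::euclidean_space set \<Rightarrow> bool" where
  "general_position U \<longleftrightarrow> finite U \<and> (\<forall>I\<subseteq>U. card I \<le> DIM('a) \<longrightarrow> independent I)"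

text \<open>Up to \<open>DIM('a)\<close> normals each lower the dimension by one, and more than that
  leave only the origin. So great circles are cut out by exactly d - 1 hyperplanes.\<close>

lemma general_position_dim_normals_perp:
  fixes U :: "'a::euclidean_space set"
  assumes U: "general_position U" and I: "I \<subseteq> U" and D: "DIM('a) \<ge> 2"
  shows "dim (normals_perp I) = 2 \<longleftrightarrow> card I = DIM('a) - 2"
proof -
  have fin: "finite I" using U I finite_subset by (auto simp: general_position_def)
  have d: "dim (normals_perp I) + dim I = DIM('a)" by (rule dim_normals_perp)
  show ?thesis
  proof (cases "card I \<le> DIM('a)")
    case True
    then have "dim I = card I" using U I by (auto simp: general_position_def dim_eq_card_independent)
    then show ?thesis using d D by auto
  next
    case False
    then have "DIM('a) \<le> card I" by simp
    then obtain J where J: "J \<subseteq> I" "card J = DIM('a)" by (rule obtain_subset_with_card_n)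
    then have "dim J = DIM('a)" using U I by (auto simp: general_position_def dim_eq_card_independent)
    moreover have "dim J \<le> dim I" using J by (intro dim_subset)
    ultimately show ?thesis using d D False by auto
  qed
qed

lemma exists_not_orthogonal:
  fixes U :: "'a::euclidean_space set"
  assumes "finite U" "0 \<notin> U"
  obtains p where "\<And>u. u \<in> U \<Longrightarrow> u \<bullet> p \<noteq> 0"
proof -
  have "negligible (\<Union>u\<in>U. {x. u \<bullet> x = 0})"
    using assms by (intro negligible_Union) (auto intro!: negligible_hyperplane)
  then have "(\<Union>u\<in>U. {x. u \<bullet> x = 0}) \<noteq> UNIV" using non_negligible_UNIV by metis
  then show thesis using that by blast
qed

text \<open>The cell is replaced by a point \<open>q\<close> in the relative interior of the cone
  over the edge: \<open>I\<close> collects the hyperplanes through \<open>q\<close>, and the others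
  bound the edge on its circle. In this form an edge shared by several cells is described without
  choosing one of them.\<close>

theorem tessellation_edges_general_position:
  fixes U :: "'a::euclidean_space set"
  assumes D: "DIM('a) \<ge> 2" and U: "general_position U"
  shows "tessellation_edges U = {sphere 0 1 \<inter> normals_perp I \<inter> sign_cone (U - I) q | I q.
     I \<subseteq> U \<and> card I = DIM('a) - 2 \<and> q \<in> normals_perp I \<and> (\<forall>u\<in>U - I. u \<bullet> q \<noteq> 0)}" (is "_ = ?R")
proof (intro equalityI subsetI)
  have fin: "finite U" using U by (simp add: general_position_def)
  fix e assume "e \<in> tessellation_edges U"
  then obtain F p where e: "e = sphere 0 1 \<inter> F" and p: "norm p = 1" "\<And>u. u \<in> U \<Longrightarrow> u \<bullet> p \<noteq> 0"
    and F: "F face_of sign_cone U p" "aff_dim F = 2"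
    unfolding tessellation_edges_sign_cone[OF D] by blast
  have "F \<noteq> {}" using F by auto
  then obtain q where q: "q \<in> F" "F = sign_cone U p \<inter> normals_perp {u \<in> U. u \<bullet> q = 0}"
    using face_of_sign_cone[OF fin p(2) F(1)] by blast
  define I where "I = {u \<in> U. u \<bullet> q = 0}"
  have qI: "q \<in> normals_perp I" by (auto simp: I_def normals_perp_def)
  have pq: "0 < (u \<bullet> p) * (u \<bullet> q)" if "u \<in> U - I" for u
  proof -
    have "0 \<le> (u \<bullet> p) * (u \<bullet> q)" using q that by (auto simp: sign_cone_def)
    moreover have "(u \<bullet> p) * (u \<bullet> q) \<noteq> 0" using p(2)[of u] that by (auto simp: I_def)
    ultimately show ?thesis by linarith
  qed
  have "aff_dim F = int (dim (normals_perp I))"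
    using aff_dim_sign_cone_Int_normals_perp[OF fin _ qI pq, of] q by (auto simp: I_def)
  then have cI: "card I = DIM('a) - 2"
    using F general_position_dim_normals_perp[OF U _ D, of I] by (auto simp: I_def)
  have "sign_cone U p \<inter> normals_perp I = normals_perp I \<inter> sign_cone (U - I) q"
  proof (intro set_eqI iffI)
    fix y assume y: "y \<in> sign_cone U p \<inter> normals_perp I"
    have "0 \<le> (u \<bullet> q) * (u \<bullet> y)" if u: "u \<in> U - I" for u
    proof -
      have "0 \<le> (u \<bullet> p) * (u \<bullet> y)" using y u by (auto simp: sign_cone_def)
      with pq[OF u] show ?thesis by (auto simp: zero_le_mult_iff zero_less_mult_iff)
    qed
    then show "y \<in> normals_perp I \<inter> sign_cone (U - I) q" using y by (auto simp: sign_cone_def)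
  next
    fix y assume y: "y \<in> normals_perp I \<inter> sign_cone (U - I) q"
    have "0 \<le> (u \<bullet> p) * (u \<bullet> y)" if u: "u \<in> U" for u
    proof (cases "u \<in> I")
      case False
      then have "0 \<le> (u \<bullet> q) * (u \<bullet> y)" using y u by (auto simp: sign_cone_def)
      with pq[of u] False u show ?thesis by (auto simp: zero_le_mult_iff zero_less_mult_iff)
    qed (use y in \<open>auto simp: normals_perp_def\<close>)
    then show "y \<in> sign_cone U p \<inter> normals_perp I" using y by (auto simp: sign_cone_def)
  qed
  then have "e = sphere 0 1 \<inter> normals_perp I \<inter> sign_cone (U - I) q"
    using e q by (auto simp: I_def)
  moreover have "I \<subseteq> U" "\<forall>u\<in>U - I. u \<bullet> q \<noteq> 0" by (auto simp: I_def)
  ultimately show "e \<in> ?R" using cI qI by blast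
next
  have fin: "finite U" using U by (simp add: general_position_def)
  fix e assume "e \<in> ?R"
  then obtain I q where e: "e = sphere 0 1 \<inter> normals_perp I \<inter> sign_cone (U - I) q"
    and I: "I \<subseteq> U" "card I = DIM('a) - 2" and q: "q \<in> normals_perp I" "\<And>u. u \<in> U - I \<Longrightarrow> u \<bullet> q \<noteq> 0" by blast
  have "0 \<notin> U"
  proof
    assume "0 \<in> U"
    then have "independent {0::'a}"
      using U D by (auto simp: general_position_def dest!: spec[of _ "{0::'a}"])
    then show False using dependent_zero[of "{0::'a}"] by simp
  qed
  then obtain p0 where p0: "\<And>u. u \<in> U \<Longrightarrow> u \<bullet> p0 \<noteq> 0" using exists_not_orthogonal[OF fin] by blast
  \<comment> \<open>Moving \<open>q\<close> slightly in a direction transversal to all hyperplanes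
    leaves those of \<open>I\<close> without crossing any other, so it reaches a chamber that has
    the edge on its boundary.\<close>
  have "\<forall>\<^sub>F t in at_right (0::real). \<forall>u\<in>U - I. 0 < (u \<bullet> (q + t *\<^sub>R p0)) * (u \<bullet> q)"
    unfolding eventually_ball_finite_distrib[OF finite_Diff[OF fin]]
  proof
    fix u assume u: "u \<in> U - I"
    have "((\<lambda>t. (u \<bullet> (q + t *\<^sub>R p0)) * (u \<bullet> q)) \<longlongrightarrow> (u \<bullet> (q + 0 *\<^sub>R p0)) * (u \<bullet> q)) (at_right 0)"
      by (intro tendsto_intros)
    moreover have "0 < (u \<bullet> (q + 0 *\<^sub>R p0)) * (u \<bullet> q)" using q(2)[OF u] by (auto simp: zero_less_mult_iff)
    ultimately show "\<forall>\<^sub>F t in at_right (0::real). 0 < (u \<bullet> (q + t *\<^sub>R p0)) * (u \<bullet> q)"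
      by (intro order_tendstoD(1))
  qed
  moreover have "\<forall>\<^sub>F t in at_right (0::real). t > 0" by (rule eventually_at_right_less)
  ultimately have "\<forall>\<^sub>F t in at_right (0::real). t > 0 \<and> (\<forall>u\<in>U - I. 0 < (u \<bullet> (q + t *\<^sub>R p0)) * (u \<bullet> q))"
    by eventually_elim auto
  then obtain t where t: "t > 0" "\<And>u. u \<in> U - I \<Longrightarrow> 0 < (u \<bullet> (q + t *\<^sub>R p0)) * (u \<bullet> q)"
    using eventually_happens trivial_limit_at_right_real by blast
  define p1 where "p1 = q + t *\<^sub>R p0"
  have p1: "u \<bullet> p1 \<noteq> 0" if u: "u \<in> U" for u
  proof (cases "u \<in> I")
    case True
    then have "u \<bullet> p1 = t * (u \<bullet> p0)" using q by (simp add: p1_def inner_add_right normals_perp_def)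
    then show ?thesis using t p0[OF u] by simp
  next
    case False
    then show ?thesis using t(2)[of u] u by (auto simp: p1_def)
  qed
  have "\<exists>p. norm p = 1 \<and> (\<forall>u\<in>U. u \<bullet> p \<noteq> 0) \<and> (\<forall>u\<in>U - I. 0 < (u \<bullet> p) * (u \<bullet> q))"
  \<comment> \<open>Normalising fails only at the origin, which lies on every hyperplane; then there
    is none, and any unit vector will do.\<close>
  proof (cases "p1 = 0")
    case True
    then have "U = {}" using p1 by auto
    then show ?thesis using SOME_Basis norm_Basis by blast
  next
    case False
    have "0 < (u \<bullet> sgn p1) * (u \<bullet> q)" if "u \<in> U - I" for u
    proof -
      have "(u \<bullet> sgn p1) * (u \<bullet> q) = ((u \<bullet> p1) * (u \<bullet> q)) / norm p1" by (simp add: sgn_div_norm divide_inverse)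
      then show ?thesis using t(2)[OF that] False by (simp add: p1_def)
    qed
    then show ?thesis using False p1 by (intro exI[of _ "sgn p1"]) (auto simp: norm_sgn sgn_div_norm)
  qed
  then obtain p where p: "norm p = 1" "\<And>u. u \<in> U \<Longrightarrow> u \<bullet> p \<noteq> 0" "\<And>u. u \<in> U - I \<Longrightarrow> 0 < (u \<bullet> p) * (u \<bullet> q)" by blast
  let ?F = "sign_cone U p \<inter> normals_perp I"
  have "aff_dim ?F = 2"
    using aff_dim_sign_cone_Int_normals_perp[OF fin I(1) q(1) p(3)] general_position_dim_normals_perp[OF U I(1) D] I(2) by simp
  moreover have "?F face_of sign_cone U p" by (rule sign_cone_Int_normals_perp_face[OF I(1) p(2)])
  moreover have "e = sphere 0 1 \<inter> ?F"
  proof -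
    have "0 \<le> (u \<bullet> q) * (u \<bullet> y) \<longleftrightarrow> 0 \<le> (u \<bullet> p) * (u \<bullet> y)" if u: "u \<in> U - I" for u y
      using p(3)[OF u] by (auto simp: zero_le_mult_iff zero_less_mult_iff)
    then have "normals_perp I \<inter> sign_cone (U - I) q = normals_perp I \<inter> sign_cone (U - I) p"
      by (auto simp: sign_cone_def)
    also have "\<dots> = ?F" using I(1) by (auto simp: sign_cone_def normals_perp_def)
    finally show ?thesis using e by blast
  qed
  ultimately show "e \<in> tessellation_edges U"
    unfolding tessellation_edges_sign_cone[OF D] using p by blast
qed

section \<open>Lines through the centre of a circle\<close>

text \<open>The preimage of an arc under the 2 * pi-periodic parametrisation. Sets of angles closed
  under the period can be compared without fixing a fundamental interval.\<close>

definition wrapped_interval :: "real \<Rightarrow> real \<Rightarrow> real set" where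
  "wrapped_interval s g = {x. \<exists>n::int. x + 2 * pi * of_int n \<in> {s..s + g}}"

lemma wrapped_interval_shift: "wrapped_interval (s + 2 * pi * of_int m) g = wrapped_interval s g"
proof -
  have "wrapped_interval s g \<subseteq> wrapped_interval (s + 2 * pi * of_int m) g" for s m
    unfolding wrapped_interval_def
  proof safe
    fix x and n :: int assume "x + 2 * pi * of_int n \<in> {s..s + g}"
    then have "x + 2 * pi * of_int (n + m) \<in> {s + 2 * pi * of_int m..s + 2 * pi * of_int m + g}"
      by (auto simp: algebra_simps)
    then show "\<exists>n::int. x + 2 * pi * of_int n \<in> {s + 2 * pi * of_int m..s + 2 * pi * of_int m + g}" ..
  qed
  from this[of s m] this[of "s + 2 * pi * of_int m" "- m"] show ?thesis by auto
qed

lemma circle_at_image_wrapped_interval: "circle_at v w ` wrapped_interval s g = circle_at v w ` {s..s + g}"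
proof (intro equalityI subsetI)
  fix y assume "y \<in> circle_at v w ` wrapped_interval s g"
  then obtain x n where x: "y = circle_at v w x" "x + 2 * pi * of_int n \<in> {s..s + g}"
    by (auto simp: wrapped_interval_def)
  have "circle_at v w (x + 2 * pi * of_int n) = circle_at v w x"
    using sin_cos_eq_iff[of "x + 2 * pi * of_int n" x] by (auto simp: circle_at_def)
  with x show "y \<in> circle_at v w ` {s..s + g}" by (metis imageI)
next
  fix y assume "y \<in> circle_at v w ` {s..s + g}"
  then obtain x where x: "y = circle_at v w x" "x \<in> {s..s + g}" by auto
  then have "x + 2 * pi * of_int 0 \<in> {s..s + g}" by simp
  then have "x \<in> wrapped_interval s g" unfolding wrapped_interval_def by blast
  with x show "y \<in> circle_at v w ` wrapped_interval s g" by simp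
qed

lemma sin_add_int_pi_eq_0_iff: "sin (x + of_int k * pi) = 0 \<longleftrightarrow> sin x = 0"
proof -
  have "sin (x + of_int k * pi) = sin x * cos (of_int k * pi)"
    using sin_npi_int[of k] by (simp add: sin_add mult.commute)
  moreover have "cos (of_int k * pi) \<noteq> 0"
    using sin_cos_squared_add[of "of_int k * pi"] sin_npi_int[of k] by (auto simp: mult.commute)
  ultimately show ?thesis by simp
qed

text \<open>The trace of the arrangement on one circle: line \<open>j\<close> is met at the angles
  \<open>\<theta> j\<close> plus multiples of pi, and \<open>\<delta> i j\<close> is the turn from a
  crossing of \<open>i\<close> to the next crossing of \<open>j\<close>. The sign of
  \<open>sin (x - \<theta> j)\<close> tells the side of line \<open>j\<close> on which the angle
  \<open>x\<close> lies.\<close>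

locale circle_lines =
  fixes J :: "'i set" and \<theta> :: "'i \<Rightarrow> real" and \<delta> :: "'i \<Rightarrow> 'i \<Rightarrow> real"
  assumes finite_J: "finite J"
    and distinct: "\<And>i j. i \<in> J \<Longrightarrow> j \<in> J \<Longrightarrow> i \<noteq> j \<Longrightarrow> sin (\<theta> i - \<theta> j) \<noteq> 0"
    and \<delta>_bounds: "\<And>i j. i \<in> J \<Longrightarrow> j \<in> J \<Longrightarrow> i \<noteq> j \<Longrightarrow> 0 < \<delta> i j \<and> \<delta> i j < pi"
    and \<delta>_zero: "\<And>i j. i \<in> J \<Longrightarrow> j \<in> J \<Longrightarrow> i \<noteq> j \<Longrightarrow> sin (\<theta> i + \<delta> i j - \<theta> j) = 0"
begin

text \<open>The value pi is the return to line \<open>i\<close> itself, at the antipode; it is the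
  gap if there is no other line.\<close>

definition gap :: "'i \<Rightarrow> real" where
  "gap i = Min (insert pi (\<delta> i ` (J - {i})))"

definition region :: "real \<Rightarrow> real set" where
  "region \<phi> = {x. \<forall>j\<in>J. 0 \<le> sin (\<phi> - \<theta> j) * sin (x - \<theta> j)}"

lemma gap_pos: "i \<in> J \<Longrightarrow> 0 < gap i"
  unfolding gap_def using finite_J \<delta>_bounds by (subst Min_gr_iff) auto

lemma gap_le_pi: "gap i \<le> pi"
  unfolding gap_def using finite_J by (intro Min_le) auto

lemma gap_le: "j \<in> J \<Longrightarrow> j \<noteq> i \<Longrightarrow> gap i \<le> \<delta> i j"
  unfolding gap_def using finite_J by (intro Min_le) auto

lemma gap_cases:
  obtains "gap i = pi" | j where "j \<in> J" "j \<noteq> i" "gap i = \<delta> i j"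
proof -
  have "gap i \<in> insert pi (\<delta> i ` (J - {i}))"
    unfolding gap_def using finite_J by (intro Min_in) auto
  then show thesis using that by auto
qed

lemma less_gap_iff: "x < gap i \<longleftrightarrow> x < pi \<and> (\<forall>j\<in>J - {i}. x < \<delta> i j)"
  unfolding gap_def using finite_J by (subst Min_gr_iff) auto

text \<open>Seen from the zero \<open>s\<close> of line \<open>i\<close>, every line \<open>j\<close> has its next zero at
  distance \<open>a\<close>, and no such zero comes before \<open>gap i\<close>.\<close>

lemma sin_from_zero:
  assumes i: "i \<in> J" and j: "j \<in> J" and s: "s = \<theta> i + of_int k * pi"
  obtains a c where "gap i \<le> a" "a \<le> pi" "c\<^sup>2 = 1" "\<And>x. sin (s + x - \<theta> j) = c * sin (x - a)"
    "j = i \<Longrightarrow> a = pi" "j \<noteq> i \<Longrightarrow> a = \<delta> i j"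
proof -
  define a where "a = (if j = i then pi else \<delta> i j)"
  have a: "gap i \<le> a" "a \<le> pi"
    using gap_le[of j i] gap_le_pi[of i] \<delta>_bounds[OF i j] j by (auto simp: a_def)
  have "sin (\<theta> i + a - \<theta> j) = 0" using \<delta>_zero[OF i j] by (auto simp: a_def)
  moreover have "s + a - \<theta> j = (\<theta> i + a - \<theta> j) + of_int k * pi" by (simp add: s)
  ultimately have 0: "sin (s + a - \<theta> j) = 0" by (simp only: sin_add_int_pi_eq_0_iff)
  define c where "c = cos (s + a - \<theta> j)"
  have c: "c\<^sup>2 = 1" using 0 sin_cos_squared_add[of "s + a - \<theta> j"] by (simp add: c_def)
  have "sin (s + x - \<theta> j) = c * sin (x - a)" for x
  proof -
    have "s + x - \<theta> j = (x - a) + (s + a - \<theta> j)" by simp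
    then have "sin (s + x - \<theta> j) = sin (x - a) * cos (s + a - \<theta> j) + cos (x - a) * sin (s + a - \<theta> j)"
      by (metis sin_add)
    then show ?thesis using 0 by (simp add: c_def)
  qed
  then show thesis using a c by (intro that[of a c]) (auto simp: a_def)
qed

lemma sin_between_neg: "0 < x \<Longrightarrow> x < a \<Longrightarrow> a \<le> pi \<Longrightarrow> sin (x - a) < 0"
  using sin_gt_zero[of "a - x"] sin_minus[of "a - x"] by simp

text \<open>Measured from \<open>s\<close>, each line gives the condition
  \<open>sin (x - a) \<le> 0\<close> with its own next crossing \<open>a \<ge> gap i\<close>. All
  hold up to the gap; after it and up to pi, a line that attains the gap fails; between pi and 2 *
  pi line \<open>i\<close> fails.\<close>

lemma region_eq:
  assumes i: "i \<in> J" and s: "s = \<theta> i + of_int k * pi" and \<phi>: "s < \<phi>" "\<phi> < s + gap i"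
  shows "region \<phi> = wrapped_interval s (gap i)" and "\<And>j. j \<in> J \<Longrightarrow> sin (\<phi> - \<theta> j) \<noteq> 0"
proof -
  define f where "f = \<phi> - s"
  have f: "0 < f" "f < gap i" "\<phi> = s + f" using \<phi> by (auto simp: f_def)
  have prod: "\<exists>a\<ge>gap i. a \<le> pi \<and> (j = i \<longrightarrow> a = pi) \<and> (j \<noteq> i \<longrightarrow> a = \<delta> i j) \<and> sin (f - a) < 0 \<and>
      sin (\<phi> - \<theta> j) \<noteq> 0 \<and> (\<forall>x. 0 \<le> sin (\<phi> - \<theta> j) * sin (s + x - \<theta> j) \<longleftrightarrow> sin (x - a) \<le> 0)"
    if j: "j \<in> J" for j
  proof -
    obtain a c where a: "gap i \<le> a" "a \<le> pi" "c\<^sup>2 = 1" "\<And>x. sin (s + x - \<theta> j) = c * sin (x - a)"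
      "j = i \<Longrightarrow> a = pi" "j \<noteq> i \<Longrightarrow> a = \<delta> i j" using sin_from_zero[OF i j s] by metis
    have neg: "sin (f - a) < 0" using a f by (intro sin_between_neg) auto
    have "sin (\<phi> - \<theta> j) * sin (s + x - \<theta> j) = sin (f - a) * sin (x - a)" for x
    proof -
      have "sin (\<phi> - \<theta> j) * sin (s + x - \<theta> j) = c\<^sup>2 * (sin (f - a) * sin (x - a))"
        by (simp add: f(3) a(4) power2_eq_square)
      then show ?thesis by (simp add: a(3))
    qed
    then have "0 \<le> sin (\<phi> - \<theta> j) * sin (s + x - \<theta> j) \<longleftrightarrow> sin (x - a) \<le> 0" for x
      using neg by (simp add: zero_le_mult_iff)
    moreover have "sin (\<phi> - \<theta> j) \<noteq> 0" using a(3) a(4)[of f] neg by (auto simp: f(3))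
    ultimately show ?thesis using a neg by blast
  qed
  show "\<And>j. j \<in> J \<Longrightarrow> sin (\<phi> - \<theta> j) \<noteq> 0" using prod by blast
  have per: "x \<in> region \<phi> \<longleftrightarrow> x + 2 * pi * of_int n \<in> region \<phi>" for x and n :: int
  proof -
    have "sin (x + 2 * pi * of_int n - \<theta> j) = sin (x - \<theta> j)" for j
      using sin_cos_eq_iff[of "x + 2 * pi * of_int n - \<theta> j" "x - \<theta> j"] by auto
    then show ?thesis by (simp add: region_def)
  qed
  have inside: "s + x \<in> region \<phi>" if x: "0 \<le> x" "x \<le> gap i" for x
    unfolding region_def
  proof safe
    fix j assume "j \<in> J"
    from prod[OF this] obtain a where a: "gap i \<le> a" "a \<le> pi"
      "\<And>x. 0 \<le> sin (\<phi> - \<theta> j) * sin (s + x - \<theta> j) \<longleftrightarrow> sin (x - a) \<le> 0" by blast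
    have "sin (x - a) \<le> 0" using sin_ge_zero[of "a - x"] sin_minus[of "a - x"] a x by simp
    then show "0 \<le> sin (\<phi> - \<theta> j) * sin (s + x - \<theta> j)" using a by simp
  qed
  have outside: "s + x \<notin> region \<phi>" if x: "gap i < x" "x < 2 * pi" for x
  proof
    assume r: "s + x \<in> region \<phi>"
    have xpi: "x \<le> pi"
    proof (rule ccontr)
      assume "\<not> x \<le> pi"
      then have "sin (x - pi) > 0" using x by (intro sin_gt_zero) auto
      moreover from prod[OF i] have "0 \<le> sin (\<phi> - \<theta> i) * sin (s + x - \<theta> i) \<longleftrightarrow> sin (x - pi) \<le> 0" by blast
      ultimately show False using r i by (auto simp: region_def)
    qed
    show False
    proof (rule gap_cases[of i])
      assume "gap i = pi" then show False using x xpi by simp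
    next
      fix j assume j: "j \<in> J" "j \<noteq> i" "gap i = \<delta> i j"
      have "sin (x - \<delta> i j) > 0" using x xpi j gap_pos[OF i] by (intro sin_gt_zero) auto
      moreover from prod[OF j(1)] j have "0 \<le> sin (\<phi> - \<theta> j) * sin (s + x - \<theta> j) \<longleftrightarrow> sin (x - \<delta> i j) \<le> 0" by metis
      ultimately show False using r j by (auto simp: region_def)
    qed
  qed
  show "region \<phi> = wrapped_interval s (gap i)"
  proof (intro equalityI subsetI)
    fix x assume x: "x \<in> region \<phi>"
    define n where "n = - \<lfloor>(x - s) / (2 * pi)\<rfloor>"
    define y where "y = x + 2 * pi * of_int n - s"
    have "of_int (- n) \<le> (x - s) / (2 * pi)" "(x - s) / (2 * pi) < of_int (- n) + 1"
      unfolding n_def by (simp_all add: floor_correct)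
    then have y: "0 \<le> y" "y < 2 * pi" by (auto simp: y_def field_simps)
    have "s + y \<in> region \<phi>" using per[of x n] x by (simp add: y_def)
    then have "y \<le> gap i" using outside[of y] y by linarith
    then show "x \<in> wrapped_interval s (gap i)" using y unfolding wrapped_interval_def y_def by (auto intro!: exI[of _ n])
  next
    fix x assume "x \<in> wrapped_interval s (gap i)"
    then obtain n where "x + 2 * pi * of_int n \<in> {s..s + gap i}" by (auto simp: wrapped_interval_def)
    then have "x + 2 * pi * of_int n \<in> region \<phi>" using inside[of "x + 2 * pi * of_int n - s"] by simp
    then show "x \<in> region \<phi>" using per by blast
  qed
qed

text \<open>Among the lines take one whose last crossing before \<open>\<phi>\<close> is nearest. No
  other line crosses between it and \<open>\<phi>\<close>, so \<open>\<phi>\<close> comes before the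
  end of its gap.\<close>

lemma exists_preceding_zero:
  assumes J: "J \<noteq> {}" and \<phi>: "\<And>j. j \<in> J \<Longrightarrow> sin (\<phi> - \<theta> j) \<noteq> 0"
  obtains i k where "i \<in> J" "\<theta> i + of_int k * pi < \<phi>" "\<phi> < \<theta> i + of_int k * pi + gap i"
proof -
  define m where "m j = \<lfloor>(\<phi> - \<theta> j) / pi\<rfloor>" for j
  define \<beta> where "\<beta> j = \<phi> - \<theta> j - of_int (m j) * pi" for j
  have \<beta>: "0 < \<beta> j" "\<beta> j < pi" if "j \<in> J" for j
  proof -
    have "of_int (m j) \<le> (\<phi> - \<theta> j) / pi" "(\<phi> - \<theta> j) / pi < of_int (m j) + 1"
      unfolding m_def by (simp_all add: floor_correct)
    then have "0 \<le> \<beta> j" "\<beta> j < pi" by (auto simp: \<beta>_def field_simps)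
    moreover have "\<beta> j \<noteq> 0"
      using \<phi>[OF that] sin_zero_iff_int2[of "\<phi> - \<theta> j"] by (auto simp: \<beta>_def)
    ultimately show "0 < \<beta> j" "\<beta> j < pi" by auto
  qed
  have "Min (\<beta> ` J) \<in> \<beta> ` J" using J finite_J by (intro Min_in) auto
  then obtain i where i: "i \<in> J" "\<beta> i = Min (\<beta> ` J)" by auto
  have min: "\<beta> i \<le> \<beta> j" if "j \<in> J" for j using that i finite_J by (auto intro: Min_le)
  have "\<beta> i < \<delta> i j" if j: "j \<in> J - {i}" for j
  proof (rule ccontr)
    assume "\<not> \<beta> i < \<delta> i j"
    then have le: "\<delta> i j \<le> \<beta> i" by simp
    have \<delta>: "0 < \<delta> i j" using \<delta>_bounds[of i j] i j by auto
    have "sin (\<theta> i + \<delta> i j - \<theta> j) = 0" using \<delta>_zero[of i j] i j by auto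
    then obtain l :: int where l: "\<theta> i + \<delta> i j - \<theta> j = of_int l * pi" using sin_zero_iff_int2 by blast
    \<comment> \<open>Both \<open>\<beta> j\<close> and \<open>\<beta> i - \<delta> i j\<close>
      measure the way back from \<open>\<phi>\<close> to a crossing of \<open>j\<close> and lie in
      [0, pi), so they agree; then \<open>j\<close> would be nearer than \<open>i\<close>.\<close>
    have "\<beta> j - (\<beta> i - \<delta> i j) = of_int (l + m i - m j) * pi"
      using l by (simp add: \<beta>_def algebra_simps)
    moreover have "\<bar>\<beta> j - (\<beta> i - \<delta> i j)\<bar> < pi" using \<beta>[of j] \<beta>[of i] i j le \<delta> by auto
    ultimately have "\<bar>real_of_int (l + m i - m j)\<bar> * pi < pi" by (simp only: abs_mult abs_of_pos[OF pi_gt_zero])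
    then have "\<bar>real_of_int (l + m i - m j)\<bar> < 1" by simp
    then have "l + m i - m j = 0" by linarith
    then have "\<beta> j = \<beta> i - \<delta> i j" using \<open>\<beta> j - (\<beta> i - \<delta> i j) = of_int (l + m i - m j) * pi\<close> by simp
    then show False using min[of j] j \<delta> by auto
  qed
  then have "\<beta> i < gap i" using \<beta>[OF i(1)] by (simp add: less_gap_iff)
  then show thesis using \<beta>[OF i(1)] i by (intro that[of i "m i"]) (auto simp: \<beta>_def)
qed

definition arc :: "'i \<times> int \<Rightarrow> real set" where
  "arc = (\<lambda>(i, k). wrapped_interval (\<theta> i + of_int k * pi) (gap i))"

text \<open>A region starts at the last crossing before any of its inner angles, and modulo 2 * pi
  the crossings of one line are \<open>\<theta> i\<close> and its antipode: hence the labels 0 and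
  1.\<close>

lemma regions_eq_arcs:
  assumes "J \<noteq> {}"
  shows "{region \<phi> |\<phi>. \<forall>j\<in>J. sin (\<phi> - \<theta> j) \<noteq> 0} = arc ` (J \<times> {0, 1})"
proof (intro equalityI subsetI)
  fix R assume "R \<in> {region \<phi> |\<phi>. \<forall>j\<in>J. sin (\<phi> - \<theta> j) \<noteq> 0}"
  then obtain \<phi> where \<phi>: "R = region \<phi>" "\<And>j. j \<in> J \<Longrightarrow> sin (\<phi> - \<theta> j) \<noteq> 0" by blast
  obtain i k where ik: "i \<in> J" "\<theta> i + of_int k * pi < \<phi>" "\<phi> < \<theta> i + of_int k * pi + gap i"
    using exists_preceding_zero[OF assms \<phi>(2)] by blast
  have "R = wrapped_interval (\<theta> i + of_int k * pi) (gap i)"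
    using region_eq(1)[OF ik(1) refl ik(2,3)] \<phi> by simp
  also have "\<theta> i + of_int k * pi = (\<theta> i + of_int (k mod 2) * pi) + 2 * pi * of_int (k div 2)"
  proof -
    have "k = k mod 2 + 2 * (k div 2)" by simp
    then have "real_of_int k = of_int (k mod 2) + 2 * of_int (k div 2)" by (metis of_int_add of_int_mult of_int_numeral)
    then show ?thesis by (simp add: algebra_simps)
  qed
  finally have "R = arc (i, k mod 2)" by (simp only: wrapped_interval_shift arc_def prod.case)
  moreover have "k mod 2 \<in> {0, 1}" by auto
  ultimately show "R \<in> arc ` (J \<times> {0, 1})"
    by (intro image_eqI[of _ _ "(i, k mod 2)"]) (simp_all only: mem_Sigma_iff ik simp_thms)
next
  fix R assume "R \<in> arc ` (J \<times> {0, 1})"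
  then obtain i k where ik: "i \<in> J" "R = wrapped_interval (\<theta> i + of_int k * pi) (gap i)" by (auto simp: arc_def)
  let ?\<phi> = "\<theta> i + of_int k * pi + gap i / 2"
  have \<phi>: "\<theta> i + of_int k * pi < ?\<phi>" "?\<phi> < \<theta> i + of_int k * pi + gap i" using gap_pos[OF ik(1)] by auto
  show "R \<in> {region \<phi> |\<phi>. \<forall>j\<in>J. sin (\<phi> - \<theta> j) \<noteq> 0}"
    using region_eq[OF ik(1) refl \<phi>] ik(2) by blast
qed

text \<open>An arc of length at most pi has a recognisable first point: going back a little from
  \<open>s\<close> leaves the first arc, so \<open>s\<close> cannot lie further on in the
  second.\<close>

lemma wrapped_interval_start:
  assumes g: "0 < g" "g \<le> pi" "0 < g'" "g' \<le> pi" and sub: "wrapped_interval s g = wrapped_interval s' g'"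
  obtains n :: int where "s = s' + 2 * pi * of_int n"
proof -
  have "s + 2 * pi * of_int 0 \<in> {s..s + g}" using g by simp
  then have "s \<in> wrapped_interval s g" unfolding wrapped_interval_def by blast
  then have "s \<in> wrapped_interval s' g'" by (simp only: sub)
  then obtain n :: int where n: "s + 2 * pi * of_int n \<in> {s'..s' + g'}" by (auto simp: wrapped_interval_def)
  define x where "x = s + 2 * pi * of_int n - s'"
  have x: "0 \<le> x" "x \<le> g'" using n by (auto simp: x_def)
  have "x = 0"
  proof (rule ccontr)
    assume "x \<noteq> 0"
    \<comment> \<open>A step back short enough to stay in the second arc, and below pi so that it
      cannot wrap around into the first.\<close>
    define e where "e = min x 1"
    have e: "0 < e" "e \<le> x" "e < pi" using x \<open>x \<noteq> 0\<close> pi_gt3 by (auto simp: e_def)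
    have "(s - e) + 2 * pi * of_int n \<in> {s'..s' + g'}" using e x by (auto simp: x_def)
    then have "s - e \<in> wrapped_interval s' g'" unfolding wrapped_interval_def by blast
    then have "s - e \<in> wrapped_interval s g" by (simp only: sub)
    then obtain m :: int where m: "s - e + 2 * pi * of_int m \<in> {s..s + g}" by (auto simp: wrapped_interval_def)
    then have m1: "e \<le> 2 * pi * of_int m" "2 * pi * of_int m \<le> g + e" by auto
    then have "0 < real_of_int m" using e by (smt (verit) mult_nonneg_nonpos pi_gt_zero)
    then have "1 \<le> real_of_int m" by simp
    then have "2 * pi \<le> 2 * pi * of_int m" by simp
    then show False using m1 e g by linarith
  qed
  then have "s = s' + 2 * pi * of_int (- n)" by (simp add: x_def)
  then show thesis by (rule that)
qed

text \<open>Equal arcs start at the same angle modulo 2 * pi; distinct lines share no crossing, and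
  the two crossings of one line differ by pi.\<close>

lemma inj_on_arc: "inj_on arc (J \<times> {0, 1})"
proof (rule inj_onI)
  fix p q assume p: "p \<in> J \<times> {0, 1}" and q: "q \<in> J \<times> {0, 1}" and eq: "arc p = arc q"
  obtain i k i' k' where ik: "p = (i, k)" "q = (i', k')" by fastforce
  with p q have i: "i \<in> J" "i' \<in> J" and k: "k \<in> {0, 1}" "k' \<in> {0, 1}" by auto
  from eq have "wrapped_interval (\<theta> i + of_int k * pi) (gap i) = wrapped_interval (\<theta> i' + of_int k' * pi) (gap i')"
    by (simp add: arc_def ik)
  then obtain n :: int where n: "\<theta> i + of_int k * pi = \<theta> i' + of_int k' * pi + 2 * pi * of_int n"
    using wrapped_interval_start gap_pos gap_le_pi i by metis
  then have "\<theta> i - \<theta> i' = of_int (k' - k + 2 * n) * pi" by (simp add: algebra_simps)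
  then have "sin (\<theta> i - \<theta> i') = 0" using sin_zero_iff_int2 by blast
  then have ii: "i = i'" using distinct[OF i] by blast
  with n have "of_int (k - k' - 2 * n) * pi = 0" by (simp add: algebra_simps)
  then have "k - k' - 2 * n = 0" by simp
  with k have "k = k'" by auto presburger+
  with ii show "p = q" by (simp add: ik)
qed

end

section \<open>Edges as circular arcs\<close>

text \<open>Here \<open>v, w\<close> is an oriented orthonormal basis of a plane; \<open>(u \<bullet> w) v - (u \<bullet> v) w\<close> spans the line
  in it that is orthogonal to \<open>u\<close>, and \<open>angle_to\<close> is the angle of the positive rotation that takes
  it to the line orthogonal to \<open>y\<close>.\<close>

definition angle_to :: "'a::euclidean_space \<Rightarrow> 'a \<Rightarrow> 'a \<Rightarrow> 'a \<Rightarrow> real" where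
  "angle_to v w u y = pi / 2 + arctan ((y \<bullet> ((u \<bullet> v) *\<^sub>R v + (u \<bullet> w) *\<^sub>R w)) / (y \<bullet> ((u \<bullet> w) *\<^sub>R v - (u \<bullet> v) *\<^sub>R w)))"

definition gap_to :: "'a::euclidean_space \<Rightarrow> 'a \<Rightarrow> 'a set \<Rightarrow> 'a \<Rightarrow> real" where
  "gap_to v w Y u = Min (insert pi (angle_to v w u ` (Y - {u})))"

definition orthonormal_pair :: "'a::euclidean_space \<Rightarrow> 'a \<Rightarrow> bool" where
  "orthonormal_pair v w \<longleftrightarrow> norm v = 1 \<and> norm w = 1 \<and> v \<bullet> w = 0"

definition edges_within :: "'a::euclidean_space set \<Rightarrow> 'a set \<Rightarrow> 'a set set" where
  "edges_within U I =
     {sphere 0 1 \<inter> normals_perp I \<inter> sign_cone (U - I) q | q. q \<in> normals_perp I \<and> (\<forall>u\<in>U - I. u \<bullet> q \<noteq> 0)}"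

lemma orthogonal_card_le:
  fixes X Z :: "'a::euclidean_space set"
  assumes "independent X" "independent Z" "\<And>x z. x \<in> X \<Longrightarrow> z \<in> Z \<Longrightarrow> x \<bullet> z = 0"
  shows "card X + card Z \<le> DIM('a)"
proof -
  have "Z \<subseteq> normals_perp X" using assms(3) by (auto simp: normals_perp_def)
  then have "dim Z \<le> dim (normals_perp X)" by (rule dim_subset)
  then show ?thesis
    using dim_normals_perp[of X] assms by (simp add: dim_eq_card_independent)
qed

text \<open>With \<open>D\<close> the difference of two line angles,
  \<open>pi / 2 + arctan (cos D / sin D)\<close> is the representative of - D modulo pi in (0, pi),
  which is the turn to the next crossing.\<close>

lemma arctan_cot:
  assumes "sin D \<noteq> 0"
  shows "sin (pi / 2 + arctan (cos D / sin D) + D) = 0"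
proof -
  define t where "t = arctan (cos D / sin D)"
  have "cos t \<noteq> 0" by (simp add: t_def)
  moreover have "tan t = cos D / sin D" by (simp add: t_def tan_arctan)
  ultimately have "sin t * sin D = cos D * cos t" using assms by (simp add: tan_def field_simps)
  moreover have "sin (pi / 2 + t + D) = cos t * cos D - sin t * sin D"
    using sin_add[of "pi / 2" "t + D"] by (simp add: cos_add add.assoc)
  ultimately show ?thesis by (simp add: t_def mult.commute)
qed

lemma wrapped_interval_periodic: "x \<in> wrapped_interval s g \<longleftrightarrow> x + 2 * pi * of_int n \<in> wrapped_interval s g"
proof
  assume "x \<in> wrapped_interval s g"
  then obtain m :: int where "x + 2 * pi * of_int m \<in> {s..s + g}" by (auto simp: wrapped_interval_def)
  then have "x + 2 * pi * of_int n + 2 * pi * of_int (m - n) \<in> {s..s + g}" by (simp add: algebra_simps)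
  then show "x + 2 * pi * of_int n \<in> wrapped_interval s g" unfolding wrapped_interval_def by blast
next
  assume "x + 2 * pi * of_int n \<in> wrapped_interval s g"
  then obtain m :: int where "x + 2 * pi * of_int n + 2 * pi * of_int m \<in> {s..s + g}" by (auto simp: wrapped_interval_def)
  then have "x + 2 * pi * of_int (n + m) \<in> {s..s + g}" by (simp add: algebra_simps)
  then show "x \<in> wrapped_interval s g" unfolding wrapped_interval_def by blast
qed

lemma norm_circle_at: "orthonormal_pair v w \<Longrightarrow> norm (circle_at v w x) = 1"
proof -
  assume o: "orthonormal_pair v w"
  then have "v \<bullet> v = 1" "w \<bullet> w = 1" "v \<bullet> w = 0" "w \<bullet> v = 0"
    by (auto simp: orthonormal_pair_def dot_square_norm inner_commute)
  then have "circle_at v w x \<bullet> circle_at v w x = (cos x)\<^sup>2 + (sin x)\<^sup>2"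
    by (simp add: circle_at_def inner_add_left inner_add_right power2_eq_square)
  then show ?thesis by (simp add: norm_eq_sqrt_inner)
qed

lemma circle_at_eq_iff:
  assumes o: "orthonormal_pair v w"
  shows "circle_at v w x = circle_at v w y \<longleftrightarrow> (\<exists>n::int. x = y + 2 * pi * of_int n)"
proof -
  have oo: "v \<bullet> v = 1" "w \<bullet> w = 1" "v \<bullet> w = 0" "w \<bullet> v = 0"
    using o by (auto simp: orthonormal_pair_def dot_square_norm inner_commute)
  have "circle_at v w z \<bullet> v = cos z" "circle_at v w z \<bullet> w = sin z" for z
    by (simp_all add: circle_at_def inner_add_left oo)
  then have "circle_at v w x = circle_at v w y \<longleftrightarrow> sin x = sin y \<and> cos x = cos y"
    by (metis circle_at_def)
  then show ?thesis using sin_cos_eq_iff[of x y] by simp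
qed

lemma inj_circle_at_wrapped:
  assumes o: "orthonormal_pair v w"
    and eq: "circle_at v w ` wrapped_interval s g = circle_at v w ` wrapped_interval s' g'"
  shows "wrapped_interval s g = wrapped_interval s' g'"
proof -
  have "wrapped_interval s g \<subseteq> wrapped_interval s' g'"
    if "circle_at v w ` wrapped_interval s g = circle_at v w ` wrapped_interval s' g'" for s g s' g'
  proof
    fix x assume "x \<in> wrapped_interval s g"
    then have "circle_at v w x \<in> circle_at v w ` wrapped_interval s' g'" using that by blast
    then obtain y where y: "y \<in> wrapped_interval s' g'" "circle_at v w x = circle_at v w y" by auto
    then obtain n :: int where "x = y + 2 * pi * of_int n" using circle_at_eq_iff[OF o] by blast
    then show "x \<in> wrapped_interval s' g'" using y(1) wrapped_interval_periodic by simp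
  qed
  from this[OF eq] this[OF eq[symmetric]] show ?thesis by blast
qed

context
  fixes U I :: "'a::euclidean_space set" and v w :: 'a
  assumes D: "DIM('a) \<ge> 2" and U: "general_position U" and I: "I \<subseteq> U" "card I = DIM('a) - 2"
    and vw: "orthonormal_pair v w" "v \<in> normals_perp I" "w \<in> normals_perp I"
begin

lemma vw_inner: "v \<bullet> v = 1" "w \<bullet> w = 1" "v \<bullet> w = 0" "w \<bullet> v = 0"
  using vw by (auto simp: orthonormal_pair_def dot_square_norm inner_commute)

lemma finite_normals: "finite U" "finite I"
  using U I finite_subset by (auto simp: general_position_def)

lemma independent_vw: "independent {v, w}" "v \<noteq> w"
proof -
  show "v \<noteq> w" using vw_inner by auto
  show "independent {v, w}"
    by (rule pairwise_orthogonal_independent) (use vw_inner in \<open>auto simp: pairwise_def orthogonal_def\<close>)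
qed

lemma circle_at_in_normals_perp: "circle_at v w x \<in> normals_perp I"
  using vw by (auto simp: circle_at_def normals_perp_def inner_add_right)

lemma sphere_Int_normals_perp: "sphere 0 1 \<inter> normals_perp I = range (circle_at v w)"
proof (intro equalityI subsetI)
  fix y assume y: "y \<in> sphere 0 1 \<inter> normals_perp I"
  define y' where "y' = y - (y \<bullet> v) *\<^sub>R v - (y \<bullet> w) *\<^sub>R w"
  have o: "y' \<bullet> v = 0" "y' \<bullet> w = 0" "v \<bullet> y' = 0" "w \<bullet> y' = 0"
    by (simp_all add: y'_def inner_diff_left inner_diff_right vw_inner inner_commute[of v y] inner_commute[of w y])
  have "y' = 0"
  proof (rule ccontr)
    assume n0: "y' \<noteq> 0"
    \<comment> \<open>Otherwise \<open>I\<close> and these three vectors, orthogonal to it, would be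
      \<open>DIM('a) + 1\<close> independent vectors.\<close>
    have "independent {v, w, y'}"
      by (rule pairwise_orthogonal_independent) (use vw_inner o n0 in \<open>auto simp: pairwise_def orthogonal_def\<close>)
    moreover have "card {v, w, y'} = 3"
    proof -
      have "y' \<noteq> v" "y' \<noteq> w" using o vw_inner by auto
      then show ?thesis using independent_vw(2) by auto
    qed
    moreover have "independent I" using U I D by (auto simp: general_position_def)
    moreover have "x \<bullet> z = 0" if "x \<in> I" "z \<in> {v, w, y'}" for x z
      using that vw y by (auto simp: normals_perp_def y'_def inner_diff_right)
    ultimately have "card I + 3 \<le> DIM('a)" using orthogonal_card_le[of I "{v, w, y'}"] by simp
    with I D show False by simp
  qed
  then have eq: "y = (y \<bullet> v) *\<^sub>R v + (y \<bullet> w) *\<^sub>R w" by (simp add: y'_def algebra_simps)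
  have "y \<bullet> y = (y \<bullet> v)\<^sup>2 + (y \<bullet> w)\<^sup>2"
    by (subst (2) eq) (simp add: inner_add_right power2_eq_square)
  moreover have "y \<bullet> y = 1" using y by (simp add: dot_square_norm)
  ultimately obtain t where "y \<bullet> v = cos t" "y \<bullet> w = sin t"
    using sincos_total_2pi[of "y \<bullet> v" "y \<bullet> w"] by metis
  then show "y \<in> range (circle_at v w)" using eq by (auto simp: circle_at_def)
next
  fix y assume "y \<in> range (circle_at v w)"
  then show "y \<in> sphere 0 1 \<inter> normals_perp I"
    using circle_at_in_normals_perp norm_circle_at[OF vw(1)] by auto
qed

lemma sphere_Int_normals_perp_arc: "sphere 0 1 \<inter> normals_perp I = circle_at v w ` {0..0 + 2 * pi}"
proof -
  have "UNIV = wrapped_interval 0 (2 * pi)"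
  proof (intro equalityI subsetI)
    fix x :: real
    define n where "n = - \<lfloor>x / (2 * pi)\<rfloor>"
    have "of_int (- n) \<le> x / (2 * pi)" "x / (2 * pi) < of_int (- n) + 1"
      unfolding n_def by (simp_all add: floor_correct)
    then have "x + 2 * pi * of_int n \<in> {0..0 + 2 * pi}" by (auto simp: field_simps)
    then show "x \<in> wrapped_interval 0 (2 * pi)" unfolding wrapped_interval_def by blast
  qed simp
  then show ?thesis using circle_at_image_wrapped_interval[of v w 0 "2 * pi"] sphere_Int_normals_perp by simp
qed

text \<open>The angle \<open>\<theta> u\<close> is that of the line orthogonal to \<open>u\<close>,
  a quarter turn away from the projection of \<open>u\<close>; hence the minus sign and the exchange
  of sine and cosine. It makes
  \<open>u \<bullet> circle_at v w x = r u * sin (x - \<theta> u)\<close>.\<close>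

lemma polar_normals:
  obtains r \<theta> where "\<And>u. u \<in> U - I \<Longrightarrow> r u > 0"
    "\<And>u. u \<in> U - I \<Longrightarrow> u \<bullet> v = - r u * sin (\<theta> u)" "\<And>u. u \<in> U - I \<Longrightarrow> u \<bullet> w = r u * cos (\<theta> u)"
proof -
  have "\<exists>r \<theta>. r > 0 \<and> u \<bullet> v = - r * sin \<theta> \<and> u \<bullet> w = r * cos \<theta>" if u: "u \<in> U - I" for u
  proof -
    \<comment> \<open>If the projection of \<open>u\<close> vanished, \<open>u\<close> and
      \<open>I\<close> would be \<open>DIM('a) - 1\<close> independent vectors orthogonal to the
      independent \<open>v, w\<close>.\<close>
    have nz: "Complex (u \<bullet> w) (- (u \<bullet> v)) \<noteq> 0"
    proof
      assume "Complex (u \<bullet> w) (- (u \<bullet> v)) = 0"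
      then have 0: "u \<bullet> v = 0" "u \<bullet> w = 0" by (auto simp: complex_eq_iff)
      have "card (insert u I) = DIM('a) - 1" using u finite_normals I D by simp
      moreover have "independent (insert u I)"
        using U I u calculation by (auto simp: general_position_def)
      moreover have "x \<bullet> z = 0" if "x \<in> insert u I" "z \<in> {v, w}" for x z
        using that 0 vw by (auto simp: normals_perp_def)
      ultimately have "DIM('a) - 1 + 2 \<le> DIM('a)"
        using orthogonal_card_le[OF _ independent_vw(1), of "insert u I"] independent_vw(2) by simp
      with D show False by simp
    qed
    define z where "z = Complex (u \<bullet> w) (- (u \<bullet> v))"
    have "z = rcis (cmod z) (Arg z)" by (simp add: rcis_cmod_Arg)
    then have "Re z = cmod z * cos (Arg z)" "Im z = cmod z * sin (Arg z)"
      by (metis Re_rcis, metis Im_rcis)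
    moreover have "cmod z > 0" using nz by (simp add: z_def)
    ultimately show ?thesis
      by (intro exI[of _ "cmod z"] exI[of _ "Arg z"]) (auto simp: z_def)
  qed
  then show thesis using that by metis
qed

text \<open>Translates the arrangement on the circle into \<open>circle_lines\<close>. The last two
  properties let an edge remember its circle: some point of it lies on no hyperplane but those of
  \<open>I\<close>, which later separates the edges of different circles.\<close>

lemma edges_within_arcs:
  assumes ne: "U - I \<noteq> {}"
  obtains A :: "'a \<times> int \<Rightarrow> 'a set" where
    "edges_within U I = A ` ((U - I) \<times> {0, 1})" "inj_on A ((U - I) \<times> {0, 1})"
    "\<And>u k. u \<in> U - I \<Longrightarrow> hausdorff1 (A (u, k)) = ennreal (gap_to v w (U - I) u)"
    "\<And>u. u \<in> U - I \<Longrightarrow> 0 < gap_to v w (U - I) u"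
    "\<And>u k. u \<in> U - I \<Longrightarrow> \<exists>q\<in>A (u, k). {u \<in> U. u \<bullet> q = 0} = I"
    "\<And>u k. u \<in> U - I \<Longrightarrow> A (u, k) \<subseteq> normals_perp I"
proof -
  obtain r \<theta> where r: "\<And>u. u \<in> U - I \<Longrightarrow> r u > 0"
    and uv: "\<And>u. u \<in> U - I \<Longrightarrow> u \<bullet> v = - r u * sin (\<theta> u)" "\<And>u. u \<in> U - I \<Longrightarrow> u \<bullet> w = r u * cos (\<theta> u)"
    using polar_normals by blast
  have inner_circle: "u \<bullet> circle_at v w x = r u * sin (x - \<theta> u)" if "u \<in> U - I" for u x
    using uv[OF that] by (simp add: circle_at_def inner_add_right sin_diff algebra_simps)
  define \<delta> where "\<delta> = angle_to v w"
  \<comment> \<open>Two normals that cut out the same line would, together with \<open>I\<close>,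
    give \<open>DIM('a)\<close> independent vectors orthogonal to a nonzero vector.\<close>
  have dist: "sin (\<theta> i - \<theta> j) \<noteq> 0" if ij: "i \<in> U - I" "j \<in> U - I" "i \<noteq> j" for i j
  proof
    assume s0: "sin (\<theta> i - \<theta> j) = 0"
    define z where "z = circle_at v w (\<theta> i)"
    have z: "z \<noteq> 0" using norm_circle_at[OF vw(1), of "\<theta> i"] by (auto simp: z_def)
    have "i \<bullet> z = 0" "j \<bullet> z = 0" using ij s0 by (auto simp: z_def inner_circle)
    then have o: "x \<bullet> y = 0" if "x \<in> insert i (insert j I)" "y \<in> {z}" for x y
      using that circle_at_in_normals_perp[of "\<theta> i"] by (auto simp: normals_perp_def z_def)
    have c: "card (insert i (insert j I)) = DIM('a)" using ij finite_normals I D by simp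
    have "independent (insert i (insert j I))"
      using U I ij c by (auto simp: general_position_def)
    moreover have "independent {z}" using z by simp
    ultimately have "DIM('a) + 1 \<le> DIM('a)" using orthogonal_card_le[OF _ _ o] c by fastforce
    then show False by simp
  qed
  have \<delta>_eq: "\<delta> i j = pi / 2 + arctan (cos (\<theta> i - \<theta> j) / sin (\<theta> i - \<theta> j))"
    if ij: "i \<in> U - I" "j \<in> U - I" for i j
  proof -
    have a: "j \<bullet> ((i \<bullet> v) *\<^sub>R v + (i \<bullet> w) *\<^sub>R w) = r i * r j * cos (\<theta> i - \<theta> j)"
      by (simp add: inner_add_right uv[OF ij(1)] uv[OF ij(2)] cos_diff algebra_simps)
    have b: "j \<bullet> ((i \<bullet> w) *\<^sub>R v - (i \<bullet> v) *\<^sub>R w) = r i * r j * sin (\<theta> i - \<theta> j)"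
      by (simp add: inner_diff_right uv[OF ij(1)] uv[OF ij(2)] sin_diff algebra_simps)
    show ?thesis unfolding \<delta>_def angle_to_def a b using r[OF ij(1)] r[OF ij(2)] by simp
  qed
  interpret circle_lines "U - I" \<theta> \<delta>
  proof
    show "finite (U - I)" using finite_normals by simp
  next
    fix i j assume ij: "i \<in> U - I" "j \<in> U - I" "i \<noteq> j"
    show "sin (\<theta> i - \<theta> j) \<noteq> 0" using dist[OF ij] .
    show "0 < \<delta> i j \<and> \<delta> i j < pi"
      using arctan_lbound[of "cos (\<theta> i - \<theta> j) / sin (\<theta> i - \<theta> j)"] arctan_ubound[of "cos (\<theta> i - \<theta> j) / sin (\<theta> i - \<theta> j)"]
      unfolding \<delta>_eq[OF ij(1,2)] by linarith
    have "\<theta> i + \<delta> i j - \<theta> j = pi / 2 + arctan (cos (\<theta> i - \<theta> j) / sin (\<theta> i - \<theta> j)) + (\<theta> i - \<theta> j)"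
      unfolding \<delta>_eq[OF ij(1,2)] by simp
    then show "sin (\<theta> i + \<delta> i j - \<theta> j) = 0" using arctan_cot[OF dist[OF ij]] by metis
  qed
  have gap: "gap u = gap_to v w (U - I) u" for u unfolding gap_def gap_to_def by (simp add: \<delta>_def)
  define A where "A p = circle_at v w ` arc p" for p
  have A_eq: "A (u, k) = circle_at v w ` {\<theta> u + of_int k * pi..\<theta> u + of_int k * pi + gap u}" for u k
    by (simp add: A_def arc_def circle_at_image_wrapped_interval)
  \<comment> \<open>Scaling by \<open>c\<close> and by the lengths \<open>r u\<close> does not
    affect signs; \<open>c\<close> allows for a \<open>q\<close> off the sphere.\<close>
  have region: "sphere 0 1 \<inter> normals_perp I \<inter> sign_cone (U - I) (c *\<^sub>R circle_at v w \<phi>) = circle_at v w ` region \<phi>"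
    if c: "c > 0" for c \<phi>
  proof -
    have "circle_at v w x \<in> sign_cone (U - I) (c *\<^sub>R circle_at v w \<phi>) \<longleftrightarrow> x \<in> region \<phi>" for x
    proof -
      have "0 \<le> (u \<bullet> (c *\<^sub>R circle_at v w \<phi>)) * (u \<bullet> circle_at v w x) \<longleftrightarrow>
        0 \<le> sin (\<phi> - \<theta> u) * sin (x - \<theta> u)" if u: "u \<in> U - I" for u
      proof -
        have eq: "(u \<bullet> (c *\<^sub>R circle_at v w \<phi>)) * (u \<bullet> circle_at v w x) =
          (c * (r u)\<^sup>2) * (sin (\<phi> - \<theta> u) * sin (x - \<theta> u))"
          by (simp add: inner_circle[OF u] power2_eq_square)
        have "c * (r u)\<^sup>2 > 0" using r[OF u] c by simp
        then show ?thesis unfolding eq by (metis mult_nonneg_nonneg less_imp_le zero_le_mult_iff not_less)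
      qed
      then show ?thesis unfolding sign_cone_def region_def mem_Collect_eq by (intro ball_cong refl)
    qed
    then show ?thesis unfolding sphere_Int_normals_perp by auto
  qed
  have "edges_within U I = (\<lambda>R. circle_at v w ` R) ` {region \<phi> |\<phi>. \<forall>j\<in>U - I. sin (\<phi> - \<theta> j) \<noteq> 0}"
  proof (intro equalityI subsetI)
    fix e assume "e \<in> edges_within U I"
    then obtain q where e: "e = sphere 0 1 \<inter> normals_perp I \<inter> sign_cone (U - I) q"
      and q: "q \<in> normals_perp I" "\<And>u. u \<in> U - I \<Longrightarrow> u \<bullet> q \<noteq> 0" by (auto simp: edges_within_def)
    have q0: "q \<noteq> 0" using q(2) ne by fastforce
    have "sgn q \<in> sphere 0 1 \<inter> normals_perp I"
      using q(1) q0 by (auto simp: norm_sgn normals_perp_def sgn_div_norm)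
    then obtain \<phi> where \<phi>: "sgn q = circle_at v w \<phi>" unfolding sphere_Int_normals_perp by auto
    then have q': "q = norm q *\<^sub>R circle_at v w \<phi>" using q0 by (metis norm_eq_zero scaleR_one scaleR_scaleR right_inverse sgn_div_norm)
    have "e = circle_at v w ` region \<phi>" unfolding e using region[of "norm q" \<phi>] q0 q' by simp
    moreover have "sin (\<phi> - \<theta> j) \<noteq> 0" if j: "j \<in> U - I" for j
    proof
      assume "sin (\<phi> - \<theta> j) = 0"
      then have "j \<bullet> (norm q *\<^sub>R circle_at v w \<phi>) = 0" by (simp add: inner_circle[OF j])
      with q(2)[OF j] q' show False by simp
    qed
    ultimately show "e \<in> (\<lambda>R. circle_at v w ` R) ` {region \<phi> |\<phi>. \<forall>j\<in>U - I. sin (\<phi> - \<theta> j) \<noteq> 0}" by blast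
  next
    fix e assume "e \<in> (\<lambda>R. circle_at v w ` R) ` {region \<phi> |\<phi>. \<forall>j\<in>U - I. sin (\<phi> - \<theta> j) \<noteq> 0}"
    then obtain \<phi> where \<phi>: "e = circle_at v w ` region \<phi>" "\<And>j. j \<in> U - I \<Longrightarrow> sin (\<phi> - \<theta> j) \<noteq> 0" by blast
    have "e = sphere 0 1 \<inter> normals_perp I \<inter> sign_cone (U - I) (circle_at v w \<phi>)"
      using region[of 1 \<phi>] \<phi> by simp
    moreover have "u \<bullet> circle_at v w \<phi> \<noteq> 0" if "u \<in> U - I" for u
      using r[OF that] \<phi>(2)[OF that] by (simp add: inner_circle[OF that])
    ultimately show "e \<in> edges_within U I"
      unfolding edges_within_def using circle_at_in_normals_perp by blast
  qed
  then have "edges_within U I = A ` ((U - I) \<times> {0, 1})"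
    unfolding regions_eq_arcs[OF ne] by (simp add: A_def image_image)
  moreover have "inj_on A ((U - I) \<times> {0, 1})"
  proof (rule inj_onI)
    fix p q assume p: "p \<in> (U - I) \<times> {0, 1}" and q: "q \<in> (U - I) \<times> {0, 1}" and eq: "A p = A q"
    have "arc p = arc q"
      using eq inj_circle_at_wrapped[OF vw(1)] unfolding A_def arc_def by (auto split: prod.splits)
    then show "p = q" using inj_on_arc p q by (auto dest: inj_onD)
  qed
  moreover have "hausdorff1 (A (u, k)) = ennreal (gap_to v w (U - I) u)" if "u \<in> U - I" for u k
    unfolding A_eq gap[symmetric] using gap_pos[OF that] gap_le_pi[of u] vw(1)
    by (subst hausdorff1_arc) (auto simp: orthonormal_pair_def)
  moreover have "0 < gap_to v w (U - I) u" if "u \<in> U - I" for u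
    using gap_pos[OF that] by (simp add: gap)
  moreover have "\<exists>q\<in>A (u, k). {u \<in> U. u \<bullet> q = 0} = I" if u: "u \<in> U - I" for u k
  proof -
    let ?s = "\<theta> u + of_int k * pi"
    let ?q = "circle_at v w (?s + gap u / 2)"
    have "?q \<in> A (u, k)" unfolding A_eq using gap_pos[OF u] by (intro imageI) auto
    moreover have "{u \<in> U. u \<bullet> ?q = 0} = I"
    proof (intro equalityI subsetI)
      fix x assume x: "x \<in> {u \<in> U. u \<bullet> ?q = 0}"
      show "x \<in> I"
      proof (rule ccontr)
        assume "x \<notin> I"
        with x have xJ: "x \<in> U - I" by auto
        then have "sin (?s + gap u / 2 - \<theta> x) \<noteq> 0"
          using gap_pos[OF u] by (intro region_eq(2)[OF u refl[of ?s]]) auto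
        then show False using x xJ r[OF xJ] inner_circle[OF xJ] by simp
      qed
    qed (use I circle_at_in_normals_perp in \<open>auto simp: normals_perp_def\<close>)
    ultimately show ?thesis by blast
  qed
  moreover have "A (u, k) \<subseteq> normals_perp I" for u k
    unfolding A_def using circle_at_in_normals_perp by auto
  ultimately show thesis by (rule that)
qed

text \<open>The factor 2 stands for the two antipodal arcs that start on the line of
  \<open>u\<close>.\<close>

lemma sum_edges_within:
  fixes f :: "real \<Rightarrow> ennreal"
  assumes ne: "U - I \<noteq> {}"
  shows "finite (edges_within U I)"
    and "(\<Sum>e\<in>edges_within U I. f (enn2real (hausdorff1 e))) = (\<Sum>u\<in>U - I. 2 * f (gap_to v w (U - I) u))"
    and "e \<in> edges_within U I \<Longrightarrow> e \<subseteq> normals_perp I \<and> (\<exists>q\<in>e. {u \<in> U. u \<bullet> q = 0} = I)"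
proof -
  obtain A :: "'a \<times> int \<Rightarrow> 'a set" where A:
    "edges_within U I = A ` ((U - I) \<times> {0, 1})" "inj_on A ((U - I) \<times> {0, 1})"
    "\<And>u k. u \<in> U - I \<Longrightarrow> hausdorff1 (A (u, k)) = ennreal (gap_to v w (U - I) u)"
    "\<And>u. u \<in> U - I \<Longrightarrow> 0 < gap_to v w (U - I) u"
    "\<And>u k. u \<in> U - I \<Longrightarrow> \<exists>q\<in>A (u, k). {u \<in> U. u \<bullet> q = 0} = I"
    "\<And>u k. u \<in> U - I \<Longrightarrow> A (u, k) \<subseteq> normals_perp I"
    using edges_within_arcs[OF ne] by blast
  show "finite (edges_within U I)" unfolding A(1) using finite_normals by simp
  show "e \<in> edges_within U I \<Longrightarrow> e \<subseteq> normals_perp I \<and> (\<exists>q\<in>e. {u \<in> U. u \<bullet> q = 0} = I)"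
    unfolding A(1) using A(5,6) by blast
  have "(\<Sum>e\<in>edges_within U I. f (enn2real (hausdorff1 e))) =
      (\<Sum>p\<in>(U - I) \<times> {0, 1}. f (enn2real (hausdorff1 (A p))))"
    unfolding A(1) by (subst sum.reindex[OF A(2)]) simp
  also have "\<dots> = (\<Sum>u\<in>U - I. \<Sum>k\<in>{0, 1::int}. f (enn2real (hausdorff1 (A (u, k)))))"
    unfolding sum.cartesian_product by (intro sum.cong) auto
  also have "\<dots> = (\<Sum>u\<in>U - I. 2 * f (gap_to v w (U - I) u))"
    using A(4) by (intro sum.cong refl) (auto simp: A(3) mult_2 less_imp_le)
  finally show "(\<Sum>e\<in>edges_within U I. f (enn2real (hausdorff1 e))) = (\<Sum>u\<in>U - I. 2 * f (gap_to v w (U - I) u))" .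
qed

end

text \<open>The frames may depend on \<open>I\<close> in any way, so a measurable choice can be
  inserted later. With exactly d - 1 normals the one edge is a full circle; with fewer there is no
  \<open>I\<close> and the sum is empty.\<close>

theorem sum_tessellation_edges:
  fixes U :: "'a::euclidean_space set" and f :: "real \<Rightarrow> ennreal"
  assumes D: "DIM('a) \<ge> 2" and U: "general_position U"
    and vw: "\<And>I. I \<subseteq> U \<Longrightarrow> card I = DIM('a) - 2 \<Longrightarrow>
      orthonormal_pair (v I) (w I) \<and> v I \<in> normals_perp I \<and> w I \<in> normals_perp I"
  shows "(\<Sum>e\<in>tessellation_edges U. f (enn2real (hausdorff1 e))) =
    (if card U = DIM('a) - 2 then f (2 * pi)
     else \<Sum>I | I \<subseteq> U \<and> card I = DIM('a) - 2. \<Sum>u\<in>U - I. 2 * f (gap_to (v I) (w I) (U - I) u))"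
proof -
  have fin: "finite U" using U by (simp add: general_position_def)
  let ?\<I> = "{I. I \<subseteq> U \<and> card I = DIM('a) - 2}"
  have edges: "tessellation_edges U = (\<Union>I\<in>?\<I>. edges_within U I)"
    unfolding tessellation_edges_general_position[OF D U] edges_within_def by blast
  show ?thesis
  proof (cases "card U = DIM('a) - 2")
    case True
    have "I = U" if "I \<subseteq> U" "card I = DIM('a) - 2" for I
      using card_subset_eq[OF fin that(1)] that(2) True by simp
    with True have "?\<I> = {U}" by blast
    then have "tessellation_edges U = edges_within U U" by (simp add: edges)
    \<comment> \<open>No hyperplane remains to impose a sign, so \<open>q = 0\<close> is a
      legitimate witness and yields the whole circle.\<close>
    also have "\<dots> = {sphere 0 1 \<inter> normals_perp U}"
      unfolding edges_within_def sign_cone_def by (auto simp: normals_perp_def intro: exI[of _ 0])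
    also have "sphere 0 1 \<inter> normals_perp U = circle_at (v U) (w U) ` {0..0 + 2 * pi}"
      using vw[of U] True by (intro sphere_Int_normals_perp_arc[OF D U]) auto
    finally have "tessellation_edges U = {circle_at (v U) (w U) ` {0..0 + 2 * pi}}" .
    moreover have "hausdorff1 (circle_at (v U) (w U) ` {0..0 + 2 * pi}) = ennreal (2 * pi)"
      using vw[of U] True by (subst hausdorff1_arc) (auto simp: orthonormal_pair_def)
    ultimately show ?thesis using True by simp
  next
    case False
    have ne: "U - I \<noteq> {}" if "I \<in> ?\<I>" for I using that False by auto
    \<comment> \<open>A common edge lies on all hyperplanes of \<open>I'\<close> and has a point
      whose hyperplanes are just those of \<open>I\<close>, so \<open>I'\<close> is contained in
      \<open>I\<close>; the roles are symmetric.\<close>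
    have disj: "edges_within U I \<inter> edges_within U I' = {}" if I: "I \<in> ?\<I>" "I' \<in> ?\<I>" "I \<noteq> I'" for I I'
    proof (rule ccontr)
      assume "edges_within U I \<inter> edges_within U I' \<noteq> {}"
      then obtain e where e: "e \<in> edges_within U I" "e \<in> edges_within U I'" by blast
      have sub: "K' \<subseteq> K" if "K \<in> ?\<I>" "K' \<in> ?\<I>" "e \<in> edges_within U K" "e \<in> edges_within U K'" for K K'
      proof -
        have "\<exists>q\<in>e. {u \<in> U. u \<bullet> q = 0} = K"
          using that ne sum_edges_within(3)[OF D U, of K "v K" "w K" e] vw[of K] by blast
        moreover have "e \<subseteq> normals_perp K'"
          using that ne sum_edges_within(3)[OF D U, of K' "v K'" "w K'" e] vw[of K'] by blast
        ultimately show ?thesis using that by (auto simp: normals_perp_def)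
      qed
      from sub[of I I'] sub[of I' I] I e show False by blast
    qed
    have "(\<Sum>e\<in>tessellation_edges U. f (enn2real (hausdorff1 e))) =
        (\<Sum>I\<in>?\<I>. \<Sum>e\<in>edges_within U I. f (enn2real (hausdorff1 e)))"
      unfolding edges
    proof (rule sum.UNION_disjoint)
      show "finite ?\<I>" using fin by simp
      show "\<forall>I\<in>?\<I>. finite (edges_within U I)"
      proof
        fix I assume I: "I \<in> ?\<I>"
        then show "finite (edges_within U I)"
          using sum_edges_within(1)[OF D U, of I "v I" "w I"] vw[of I] ne[OF I] by simp
      qed
      show "\<forall>I\<in>?\<I>. \<forall>I'\<in>?\<I>. I \<noteq> I' \<longrightarrow> edges_within U I \<inter> edges_within U I' = {}"
        using disj by blast
    qed
    also have "\<dots> = (\<Sum>I\<in>?\<I>. \<Sum>u\<in>U - I. 2 * f (gap_to (v I) (w I) (U - I) u))"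
      using vw ne by (intro sum.cong refl sum_edges_within(2)[OF D U]) auto
    finally show ?thesis using False by simp
  qed
qed

section \<open>Generic configurations\<close>

text \<open>Gram--Schmidt in a form that is measurable in all vectors; a vanishing residual is harmless
  since \<open>x / 0 = 0\<close>.\<close>

fun proj_off :: "'a::euclidean_space list \<Rightarrow> 'a \<Rightarrow> 'a" where
  "proj_off [] v = v"
| "proj_off (x # xs) v =
     proj_off xs v - ((proj_off xs v \<bullet> proj_off xs x) / (proj_off xs x \<bullet> proj_off xs x)) *\<^sub>R proj_off xs x"

lemma proj_off_diff_in_span: "v - proj_off xs v \<in> span (set xs)"
proof (induction xs arbitrary: v)
  case (Cons x xs)
  let ?S = "span (set (x # xs))"
  let ?c = "(proj_off xs v \<bullet> proj_off xs x) / (proj_off xs x \<bullet> proj_off xs x)"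
  have sub: "span (set xs) \<subseteq> ?S" by (intro span_mono) auto
  have "x \<in> ?S" "x - proj_off xs x \<in> ?S"
    using Cons.IH[of x] sub by (auto intro: span_base)
  then have "x - (x - proj_off xs x) \<in> ?S" by (rule span_diff)
  then have "?c *\<^sub>R proj_off xs x \<in> ?S" by (intro span_scale) simp
  moreover have "v - proj_off xs v \<in> ?S" using Cons.IH[of v] sub by blast
  ultimately have "(v - proj_off xs v) + ?c *\<^sub>R proj_off xs x \<in> ?S" by (rule span_add[rotated])
  then show ?case by (simp add: algebra_simps)
qed (simp add: span_zero)

lemma inner_span_eq_0:
  assumes "\<And>x. x \<in> X \<Longrightarrow> x \<bullet> y = 0" "z \<in> span X"
  shows "z \<bullet> y = 0"
  using orthogonal_to_span[OF assms(2), of y] assms(1) by (simp add: orthogonal_def inner_commute)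

lemma inner_proj_off: "x \<in> set xs \<Longrightarrow> x \<bullet> proj_off xs v = 0"
proof (induction xs arbitrary: v x)
  case (Cons z xs)
  let ?q = "proj_off xs z" and ?y = "proj_off xs v"
  show ?case
  proof (cases "x \<in> set xs")
    case True
    then show ?thesis using Cons.IH by (simp add: inner_diff_right)
  next
    case False
    then have xz: "x = z" using Cons.prems by simp
    have "(z - ?q) \<bullet> proj_off xs u = 0" for u
      by (rule inner_span_eq_0[OF Cons.IH proj_off_diff_in_span])
    then have "z \<bullet> ?y = ?q \<bullet> ?y" "z \<bullet> ?q = ?q \<bullet> ?q" by (simp_all add: inner_diff_left)
    then show ?thesis by (cases "?q = 0") (simp_all add: xz inner_diff_right inner_commute)
  qed
qed simp

text \<open>This turns membership in the span of random vectors into the vanishing of a measurable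
  function, so that degenerate configurations form measurable sets.\<close>

lemma proj_off_eq_0_iff: "proj_off xs v = 0 \<longleftrightarrow> v \<in> span (set xs)"
proof
  assume "proj_off xs v = 0"
  then show "v \<in> span (set xs)" using proj_off_diff_in_span[of v xs] by simp
next
  assume v: "v \<in> span (set xs)"
  then have "v - (v - proj_off xs v) \<in> span (set xs)" using proj_off_diff_in_span by (rule span_diff)
  then have "proj_off xs v \<in> span (set xs)" by simp
  then have "proj_off xs v \<bullet> proj_off xs v = 0"
    using inner_proj_off by (rule inner_span_eq_0[rotated])
  then show "proj_off xs v = 0" by simp
qed

lemma proj_off_measurable:
  fixes f :: "'i \<Rightarrow> 'b \<Rightarrow> 'a::euclidean_space" and g :: "'b \<Rightarrow> 'a" and N :: "'b measure"
  assumes "\<And>i. i \<in> set js \<Longrightarrow> f i \<in> borel_measurable N" "g \<in> borel_measurable N"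
  shows "(\<lambda>x. proj_off (map (\<lambda>i. f i x) js) (g x)) \<in> borel_measurable N"
  using assms
proof (induction js arbitrary: g)
  case (Cons j js)
  have [measurable]: "(\<lambda>x. proj_off (map (\<lambda>i. f i x) js) (g x)) \<in> borel_measurable N"
    "(\<lambda>x. proj_off (map (\<lambda>i. f i x) js) (f j x)) \<in> borel_measurable N"
    using Cons by auto
  show ?case by simp
qed simp

text \<open>The fixed vectors \<open>bs\<close> serve two uses: with none the points are in general
  position, with two basis vectors the frames below do not vanish. The condition singles out one
  point \<open>x j\<close> given others, the form in which Fubini proves it almost surely.\<close>

definition generic :: "'a::euclidean_space list \<Rightarrow> 'i set \<Rightarrow> ('i \<Rightarrow> 'a) \<Rightarrow> bool" where
  "generic bs K x \<longleftrightarrow>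
     (\<forall>J\<in>Pow K. \<forall>j\<in>K - J. length bs + card J < DIM('a) \<longrightarrow> x j \<notin> span (set bs \<union> x ` J))"

lemma generic_independent:
  fixes bs :: "'a::euclidean_space list"
  assumes g: "generic bs K x" and bs: "independent (set bs)" "distinct bs"
    and J: "finite J" "J \<subseteq> K" "length bs + card J \<le> DIM('a)"
  shows "inj_on x J \<and> set bs \<inter> x ` J = {} \<and> independent (set bs \<union> x ` J)"
  using J
proof (induction J rule: finite_induct)
  case (insert j J)
  then have IH: "inj_on x J" "set bs \<inter> x ` J = {}" "independent (set bs \<union> x ` J)" by auto
  have xj: "x j \<notin> span (set bs \<union> x ` J)"
    using g insert by (auto simp: generic_def)
  then have "x j \<notin> set bs \<union> x ` J" using span_base[of "x j" "set bs \<union> x ` J"] by metis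
  moreover have "independent (insert (x j) (set bs \<union> x ` J))"
    using xj IH(3) by (rule independent_insertI)
  ultimately show ?case using IH insert.hyps by auto
qed (use bs in auto)

lemma generic_general_position:
  fixes x :: "'i \<Rightarrow> 'a::euclidean_space"
  assumes D: "DIM('a) \<ge> 2" and g: "generic [] K x" and K: "finite K"
  shows "general_position (x ` K)" "inj_on x K"
proof -
  have ind: "inj_on x J \<and> independent (x ` J)" if "J \<subseteq> K" "card J \<le> DIM('a)" for J
    using generic_independent[OF g, of J] that finite_subset[OF that(1) K] independent_empty by simp
  show inj: "inj_on x K"
  proof (rule inj_onI)
    fix i j assume ij: "i \<in> K" "j \<in> K" "x i = x j"
    have "card {i, j} \<le> DIM('a)" using D card_insert_le_m1[of 2 "{j}" i] by simp
    then have "inj_on x {i, j}" using ind[of "{i, j}"] ij by simp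
    then show "i = j" by (rule inj_onD) (use ij in simp_all)
  qed
  show "general_position (x ` K)"
    unfolding general_position_def
  proof (intro conjI allI impI)
    show "finite (x ` K)" using K by simp
    fix I assume I: "I \<subseteq> x ` K" "card I \<le> DIM('a)"
    then obtain J where J: "J \<subseteq> K" "I = x ` J" by (auto simp: subset_image_iff)
    then have "card J = card I" using card_image[OF inj_on_subset[OF inj J(1)]] by simp
    then show "independent I" using ind[of J] J I by simp
  qed
qed

text \<open>For generic points, two fixed basis vectors \<open>b, c\<close> give a measurable choice of an orthonormal basis
  of the plane orthogonal to \<open>x ` I\<close>, and so a common orientation for all arcs of that circle.\<close>

definition frame_v :: "'a::euclidean_space \<Rightarrow> nat set \<Rightarrow> (nat \<Rightarrow> 'a) \<Rightarrow> 'a" where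
  "frame_v b I x = sgn (proj_off (map x (sorted_list_of_set I)) b)"

definition frame_w :: "'a::euclidean_space \<Rightarrow> 'a \<Rightarrow> nat set \<Rightarrow> (nat \<Rightarrow> 'a) \<Rightarrow> 'a" where
  "frame_w b c I x = sgn (proj_off (b # map x (sorted_list_of_set I)) c)"

text \<open>Together with \<open>b\<close> and \<open>c\<close> the points indexed by
  \<open>I\<close> are \<open>DIM('a)\<close> independent vectors, so neither residual vanishes. The
  second is orthogonal to \<open>b\<close> and to these points, hence to the first, which lies in
  their span.\<close>

lemma frame_orthonormal:
  fixes b c :: "'a::euclidean_space"
  assumes D: "DIM('a) \<ge> 2" and bc: "b \<in> Basis" "c \<in> Basis" "b \<noteq> c" and g: "generic [b, c] K x"
    and I: "finite I" "I \<subseteq> K" "card I = DIM('a) - 2"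
  shows "orthonormal_pair (frame_v b I x) (frame_w b c I x)"
    "frame_v b I x \<in> normals_perp (x ` I)" "frame_w b c I x \<in> normals_perp (x ` I)"
proof -
  have "independent (set [b, c])"
    by (rule independent_mono[OF independent_Basis]) (use bc in auto)
  then have ind: "set [b, c] \<inter> x ` I = {}" "independent (set [b, c] \<union> x ` I)"
    using generic_independent[OF g, of I] I D bc by auto
  let ?xs = "map x (sorted_list_of_set I)"
  have set: "set ?xs = x ` I" using I by simp
  have b: "proj_off ?xs b \<noteq> 0"
  proof -
    have "independent (insert b (x ` I))" using ind(2) by (rule independent_mono) auto
    then have "b \<notin> span (x ` I)" using ind(1) by (auto simp: independent_insert)
    then show ?thesis unfolding proj_off_eq_0_iff set .
  qed
  have c: "proj_off (b # ?xs) c \<noteq> 0"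
  proof -
    have "insert c (insert b (x ` I)) = set [b, c] \<union> x ` I" by auto
    then have "independent (insert c (insert b (x ` I)))" using ind(2) by simp
    then have "c \<notin> span (insert b (x ` I))" using ind(1) bc(3) by (auto simp: independent_insert split: if_splits)
    then show ?thesis unfolding proj_off_eq_0_iff using set by simp
  qed
  have cperp: "z \<bullet> proj_off (b # ?xs) c = 0" if "z \<in> set (b # ?xs)" for z
    using that by (rule inner_proj_off)
  have bperp: "z \<bullet> proj_off ?xs b = 0" if "z \<in> set ?xs" for z
    using that by (rule inner_proj_off)
  have "proj_off ?xs b \<in> span (set (b # ?xs))"
  proof -
    have "b \<in> span (set (b # ?xs))" "b - proj_off ?xs b \<in> span (set (b # ?xs))"
      using proj_off_diff_in_span[of b ?xs] span_mono[of "set ?xs" "set (b # ?xs)"]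
      by (auto intro: span_base)
    then have "b - (b - proj_off ?xs b) \<in> span (set (b # ?xs))" by (rule span_diff)
    then show ?thesis by simp
  qed
  then have "proj_off ?xs b \<bullet> proj_off (b # ?xs) c = 0"
    using cperp by (rule inner_span_eq_0[rotated])
  with b c show "orthonormal_pair (frame_v b I x) (frame_w b c I x)"
    unfolding orthonormal_pair_def frame_v_def frame_w_def by (simp add: norm_sgn) (simp add: sgn_div_norm)
  show "frame_v b I x \<in> normals_perp (x ` I)"
    using bperp unfolding normals_perp_def frame_v_def set[symmetric] by (simp add: sgn_div_norm)
  show "frame_w b c I x \<in> normals_perp (x ` I)"
    using cperp unfolding normals_perp_def frame_w_def set[symmetric] by (simp add: sgn_div_norm)
qed

lemma exists_two_Basis:
  assumes "DIM('a::euclidean_space) \<ge> 2"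
  obtains b c :: "'a::euclidean_space" where "b \<in> Basis" "c \<in> Basis" "b \<noteq> c"
proof -
  obtain T where "T \<subseteq> (Basis :: 'a set)" "card T = 2"
    using assms by (rule obtain_subset_with_card_n)
  then show thesis using that by (auto simp: card_2_iff)
qed

definition index_gap :: "'a::euclidean_space \<Rightarrow> 'a \<Rightarrow> nat set \<Rightarrow> nat set \<Rightarrow> nat \<Rightarrow> (nat \<Rightarrow> 'a) \<Rightarrow> real" where
  "index_gap b c K I i x =
     Min (insert pi ((\<lambda>j. angle_to (frame_v b I x) (frame_w b c I x) (x i) (x j)) ` (K - I - {i})))"

text \<open>The edge functional for labelled points: it sums over sets of indices instead of sets of
  points, which makes it measurable on the product space.\<close>

definition edge_sum :: "'a::euclidean_space \<Rightarrow> 'a \<Rightarrow> (real \<Rightarrow> ennreal) \<Rightarrow> nat \<Rightarrow> (nat \<Rightarrow> 'a) \<Rightarrow> ennreal" where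
  "edge_sum b c f n x = (if n = DIM('a) - 2 then f (2 * pi)
     else \<Sum>I | I \<subseteq> {..<n} \<and> card I = DIM('a) - 2. \<Sum>i\<in>{..<n} - I. 2 * f (index_gap b c {..<n} I i x))"

lemma sum_tessellation_edges_indexed:
  fixes x :: "nat \<Rightarrow> 'a::euclidean_space"
  assumes D: "DIM('a) \<ge> 2" and bc: "b \<in> Basis" "c \<in> Basis" "b \<noteq> c"
    and g: "generic [] {..<n} x" "generic [b, c] {..<n} x"
  shows "(\<Sum>e\<in>tessellation_edges (x ` {..<n}). f (enn2real (hausdorff1 e))) = edge_sum b c f n x"
proof -
  let ?K = "{..<n}"
  have gp: "general_position (x ` ?K)" and inj: "inj_on x ?K"
    using generic_general_position[OF D g(1)] by auto
  \<comment> \<open>Frames belong to sets of indices but the edge sum runs over sets of points;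
    injectivity lets the indices be recovered.\<close>
  define idx where "idx I' = {i \<in> ?K. x i \<in> I'}" for I'
  have idx: "idx (x ` I) = I" if "I \<subseteq> ?K" for I
    using that inj unfolding idx_def by (auto simp: inj_on_def)
  let ?v = "\<lambda>I'. frame_v b (idx I') x" and ?w = "\<lambda>I'. frame_w b c (idx I') x"
  have ximg: "\<exists>I\<subseteq>?K. I' = x ` I \<and> card I = card I'" if "I' \<subseteq> x ` ?K" for I'
    using that inj by (metis card_image inj_on_subset subset_imageE)
  have vw: "orthonormal_pair (?v I') (?w I') \<and> ?v I' \<in> normals_perp I' \<and> ?w I' \<in> normals_perp I'"
    if I': "I' \<subseteq> x ` ?K" "card I' = DIM('a) - 2" for I'
  proof -
    obtain I where I: "I \<subseteq> ?K" "I' = x ` I" "card I = card I'" using ximg[OF I'(1)] by blast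
    have fI: "finite I" using I(1) finite_subset by blast
    show ?thesis
      using frame_orthonormal[OF D bc g(2) fI I(1)] I idx[OF I(1)] I' by simp
  qed
  have card: "card (x ` ?K) = n" using inj by (simp add: card_image)
  have gap: "gap_to (frame_v b I x) (frame_w b c I x) (x ` ?K - x ` I) (x i) = index_gap b c ?K I i x"
    if I: "I \<subseteq> ?K" "i \<in> ?K - I" for I i
  proof -
    have "x ` ?K - x ` I - {x i} = x ` (?K - I - {i})"
      using I inj by (auto simp: inj_on_def)
    then show ?thesis by (simp add: gap_to_def index_gap_def image_image)
  qed
  have "(\<Sum>I' | I' \<subseteq> x ` ?K \<and> card I' = DIM('a) - 2. \<Sum>u\<in>x ` ?K - I'. 2 * f (gap_to (?v I') (?w I') (x ` ?K - I') u)) =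
     (\<Sum>I | I \<subseteq> ?K \<and> card I = DIM('a) - 2. \<Sum>u\<in>x ` ?K - x ` I. 2 * f (gap_to (?v (x ` I)) (?w (x ` I)) (x ` ?K - x ` I) u))"
  proof (rule sum.reindex_cong[of "\<lambda>I. x ` I"])
    show "inj_on ((`) x) {I. I \<subseteq> ?K \<and> card I = DIM('a) - 2}"
      by (rule inj_on_inverseI[of _ idx]) (use idx in blast)
    show "{I'. I' \<subseteq> x ` ?K \<and> card I' = DIM('a) - 2} = (`) x ` {I. I \<subseteq> ?K \<and> card I = DIM('a) - 2}"
    proof (intro equalityI subsetI)
      fix I' assume "I' \<in> {I'. I' \<subseteq> x ` ?K \<and> card I' = DIM('a) - 2}"
      then show "I' \<in> (`) x ` {I. I \<subseteq> ?K \<and> card I = DIM('a) - 2}" using ximg[of I'] by auto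
    next
      fix I' assume "I' \<in> (`) x ` {I. I \<subseteq> ?K \<and> card I = DIM('a) - 2}"
      then show "I' \<in> {I'. I' \<subseteq> x ` ?K \<and> card I' = DIM('a) - 2}"
        using inj by (auto simp: card_image inj_on_subset)
    qed
  qed simp
  also have "\<dots> = (\<Sum>I | I \<subseteq> ?K \<and> card I = DIM('a) - 2. \<Sum>i\<in>?K - I. 2 * f (index_gap b c ?K I i x))"
  proof (rule sum.cong[OF refl])
    fix I assume "I \<in> {I. I \<subseteq> ?K \<and> card I = DIM('a) - 2}"
    then have I: "I \<subseteq> ?K" by simp
    have "x ` ?K - x ` I = x ` (?K - I)" using I inj by (auto simp: inj_on_def)
    moreover have "inj_on x (?K - I)" using inj by (rule inj_on_subset) auto
    ultimately have "(\<Sum>u\<in>x ` ?K - x ` I. 2 * f (gap_to (?v (x ` I)) (?w (x ` I)) (x ` ?K - x ` I) u)) =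
      (\<Sum>i\<in>?K - I. 2 * f (gap_to (?v (x ` I)) (?w (x ` I)) (x ` ?K - x ` I) (x i)))"
      by (simp add: sum.reindex)
    also have "\<dots> = (\<Sum>i\<in>?K - I. 2 * f (index_gap b c ?K I i x))"
      using gap[OF I] by (simp add: idx[OF I])
    finally show "(\<Sum>u\<in>x ` ?K - x ` I. 2 * f (gap_to (?v (x ` I)) (?w (x ` I)) (x ` ?K - x ` I) u)) =
      (\<Sum>i\<in>?K - I. 2 * f (index_gap b c ?K I i x))" .
  qed
  finally show ?thesis
    using sum_tessellation_edges[OF D gp, of ?v ?w f] vw unfolding edge_sum_def card by simp
qed

section \<open>Law of the gaps\<close>

lemma proj_off_append_measurable:
  fixes f :: "'i \<Rightarrow> 'b \<Rightarrow> 'a::euclidean_space" and g :: "'b \<Rightarrow> 'a" and N :: "'b measure"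
  assumes "\<And>i. i \<in> set js \<Longrightarrow> f i \<in> borel_measurable N" "g \<in> borel_measurable N"
  shows "(\<lambda>x. proj_off (bs @ map (\<lambda>i. f i x) js) (g x)) \<in> borel_measurable N"
proof -
  \<comment> \<open>The fixed vectors are treated as further, constant, coordinates.\<close>
  define F where "F k x = (case k of Inl b \<Rightarrow> b | Inr i \<Rightarrow> f i x)" for k x
  have "bs @ map (\<lambda>i. f i x) js = map (\<lambda>k. F k x) (map Inl bs @ map Inr js)" for x
    by (simp add: F_def o_def)
  moreover have "(\<lambda>x. proj_off (map (\<lambda>k. F k x) (map Inl bs @ map Inr js)) (g x)) \<in> borel_measurable N"
    using assms by (intro proj_off_measurable) (auto simp: F_def)
  ultimately show ?thesis by (simp only:)
qed

lemma angle_to_measurable: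
  assumes [measurable]: "F \<in> borel_measurable N" "G \<in> borel_measurable N" "u \<in> borel_measurable N" "y \<in> borel_measurable N"
  shows "(\<lambda>x. angle_to (F x) (G x) (u x) (y x)) \<in> borel_measurable N"
  unfolding angle_to_def by measurable

lemma sgn_measurable: "(sgn :: 'a::euclidean_space \<Rightarrow> 'a) \<in> borel_measurable borel"
  unfolding sgn_div_norm[abs_def] by measurable

lemma frames_measurable:
  fixes N :: "(nat \<Rightarrow> 'a::euclidean_space) measure"
  assumes "finite I" "\<And>i. i \<in> I \<Longrightarrow> (\<lambda>x. x i) \<in> borel_measurable N"
  shows "frame_v b I \<in> borel_measurable N" "frame_w b c I \<in> borel_measurable N"
proof -
  have "(\<lambda>x. proj_off ([] @ map (\<lambda>i. x i) (sorted_list_of_set I)) b) \<in> borel_measurable N"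
    using assms by (intro proj_off_append_measurable) auto
  then show "frame_v b I \<in> borel_measurable N"
    unfolding frame_v_def[abs_def] by (intro measurable_compose[OF _ sgn_measurable]) simp
  have "(\<lambda>x. proj_off ([b] @ map (\<lambda>i. x i) (sorted_list_of_set I)) c) \<in> borel_measurable N"
    using assms by (intro proj_off_append_measurable) auto
  then show "frame_w b c I \<in> borel_measurable N"
    unfolding frame_w_def[abs_def] by (intro measurable_compose[OF _ sgn_measurable]) simp
qed

lemma less_index_gap_iff:
  assumes "finite K"
  shows "s < index_gap b c K I i x \<longleftrightarrow>
    s < pi \<and> (\<forall>j\<in>K - I - {i}. s < angle_to (frame_v b I x) (frame_w b c I x) (x i) (x j))"
  unfolding index_gap_def using assms by (subst Min_gr_iff) auto

lemma index_gap_measurable: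
  fixes N :: "(nat \<Rightarrow> 'a::euclidean_space) measure"
  assumes K: "finite K" "I \<subseteq> K" "i \<in> K" and comp: "\<And>i. i \<in> K \<Longrightarrow> (\<lambda>x. x i) \<in> borel_measurable N"
  shows "index_gap b c K I i \<in> borel_measurable N"
  unfolding borel_measurable_iff_greater
proof
  fix a
  have I: "finite I" using K finite_subset by blast
  have [measurable]: "frame_v b I \<in> borel_measurable N" "frame_w b c I \<in> borel_measurable N"
    using K comp I by (auto intro!: frames_measurable)
  have [measurable]: "(\<lambda>x. angle_to (frame_v b I x) (frame_w b c I x) (x i) (x j)) \<in> borel_measurable N" if "j \<in> K" for j
    using that K comp by (intro angle_to_measurable) auto
  have "{x \<in> space N. \<forall>j\<in>K - I - {i}. a < angle_to (frame_v b I x) (frame_w b c I x) (x i) (x j)} \<in> sets N"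
  proof (rule sets.sets_Collect_finite_All)
    fix j assume "j \<in> K - I - {i}"
    then have "j \<in> K" by simp
    then show "{x \<in> space N. a < angle_to (frame_v b I x) (frame_w b c I x) (x i) (x j)} \<in> sets N"
      by measurable
  qed (use K in simp)
  then show "{x \<in> space N. a < index_gap b c K I i x} \<in> sets N"
    unfolding less_index_gap_iff[OF K(1)] by (cases "a < pi") auto
qed

lemma angle_to_bounds: "0 < angle_to v w u y" "angle_to v w u y < pi"
  unfolding angle_to_def using arctan_lbound arctan_ubound by (smt (verit) field_sum_of_halves)+

lemma index_gap_pos: "finite K \<Longrightarrow> 0 < index_gap b c K I i x"
  by (simp add: less_index_gap_iff angle_to_bounds)

text \<open>\<open>rank\<close> is d - 1, the number of hyperplanes that cut out a great circle. The
  measure is not normalised: a product over \<open>n\<close> points has mass \<open>t ^ n\<close>,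
  the numerator of the Poisson weight.\<close>

locale scaled_sphere =
  fixes t :: real and L :: "'a::euclidean_space measure" and rank :: nat
  assumes t: "t > 0" and L: "L = scale_measure (ennreal t) sphere_measure" and DIM_rank: "DIM('a) = rank + 2"
begin

lemma D: "DIM('a) \<ge> 2" by (simp add: DIM_rank)

lemma space_L: "space L = sphere 0 1" by (simp add: L space_scale_measure)

lemma emeasure_L: "emeasure L A = ennreal t * emeasure sphere_measure A" by (simp add: L)

lemma emeasure_L_space: "emeasure L (space L) = ennreal t"
  using prob_space.emeasure_space_1[OF prob_space_sphere_measure[where 'a='a]] by (simp add: space_L emeasure_L)

lemma finite_L: "finite_measure L"
  by (rule finite_measureI) (simp add: emeasure_L_space)

lemma id_measurable_L: "(\<lambda>x. x) \<in> borel_measurable L"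
  using measurable_sphere_measure by (simp add: L measurable_def space_scale_measure)

lemma component_measurable: "i \<in> K \<Longrightarrow> (\<lambda>x. x i) \<in> borel_measurable (\<Pi>\<^sub>M i\<in>K. L)"
  using measurable_compose[OF measurable_component_singleton[of i K "\<lambda>_. L"] id_measurable_L] by simp

sublocale finite_measure L by (rule finite_L)

sublocale P: product_sigma_finite "\<lambda>_::nat. L" ..

lemma emeasure_PiM_space: "finite (K :: nat set) \<Longrightarrow> emeasure (\<Pi>\<^sub>M i\<in>K. L) (space (\<Pi>\<^sub>M i\<in>K. L)) = ennreal (t ^ card K)"
  using t unfolding space_PiM by (subst P.emeasure_PiM) (auto simp: emeasure_L_space ennreal_power)

text \<open>With all other coordinates fixed, \<open>x j\<close> would have to lie in a span of too
  few vectors, a proper subspace, which meets the sphere in a null set.\<close>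

lemma AE_generic:
  fixes K :: "nat set"
  assumes K: "finite K"
  shows "AE x in (\<Pi>\<^sub>M i\<in>K. L). generic bs K x"
proof -
  have "AE x in (\<Pi>\<^sub>M i\<in>K. L). x j \<notin> span (set bs \<union> x ` J)"
    if J: "J \<subseteq> K" and j: "j \<in> K - J" and len: "length bs + card J < DIM('a)" for J j
  proof -
    have fJ: "finite J" using J K finite_subset by blast
    let ?js = "sorted_list_of_set J"
    let ?N = "{x \<in> space (\<Pi>\<^sub>M i\<in>K. L). proj_off (bs @ map (\<lambda>i. x i) ?js) (x j) = 0}"
    have N_iff: "proj_off (bs @ map (\<lambda>i. x i) ?js) (x j) = 0 \<longleftrightarrow> x j \<in> span (set bs \<union> x ` J)" for x
      unfolding proj_off_eq_0_iff using fJ by simp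
    have "(\<lambda>x. proj_off (bs @ map (\<lambda>i. x i) ?js) (x j)) \<in> borel_measurable (\<Pi>\<^sub>M i\<in>K. L)"
      using J j fJ by (intro proj_off_append_measurable component_measurable) auto
    then have N: "?N \<in> sets (\<Pi>\<^sub>M i\<in>K. L)" by measurable
    have ins: "insert j (K - {j}) = K" using j by auto
    have N': "indicator ?N \<in> borel_measurable (\<Pi>\<^sub>M i\<in>insert j (K - {j}). L)"
      unfolding ins using N by simp
    have "emeasure (\<Pi>\<^sub>M i\<in>K. L) ?N = (\<integral>\<^sup>+x. indicator ?N x \<partial>(\<Pi>\<^sub>M i\<in>insert j (K - {j}). L))"
      unfolding ins using N by simp
    also have "\<dots> = (\<integral>\<^sup>+x. (\<integral>\<^sup>+y. indicator ?N (x(j := y)) \<partial>L) \<partial>(\<Pi>\<^sub>M i\<in>K - {j}. L))"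
      using K N' by (subst P.product_nn_integral_insert) auto
    also have "\<dots> = (\<integral>\<^sup>+x. 0 \<partial>(\<Pi>\<^sub>M i\<in>K - {j}. L))"
    proof (rule nn_integral_cong)
      fix x :: "nat \<Rightarrow> 'a"
      let ?H = "span (set bs \<union> x ` J)"
      have "card (set bs \<union> x ` J) \<le> card (set bs) + card (x ` J)" by (rule card_Un_le)
      also have "\<dots> \<le> length bs + card J" by (intro add_mono card_length card_image_le fJ)
      finally have "dim ?H < DIM('a)"
        using len fJ dim_le_card'[of "set bs \<union> x ` J"] by simp
      then have "emeasure sphere_measure (sphere 0 1 \<inter> ?H) = 0"
        by (intro emeasure_sphere_measure_subspace) auto
      then have 0: "emeasure L (sphere 0 1 \<inter> ?H) = 0" by (simp add: emeasure_L)
      have Hb: "?H \<in> sets borel" by (intro borel_closed closed_subspace) simp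
      have H: "sphere 0 1 \<inter> ?H \<in> sets L"
        using measurable_sets[OF id_measurable_L Hb] by (simp add: space_L Int_commute vimage_def Int_def conj_commute)
      \<comment> \<open>As \<open>j\<close> is not in \<open>J\<close>, changing coordinate
        \<open>j\<close> does not move the span.\<close>
      have img: "(x(j := y)) ` J = x ` J" for y using j by auto
      have "(\<integral>\<^sup>+y. indicator ?N (x(j := y)) \<partial>L) \<le> (\<integral>\<^sup>+y. indicator (sphere 0 1 \<inter> ?H) y \<partial>L)"
      proof (rule nn_integral_mono)
        fix y assume y: "y \<in> space L"
        have "y \<in> ?H" if "x(j := y) \<in> ?N"
        proof -
          have "(x(j := y)) j \<in> span (set bs \<union> (x(j := y)) ` J)" using that N_iff[of "x(j := y)"] by blast
          then show ?thesis unfolding img by simp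
        qed
        then show "indicator ?N (x(j := y)) \<le> (indicator (sphere 0 1 \<inter> ?H) y :: ennreal)"
          using y unfolding space_L by (auto simp: indicator_def)
      qed
      also have "\<dots> = 0" using H 0 by simp
      finally show "(\<integral>\<^sup>+y. indicator ?N (x(j := y)) \<partial>L) = 0" by simp
    qed
    finally have "?N \<in> null_sets (\<Pi>\<^sub>M i\<in>K. L)" using N by auto
    then show ?thesis by (rule AE_I') (auto simp: N_iff)
  qed
  then show ?thesis
    unfolding generic_def using K by (intro AE_finite_allI) auto
qed

text \<open>The vectors \<open>q\<close> and \<open>p\<close> are the projection of \<open>u\<close>
  to the plane and its quarter turn, hence orthogonal and of equal norm; the uniform angle applies
  to them.\<close>

lemma emeasure_angle_to:
  assumes vw: "orthonormal_pair v w" and u: "u \<bullet> v \<noteq> 0 \<or> u \<bullet> w \<noteq> 0" and s: "0 \<le> s" "s < pi"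
  shows "(\<integral>\<^sup>+z. indicator {z. s < angle_to v w u z} z \<partial>L) = ennreal (t * (1 - s / pi))"
proof -
  have o: "v \<bullet> v = 1" "w \<bullet> w = 1" "v \<bullet> w = 0" "w \<bullet> v = 0"
    using vw by (auto simp: orthonormal_pair_def dot_square_norm inner_commute)
  define p where "p = (u \<bullet> w) *\<^sub>R v - (u \<bullet> v) *\<^sub>R w"
  define q where "q = (u \<bullet> v) *\<^sub>R v + (u \<bullet> w) *\<^sub>R w"
  have pp: "p \<bullet> p = (u \<bullet> v)\<^sup>2 + (u \<bullet> w)\<^sup>2" and qq: "q \<bullet> q = (u \<bullet> v)\<^sup>2 + (u \<bullet> w)\<^sup>2" and pq: "p \<bullet> q = 0"
    by (simp_all add: p_def q_def inner_add_left inner_add_right inner_diff_left inner_diff_right o power2_eq_square)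
  have "norm p = norm q" by (simp add: norm_eq_sqrt_inner pp qq)
  moreover have "p \<noteq> 0" using pp u by (auto simp: sum_power2_eq_zero_iff)
  ultimately have "emeasure sphere_measure {z \<in> sphere 0 1. pi / 2 + arctan ((z \<bullet> q) / (z \<bullet> p)) > s} = ennreal (1 - s / pi)"
    using pq s by (intro emeasure_sphere_measure_angle)
  then have 1: "emeasure L {z \<in> sphere 0 1. s < angle_to v w u z} = ennreal (t * (1 - s / pi))"
    using t s by (simp add: emeasure_L angle_to_def p_def q_def ennreal_mult)
  have m: "(\<lambda>z. angle_to v w u z) \<in> borel_measurable L"
    by (intro angle_to_measurable id_measurable_L) auto
  then have "{z \<in> space L. s < angle_to v w u z} \<in> sets L" by measurable
  then have S: "{z \<in> sphere 0 1. s < angle_to v w u z} \<in> sets L" by (simp add: space_L)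
  have "(\<integral>\<^sup>+z. indicator {z. s < angle_to v w u z} z \<partial>L) = (\<integral>\<^sup>+z. indicator {z \<in> sphere 0 1. s < angle_to v w u z} z \<partial>L)"
    by (intro nn_integral_cong) (auto simp: space_L indicator_def)
  then show ?thesis using S 1 by simp
qed

text \<open>Those coordinates in \<open>K1 = insert i I\<close> determine the circle, its frame and
  the line where the arc starts. Given them, the points in \<open>K2\<close> are independent, and
  the arc is longer than \<open>s\<close> iff each of them has its next crossing beyond
  \<open>s\<close>. As \<open>K1\<close> has d elements, the exponent is n - d.\<close>

lemma nn_integral_gap_tail:
  assumes bc: "b \<in> Basis" "c \<in> Basis" "b \<noteq> c"
    and I: "I \<subseteq> {..<n}" "card I = DIM('a) - 2" and i: "i \<in> {..<n} - I" and s: "0 \<le> s"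
  shows "(\<integral>\<^sup>+x. indicator {s<..} (index_gap b c {..<n} I i x) \<partial>(\<Pi>\<^sub>M i\<in>{..<n}. L)) =
    (if s < pi then ennreal (t ^ n * (1 - s / pi) ^ (n - (DIM('a) - 1))) else 0)"
proof (cases "s < pi")
  case False
  then have "indicator {s<..} (index_gap b c {..<n} I i x) = (0::ennreal)" for x
    by (simp add: less_index_gap_iff indicator_def)
  with False show ?thesis by simp
next
  case True
  define K1 where "K1 = insert i I"
  define K2 where "K2 = {..<n} - K1"
  have K: "K1 \<inter> K2 = {}" "K1 \<union> K2 = {..<n}" "finite K1" "finite K2"
    using I i finite_subset[OF I(1)] by (auto simp: K1_def K2_def)
  have fI: "finite I" using K by (simp add: K1_def)
  have c1: "card K1 = DIM('a) - 1" using i I D fI by (simp add: K1_def)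
  have cn: "card K1 + card K2 = n" using card_Un_disjoint[OF K(3,4,1)] K(2) by simp
  have K2_eq: "{..<n} - I - {i} = K2" by (auto simp: K1_def K2_def)
  have meas: "(\<lambda>x. indicator {s<..} (index_gap b c {..<n} I i x) :: ennreal) \<in> borel_measurable (\<Pi>\<^sub>M i\<in>K1 \<union> K2. L)"
  proof -
    have [measurable]: "index_gap b c {..<n} I i \<in> borel_measurable (\<Pi>\<^sub>M i\<in>{..<n}. L)"
      using I i by (intro index_gap_measurable component_measurable) auto
    show ?thesis unfolding K(2) by measurable
  qed
  have "(\<integral>\<^sup>+x. indicator {s<..} (index_gap b c {..<n} I i x) \<partial>(\<Pi>\<^sub>M i\<in>{..<n}. L)) =
    (\<integral>\<^sup>+x. indicator {s<..} (index_gap b c {..<n} I i x) \<partial>(\<Pi>\<^sub>M i\<in>K1 \<union> K2. L))" by (simp only: K(2))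
  also have "\<dots> = (\<integral>\<^sup>+x. (\<integral>\<^sup>+y. indicator {s<..} (index_gap b c {..<n} I i (merge K1 K2 (x, y))) \<partial>(\<Pi>\<^sub>M i\<in>K2. L)) \<partial>(\<Pi>\<^sub>M i\<in>K1. L))"
    by (rule P.product_nn_integral_fold[OF K(1,3,4) meas])
  also have "\<dots> = (\<integral>\<^sup>+x. ennreal (t * (1 - s / pi)) ^ card K2 \<partial>(\<Pi>\<^sub>M i\<in>K1. L))"
  proof (rule nn_integral_cong_AE)
    have "AE x in (\<Pi>\<^sub>M i\<in>K1. L). generic [] K1 x" "AE x in (\<Pi>\<^sub>M i\<in>K1. L). generic [b, c] K1 x"
      using K by (auto intro: AE_generic)
    then show "AE x in (\<Pi>\<^sub>M i\<in>K1. L). (\<integral>\<^sup>+y. indicator {s<..} (index_gap b c {..<n} I i (merge K1 K2 (x, y))) \<partial>(\<Pi>\<^sub>M i\<in>K2. L)) =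
      ennreal (t * (1 - s / pi)) ^ card K2"
    proof eventually_elim
      case (elim x)
      define v where "v = frame_v b I x"
      define w where "w = frame_w b c I x"
      have IK1: "I \<subseteq> K1" by (auto simp: K1_def)
      have vw: "orthonormal_pair v w" "v \<in> normals_perp (x ` I)" "w \<in> normals_perp (x ` I)"
        unfolding v_def w_def using frame_orthonormal[OF D bc elim(2) fI IK1 I(2)] by auto
      have gp: "general_position (x ` K1)" and inj: "inj_on x K1"
        using generic_general_position[OF D elim(1) K(3)] by auto
      have "card (x ` I) = DIM('a) - 2" using I(2) card_image[OF inj_on_subset[OF inj IK1]] by simp
      moreover have "x ` I \<subseteq> x ` K1" using IK1 by auto
      moreover have xi: "x i \<in> x ` K1 - x ` I"
        using inj i by (auto simp: K1_def inj_on_def)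
      ultimately obtain r \<theta> where "r (x i) > 0" "x i \<bullet> v = - r (x i) * sin (\<theta> (x i))" "x i \<bullet> w = r (x i) * cos (\<theta> (x i))"
        using polar_normals[OF D gp _ _ vw] by metis
      moreover have "sin (\<theta> (x i)) \<noteq> 0 \<or> cos (\<theta> (x i)) \<noteq> 0"
        using sin_zero_abs_cos_one[of "\<theta> (x i)"] by auto
      ultimately have u: "x i \<bullet> v \<noteq> 0 \<or> x i \<bullet> w \<noteq> 0" by auto
      have merge_frames: "frame_v b I (merge K1 K2 (x, y)) = v" "frame_w b c I (merge K1 K2 (x, y)) = w" for y
      proof -
        have "map (merge K1 K2 (x, y)) (sorted_list_of_set I) = map x (sorted_list_of_set I)"
          using IK1 fI by (auto simp: merge_def)
        then show "frame_v b I (merge K1 K2 (x, y)) = v" "frame_w b c I (merge K1 K2 (x, y)) = w"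
          unfolding v_def w_def frame_v_def frame_w_def by (simp_all only:)
      qed
      have "(\<integral>\<^sup>+y. indicator {s<..} (index_gap b c {..<n} I i (merge K1 K2 (x, y))) \<partial>(\<Pi>\<^sub>M i\<in>K2. L)) =
        (\<integral>\<^sup>+y. (\<Prod>j\<in>K2. indicator {z. s < angle_to v w (x i) z} (y j)) \<partial>(\<Pi>\<^sub>M i\<in>K2. L))"
      proof (rule nn_integral_cong)
        fix y
        have "merge K1 K2 (x, y) i = x i" by (simp add: merge_def K1_def)
        moreover have "merge K1 K2 (x, y) j = y j" if "j \<in> K2" for j
          using that K(1) by (auto simp: merge_def)
        ultimately have "s < index_gap b c {..<n} I i (merge K1 K2 (x, y)) \<longleftrightarrow> (\<forall>j\<in>K2. s < angle_to v w (x i) (y j))"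
          unfolding less_index_gap_iff[OF finite_lessThan] merge_frames K2_eq using True by auto
        then show "indicator {s<..} (index_gap b c {..<n} I i (merge K1 K2 (x, y))) =
          (\<Prod>j\<in>K2. indicator {z. s < angle_to v w (x i) z} (y j) :: ennreal)"
          using K(4) by (auto simp: indicator_def prod_zero_iff)
      qed
      also have "\<dots> = (\<Prod>j\<in>K2. \<integral>\<^sup>+z. indicator {z. s < angle_to v w (x i) z} z \<partial>L)"
      proof (rule P.product_nn_integral_prod[OF K(4)])
        fix j
        have m[measurable]: "(\<lambda>z. angle_to v w (x i) z) \<in> borel_measurable L"
          by (intro angle_to_measurable id_measurable_L) auto
        show "(indicator {z. s < angle_to v w (x i) z} :: 'a \<Rightarrow> ennreal) \<in> borel_measurable L"
          by measurable
      qed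
      also have "\<dots> = ennreal (t * (1 - s / pi)) ^ card K2"
        using emeasure_angle_to[OF vw(1) u s True] by simp
      finally show ?case .
    qed
  qed
  also have "\<dots> = ennreal (t * (1 - s / pi)) ^ card K2 * ennreal (t ^ card K1)"
    using K by (simp add: emeasure_PiM_space)
  also have "\<dots> = ennreal (t ^ n * (1 - s / pi) ^ card K2)"
  proof -
    have "0 \<le> t * (1 - s / pi)" using t s True by simp
    then have "ennreal (t * (1 - s / pi)) ^ card K2 * ennreal (t ^ card K1) = ennreal ((t * (1 - s / pi)) ^ card K2 * t ^ card K1)"
      using t by (simp add: ennreal_power ennreal_mult)
    also have "(t * (1 - s / pi)) ^ card K2 * t ^ card K1 = t ^ n * (1 - s / pi) ^ card K2"
      by (simp add: cn[symmetric] power_mult_distrib power_add)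
    finally show ?thesis .
  qed
  also have "card K2 = n - (DIM('a) - 1)" using cn c1 by linarith
  finally show ?thesis using True by simp
qed

end

section \<open>The typical edge length\<close>

text \<open>Meant for set functions given by series and integrals: countable additivity makes
  \<open>F\<close> a measure, and the half-lines are an intersection-stable generator of the Borel
  sets.\<close>

lemma measure_eq_from_tails:
  fixes F :: "real set \<Rightarrow> ennreal"
  assumes \<mu>: "finite_measure \<mu>" "sets \<mu> = sets borel"
    and F0: "F {} = 0"
    and Fca: "\<And>A :: nat \<Rightarrow> real set. range A \<subseteq> sets borel \<Longrightarrow> disjoint_family A \<Longrightarrow> (\<Sum>k. F (A k)) = F (\<Union>k. A k)"
    and tail: "\<And>s. F {s<..} = emeasure \<mu> {s<..}"
    and B: "B \<in> sets borel"
  shows "F B = emeasure \<mu> B"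
proof -
  define \<nu> where "\<nu> = measure_of UNIV (sets borel) F"
  have \<nu>: "emeasure \<nu> A = F A" if "A \<in> sets borel" for A
    unfolding \<nu>_def
  proof (rule emeasure_measure_of_sigma)
    show "sigma_algebra UNIV (sets (borel :: real measure))"
      using sets.sigma_algebra_axioms[of "borel :: real measure"] by simp
    show "positive (sets borel) F" using F0 by (simp add: positive_def)
    show "countably_additive (sets borel) F" using Fca by (simp add: countably_additive_def)
  qed fact
  have "sets \<nu> = sets borel"
    unfolding \<nu>_def using sets.sigma_sets_eq[of "borel :: real measure"] by (simp add: sets_measure_of_conv)
  moreover have gen: "sets (borel :: real measure) = sigma_sets UNIV (range greaterThan)"
    by (subst borel_Ioi) simp
  ultimately have "\<nu> = \<mu>"
  proof (intro measure_eqI_generator_eq[where E = "range greaterThan" and \<Omega> = UNIV and A = "\<lambda>i. {- real i<..}"])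
    show "Int_stable (range (greaterThan :: real \<Rightarrow> real set))"
      unfolding Int_stable_def
    proof safe
      fix a b :: real
      have "{a<..} \<inter> {b<..} = {max a b<..}" by auto
      then show "{a<..} \<inter> {b<..} \<in> range greaterThan" by blast
    qed
    show "(\<Union>i. {- real i<..}) = UNIV"
    proof (intro equalityI subsetI)
      fix x :: real
      obtain i :: nat where "- x < real i" using reals_Archimedean2 by blast
      then have "x \<in> {- real i<..}" by simp
      then show "x \<in> (\<Union>i. {- real i<..})" by blast
    qed simp
    show "emeasure \<nu> {- real i<..} \<noteq> \<infinity>" for i
      using finite_measure.emeasure_finite[OF \<mu>(1)] by (simp add: \<nu> tail)
    show "emeasure \<nu> X = emeasure \<mu> X" if "X \<in> range greaterThan" for X
      using that by (auto simp: \<nu> tail)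
  qed (use \<mu> in auto)
  then show ?thesis using \<nu>[OF B] by simp
qed

lemma exponential_tail:
  assumes l: "0 < l" and a: "0 \<le> a"
  shows "emeasure (density lborel (exponential_density l)) {a<..} = ennreal (exp (- a * l))"
proof -
  let ?E = "density lborel (exponential_density l)"
  interpret prob_space ?E using l by (rule prob_space_exponential_density)
  have "distr ?E lborel (\<lambda>x. x) = distr ?E ?E (\<lambda>x. x)" by (intro distr_cong) auto
  then have "distributed ?E lborel (\<lambda>x. x) (exponential_density l)"
    by (auto simp: distributed_def)
  from exponential_distributedD_gt[OF this a l]
  have "prob {a<..} = exp (- a * l)" by (simp add: greaterThan_def)
  then show ?thesis by (simp add: emeasure_eq_measure)
qed

context
  fixes M :: "'w measure" and L :: "'a measure" and \<eta> :: "'w \<Rightarrow> 'a multiset"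
  assumes PP: "poisson_process M L \<eta>"
begin

lemma poisson_ordering_in_space:
  assumes \<omega>: "\<omega> \<in> space M" and n: "size (\<eta> \<omega>) = n" and p: "p \<in> bijections {..<n} {..<n}"
  shows "(\<lambda>i\<in>{..<n}. enum (\<eta> \<omega>) (p i)) \<in> space (\<Pi>\<^sub>M i\<in>{..<n}. L)"
proof -
  have "p i < n" if "i < n" for i using p that by (auto simp: bijections_def bij_betw_def)
  then have "enum (\<eta> \<omega>) (p i) \<in> space L" if "i < n" for i
    using that n \<omega> poisson_enum_in_space[OF PP] by auto
  then show ?thesis by (auto simp: space_PiM)
qed

text \<open>By the Janossy formula for the indicator of a null set, the sum over orderings has
  integral 0, so almost surely no ordering lies in that set. Countably many sizes preserve
  this.\<close>

lemma AE_poisson_orderings: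
  assumes P: "\<And>n. AE x in (\<Pi>\<^sub>M i\<in>{..<n}. L). P n x"
  shows "AE \<omega> in M. \<forall>p\<in>bijections {..<size (\<eta> \<omega>)} {..<size (\<eta> \<omega>)}.
    P (size (\<eta> \<omega>)) (\<lambda>i\<in>{..<size (\<eta> \<omega>)}. enum (\<eta> \<omega>) (p i))"
proof -
  have "AE \<omega> in M. size (\<eta> \<omega>) = n \<longrightarrow> (\<forall>p\<in>bijections {..<n} {..<n}. P n (\<lambda>i\<in>{..<n}. enum (\<eta> \<omega>) (p i)))" for n
  proof -
    obtain N where N: "{x \<in> space (\<Pi>\<^sub>M i\<in>{..<n}. L). \<not> P n x} \<subseteq> N" "N \<in> null_sets (\<Pi>\<^sub>M i\<in>{..<n}. L)"
      using P[of n] by (auto elim!: AE_E simp: null_sets_def)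
    have f: "(indicator N :: _ \<Rightarrow> ennreal) \<in> borel_measurable (\<Pi>\<^sub>M i\<in>{..<n}. L)" using N by auto
    have m: "(\<lambda>\<omega>. sum_orderings n (indicator N) (\<eta> \<omega>)) \<in> borel_measurable M"
      and "(\<integral>\<^sup>+\<omega>. sum_orderings n (indicator N) (\<eta> \<omega>) \<partial>M) = 0"
      using janossy_formula[OF PP f] N by (auto simp: null_sets_def)
    then have "AE \<omega> in M. sum_orderings n (indicator N) (\<eta> \<omega>) = 0"
      by (simp add: nn_integral_0_iff_AE)
    moreover have "AE \<omega> in M. \<omega> \<in> space M" by (rule AE_space)
    ultimately show ?thesis
    proof eventually_elim
      case (elim \<omega>)
      show ?case
      proof (intro impI ballI)
        fix p assume n: "size (\<eta> \<omega>) = n" and p: "p \<in> bijections {..<n} {..<n}"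
        have "(\<Sum>p\<in>bijections {..<n} {..<n}. indicator N (\<lambda>i\<in>{..<n}. enum (\<eta> \<omega>) (p i)) :: ennreal) = 0"
          using elim(1) n by (simp add: sum_orderings_def)
        then have "(\<lambda>i\<in>{..<n}. enum (\<eta> \<omega>) (p i)) \<notin> N"
          using p finite_bijections[of "{..<n}" "{..<n}"] by (auto simp: sum_eq_0_iff indicator_eq_0_iff)
        then show "P n (\<lambda>i\<in>{..<n}. enum (\<eta> \<omega>) (p i))"
          using poisson_ordering_in_space[OF elim(2) n p] N(1) by blast
      qed
    qed
  qed
  then have "AE \<omega> in M. \<forall>n. size (\<eta> \<omega>) = n \<longrightarrow> (\<forall>p\<in>bijections {..<n} {..<n}. P n (\<lambda>i\<in>{..<n}. enum (\<eta> \<omega>) (p i)))"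
    unfolding AE_all_countable by blast
  then show ?thesis by eventually_elim simp
qed

text \<open>The functional \<open>h\<close> need not be measurable on degenerate configurations: the identity
  uses only that it agrees almost everywhere with the measurable \<open>g\<close>.\<close>

lemma sum_over_poisson_process:
  assumes g: "\<And>n. g n \<in> borel_measurable (\<Pi>\<^sub>M i\<in>{..<n}. L)"
    and h: "\<And>n. AE x in (\<Pi>\<^sub>M i\<in>{..<n}. L). h (x ` {..<n}) = g n x"
  shows "(\<integral>\<^sup>+\<omega>. h (set_mset (\<eta> \<omega>)) \<partial>M) =
    (\<Sum>n. ennreal (exp (- measure L (space L)) / fact n) * (\<integral>\<^sup>+x. g n x \<partial>(\<Pi>\<^sub>M i\<in>{..<n}. L)))"
proof -
  have "AE \<omega> in M. h (set_mset (\<eta> \<omega>)) = (\<Sum>n. ennreal (1 / fact n) * sum_orderings n (g n) (\<eta> \<omega>))"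
    using AE_poisson_orderings[OF h]
  proof eventually_elim
    case (elim \<omega>)
    define n where "n = size (\<eta> \<omega>)"
    have "g n (\<lambda>i\<in>{..<n}. enum (\<eta> \<omega>) (p i)) = h (set_mset (\<eta> \<omega>))" if p: "p \<in> bijections {..<n} {..<n}" for p
    proof -
      have "(\<lambda>i\<in>{..<n}. enum (\<eta> \<omega>) (p i)) ` {..<n} = enum (\<eta> \<omega>) ` (p ` {..<n})" by (auto simp: image_iff)
      also have "p ` {..<n} = {..<n}" using p by (simp add: bijections_def bij_betw_def)
      also have "enum (\<eta> \<omega>) ` {..<n} = set_mset (\<eta> \<omega>)" by (simp add: set_mset_enum n_def)
      finally have "h ((\<lambda>i\<in>{..<n}. enum (\<eta> \<omega>) (p i)) ` {..<n}) = h (set_mset (\<eta> \<omega>))" by (simp only:)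
      moreover have "h ((\<lambda>i\<in>{..<n}. enum (\<eta> \<omega>) (p i)) ` {..<n}) = g n (\<lambda>i\<in>{..<n}. enum (\<eta> \<omega>) (p i))"
        using elim p unfolding n_def by blast
      ultimately show ?thesis by (simp only:)
    qed
    \<comment> \<open>All \<open>fact n\<close> orderings have the same underlying set, so each
      contributes the same value.\<close>
    then have "sum_orderings n (g n) (\<eta> \<omega>) = of_nat (fact n) * h (set_mset (\<eta> \<omega>))"
      by (simp add: sum_orderings_def n_def[symmetric] card_bijections)
    then have "ennreal (1 / fact n) * sum_orderings n (g n) (\<eta> \<omega>) = h (set_mset (\<eta> \<omega>))"
      by (simp add: ennreal_of_nat_eq_real_of_nat flip: mult.assoc ennreal_mult)
    moreover have "(\<Sum>k. ennreal (1 / fact k) * sum_orderings k (g k) (\<eta> \<omega>)) =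
      (\<Sum>k\<in>{n}. ennreal (1 / fact k) * sum_orderings k (g k) (\<eta> \<omega>))"
      by (rule suminf_finite) (auto simp: sum_orderings_def n_def)
    ultimately show ?case by simp
  qed
  then have "(\<integral>\<^sup>+\<omega>. h (set_mset (\<eta> \<omega>)) \<partial>M) =
    (\<integral>\<^sup>+\<omega>. (\<Sum>n. ennreal (1 / fact n) * sum_orderings n (g n) (\<eta> \<omega>)) \<partial>M)"
    by (rule nn_integral_cong_AE)
  also have "\<dots> = (\<Sum>n. \<integral>\<^sup>+\<omega>. ennreal (1 / fact n) * sum_orderings n (g n) (\<eta> \<omega>) \<partial>M)"
    using janossy_formula(1)[OF PP g] by (intro nn_integral_suminf borel_measurable_times_ennreal) auto
  also have "\<dots> = (\<Sum>n. ennreal (1 / fact n) * (ennreal (exp (- measure L (space L))) * (\<integral>\<^sup>+x. g n x \<partial>(\<Pi>\<^sub>M i\<in>{..<n}. L))))"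
    using janossy_formula[OF PP g] by (simp add: nn_integral_cmult)
  also have "\<dots> = (\<Sum>n. ennreal (exp (- measure L (space L)) / fact n) * (\<integral>\<^sup>+x. g n x \<partial>(\<Pi>\<^sub>M i\<in>{..<n}. L)))"
    by (simp add: mult.assoc[symmetric] ennreal_mult[symmetric])
  finally show ?thesis .
qed

end

text \<open>The truncation reflects that on a circle with at least one crossing line an arc reaches
  at most the antipode. The atom at pi belongs to the configurations with just one such line, that
  is to n = d.\<close>

definition truncated_exponential :: "real \<Rightarrow> real measure" where
  "truncated_exponential t = distr (density lborel (exponential_density 1)) borel (\<lambda>y. min (pi / t * y) pi)"

lemma truncated_exponential_tail:
  assumes t: "t > 0"
  shows "emeasure (truncated_exponential t) {s<..} = (if s < pi then ennreal (exp (- t * max 0 s / pi)) else 0)"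
proof -
  let ?E = "density lborel (exponential_density 1)"
  interpret prob_space ?E by (rule prob_space_exponential_density) simp
  have "emeasure (truncated_exponential t) {s<..} = emeasure ?E {y. s < min (pi / t * y) pi}"
    unfolding truncated_exponential_def by (subst emeasure_distr) (auto simp: vimage_def)
  also have "{y. s < min (pi / t * y) pi} = (if s < pi then {t * s / pi<..} else {})"
    using t by (auto simp: field_simps)
  also have "emeasure ?E \<dots> = (if s < pi then ennreal (exp (- t * max 0 s / pi)) else 0)"
  proof (cases "s < pi \<and> s < 0")
    case False
    then show ?thesis using exponential_tail[of 1 "t * s / pi"] t by auto
  next
    case True
    \<comment> \<open>For negative \<open>s\<close> the half-line contains all positive numbers,
      which already have full mass.\<close>
    have "t * s / pi < 0" using True t by (simp add: divide_neg_pos mult_pos_neg)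
    then have "emeasure ?E {0<..} \<le> emeasure ?E {t * s / pi<..}"
      by (intro emeasure_mono) auto
    then have "1 \<le> emeasure ?E {t * s / pi<..}" using exponential_tail[of 1 0] by simp
    moreover have "emeasure ?E {t * s / pi<..} \<le> 1" by (rule emeasure_le_1)
    ultimately show ?thesis using True by simp
  qed
  finally show ?thesis .
qed

lemma prob_space_truncated_exponential: "prob_space (truncated_exponential t)"
  unfolding truncated_exponential_def
  by (intro prob_space.prob_space_distr prob_space_exponential_density) auto

text \<open>Put n = m + D + 1: the binomial coefficient times n - D over n! is 1 / (D! m!), so an
  exponential series in t * q remains. The earlier terms vanish, since n choose D does for n < D and
  n - D does for n = D.\<close>

lemma gap_series:
  fixes t q :: real and D :: nat
  shows "(\<lambda>n. exp (- t) / fact n * (real (n choose D) * real (n - D) * (2 * (t ^ n * q ^ (n - (D + 1))))))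
     sums (2 * t ^ (D + 1) / fact D * exp (- t + t * q))"
proof -
  let ?f = "\<lambda>n. exp (- t) / fact n * (real (n choose D) * real (n - D) * (2 * (t ^ n * q ^ (n - (D + 1)))))"
  have "?f (m + (D + 1)) = 2 * t ^ (D + 1) / fact D * exp (- t) * ((t * q) ^ m /\<^sub>R fact m)" for m
  proof -
    have nD: "m + (D + 1) - D = Suc m" by simp
    have "real (m + (D + 1) choose D) = fact (m + (D + 1)) / (fact D * fact (m + (D + 1) - D))"
      by (rule binomial_fact) simp
    then have "real (m + (D + 1) choose D) * real (Suc m) / fact (m + (D + 1)) = 1 / (fact D * fact m)"
      unfolding nD by (simp add: field_simps del: of_nat_Suc)
    moreover have "?f (m + (D + 1)) = exp (- t) * (real (m + (D + 1) choose D) * real (Suc m) / fact (m + (D + 1))) *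
       (2 * (t ^ (m + (D + 1)) * q ^ m))"
      unfolding nD by simp
    ultimately show ?thesis by (simp add: power_add power_mult_distrib field_simps)
  qed
  moreover have "(\<lambda>m. 2 * t ^ (D + 1) / fact D * exp (- t) * ((t * q) ^ m /\<^sub>R fact m)) sums
    (2 * t ^ (D + 1) / fact D * exp (- t) * exp (t * q))"
    by (intro sums_mult exp_converges)
  ultimately have "(\<lambda>m. ?f (m + (D + 1))) sums (2 * t ^ (D + 1) / fact D * exp (- t) * exp (t * q))" by simp
  moreover have "?f i = 0" if "i < D + 1" for i using that by simp
  ultimately have "?f sums (2 * t ^ (D + 1) / fact D * exp (- t) * exp (t * q))"
    using sums_zero_iff_shift[of "D + 1" ?f] by simp
  then show ?thesis by (simp only: exp_add mult.assoc)
qed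

context scaled_sphere
begin

text \<open>The contribution of the proper arcs for \<open>n\<close> points; the full circle has no
  starting line and is added separately.\<close>

definition gap_mass :: "'a \<Rightarrow> 'a \<Rightarrow> nat \<Rightarrow> real set \<Rightarrow> ennreal" where
  "gap_mass b c n B = (\<Sum>I | I \<subseteq> {..<n} \<and> card I = rank. \<Sum>i\<in>{..<n} - I.
     2 * (\<integral>\<^sup>+x. indicator B (index_gap b c {..<n} I i x) \<partial>(\<Pi>\<^sub>M i\<in>{..<n}. L)))"

lemma rank_DIM: "DIM('a) - 1 = rank + 1" and rank_def: "rank = DIM('a) - 2"
  by (simp_all add: DIM_rank)

lemma index_gap_PiM_measurable:
  "I \<subseteq> {..<n} \<Longrightarrow> i \<in> {..<n} - I \<Longrightarrow> index_gap b c {..<n} I i \<in> borel_measurable (\<Pi>\<^sub>M i\<in>{..<n}. L)"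
  by (intro index_gap_measurable component_measurable) auto

lemma edge_sum_measurable:
  assumes B: "B \<in> sets borel"
  shows "edge_sum b c (indicator B) n \<in> borel_measurable (\<Pi>\<^sub>M i\<in>{..<n}. L)"
proof (cases "n = DIM('a) - 2")
  case True
  then show ?thesis unfolding edge_sum_def[abs_def] by simp
next
  case False
  have m: "(\<lambda>x. indicator B (index_gap b c {..<n} I i x) :: ennreal) \<in> borel_measurable (\<Pi>\<^sub>M i\<in>{..<n}. L)"
    if "I \<subseteq> {..<n}" "i \<in> {..<n} - I" for I i
    using B by (intro measurable_compose[OF index_gap_PiM_measurable[OF that]]) auto
  have "(\<lambda>x. \<Sum>I | I \<subseteq> {..<n} \<and> card I = DIM('a) - 2. \<Sum>i\<in>{..<n} - I. 2 * (indicator B (index_gap b c {..<n} I i x) :: ennreal))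
    \<in> borel_measurable (\<Pi>\<^sub>M i\<in>{..<n}. L)"
    by (intro borel_measurable_sum borel_measurable_times_ennreal borel_measurable_const m) auto
  then show ?thesis unfolding edge_sum_def[abs_def] by (simp only: False if_False)
qed

lemma nn_integral_edge_sum:
  assumes B: "B \<in> sets borel"
  shows "(\<integral>\<^sup>+x. edge_sum b c (indicator B) n x \<partial>(\<Pi>\<^sub>M i\<in>{..<n}. L)) =
    gap_mass b c n B + (if n = rank then ennreal (t ^ rank) * indicator B (2 * pi) else 0)"
proof (cases "n = rank")
  case True
  have "{..<n} - I = {}" if "I \<subseteq> {..<n}" "card I = n" for I
    using that card_subset_eq[of "{..<n}" I] by simp
  then have "gap_mass b c n B = 0" unfolding gap_mass_def using True by (intro sum.neutral) auto
  moreover have "(\<integral>\<^sup>+x. edge_sum b c (indicator B) n x \<partial>(\<Pi>\<^sub>M i\<in>{..<n}. L)) =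
    (\<integral>\<^sup>+x. indicator B (2 * pi) \<partial>(\<Pi>\<^sub>M i\<in>{..<n}. L))"
    using True by (simp add: edge_sum_def rank_def)
  ultimately show ?thesis using True emeasure_PiM_space[of "{..<n}"] by (simp add: mult.commute)
next
  case False
  have m: "(\<lambda>x. indicator B (index_gap b c {..<n} I i x) :: ennreal) \<in> borel_measurable (\<Pi>\<^sub>M i\<in>{..<n}. L)"
    if "I \<subseteq> {..<n}" "i \<in> {..<n} - I" for I i
    using B by (intro measurable_compose[OF index_gap_PiM_measurable[OF that]]) auto
  have "(\<integral>\<^sup>+x. edge_sum b c (indicator B) n x \<partial>(\<Pi>\<^sub>M i\<in>{..<n}. L)) =
    (\<integral>\<^sup>+x. (\<Sum>I | I \<subseteq> {..<n} \<and> card I = rank. \<Sum>i\<in>{..<n} - I. 2 * indicator B (index_gap b c {..<n} I i x)) \<partial>(\<Pi>\<^sub>M i\<in>{..<n}. L))"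
    using False by (simp add: edge_sum_def rank_def)
  also have "\<dots> = (\<Sum>I | I \<subseteq> {..<n} \<and> card I = rank. \<integral>\<^sup>+x. (\<Sum>i\<in>{..<n} - I. 2 * indicator B (index_gap b c {..<n} I i x)) \<partial>(\<Pi>\<^sub>M i\<in>{..<n}. L))"
    by (intro nn_integral_sum borel_measurable_sum borel_measurable_times_ennreal borel_measurable_const m) auto
  also have "\<dots> = gap_mass b c n B"
    unfolding gap_mass_def
  proof (intro sum.cong refl)
    fix I assume "I \<in> {I. I \<subseteq> {..<n} \<and> card I = rank}"
    then have I: "I \<subseteq> {..<n}" by simp
    have "(\<integral>\<^sup>+x. (\<Sum>i\<in>{..<n} - I. 2 * indicator B (index_gap b c {..<n} I i x)) \<partial>(\<Pi>\<^sub>M i\<in>{..<n}. L)) =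
      (\<Sum>i\<in>{..<n} - I. \<integral>\<^sup>+x. 2 * indicator B (index_gap b c {..<n} I i x) \<partial>(\<Pi>\<^sub>M i\<in>{..<n}. L))"
      by (intro nn_integral_sum borel_measurable_times_ennreal borel_measurable_const m[OF I])
    also have "\<dots> = (\<Sum>i\<in>{..<n} - I. 2 * (\<integral>\<^sup>+x. indicator B (index_gap b c {..<n} I i x) \<partial>(\<Pi>\<^sub>M i\<in>{..<n}. L)))"
      by (intro sum.cong refl nn_integral_cmult m[OF I])
    finally show "(\<integral>\<^sup>+x. (\<Sum>i\<in>{..<n} - I. 2 * indicator B (index_gap b c {..<n} I i x)) \<partial>(\<Pi>\<^sub>M i\<in>{..<n}. L)) =
      (\<Sum>i\<in>{..<n} - I. 2 * (\<integral>\<^sup>+x. indicator B (index_gap b c {..<n} I i x) \<partial>(\<Pi>\<^sub>M i\<in>{..<n}. L)))" .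
  qed
  finally show ?thesis using False by simp
qed

lemma gap_mass_tail:
  assumes bc: "b \<in> Basis" "c \<in> Basis" "b \<noteq> c" and s: "0 \<le> s"
  shows "gap_mass b c n {s<..} = (if s < pi
    then ennreal (real (n choose rank) * real (n - rank) * (2 * (t ^ n * (1 - s / pi) ^ (n - (rank + 1))))) else 0)"
proof (cases "s < pi")
  case True
  let ?T = "t ^ n * (1 - s / pi) ^ (n - (rank + 1))"
  have T: "0 \<le> ?T" using t True by simp
  have "gap_mass b c n {s<..} = (\<Sum>I | I \<subseteq> {..<n} \<and> card I = rank. \<Sum>i\<in>{..<n} - I. ennreal (2 * ?T))"
    unfolding gap_mass_def
  proof (intro sum.cong refl)
    fix I i assume "I \<in> {I. I \<subseteq> {..<n} \<and> card I = rank}" "i \<in> {..<n} - I"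
    then have "(\<integral>\<^sup>+x. indicator {s<..} (index_gap b c {..<n} I i x) \<partial>(\<Pi>\<^sub>M i\<in>{..<n}. L)) = ennreal ?T"
      using nn_integral_gap_tail[OF bc, of I n i s] True s rank_DIM by (simp add: rank_def)
    then show "2 * (\<integral>\<^sup>+x. indicator {s<..} (index_gap b c {..<n} I i x) \<partial>(\<Pi>\<^sub>M i\<in>{..<n}. L)) = ennreal (2 * ?T)"
      using T by (simp add: ennreal_mult)
  qed
  also have "\<dots> = (\<Sum>I | I \<subseteq> {..<n} \<and> card I = rank. of_nat (n - rank) * ennreal (2 * ?T))"
  proof (intro sum.cong refl)
    fix I assume I: "I \<in> {I. I \<subseteq> {..<n} \<and> card I = rank}"
    then have "card ({..<n} - I) = n - rank" using finite_subset[of I "{..<n}"] by (simp add: card_Diff_subset)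
    then show "(\<Sum>i\<in>{..<n} - I. ennreal (2 * ?T)) = of_nat (n - rank) * ennreal (2 * ?T)" by simp
  qed
  also have "\<dots> = of_nat (n choose rank) * (of_nat (n - rank) * ennreal (2 * ?T))"
    using n_subsets[of "{..<n}" rank] by simp
  also have "\<dots> = ennreal (real (n choose rank) * real (n - rank) * (2 * ?T))"
    using T by (simp add: ennreal_of_nat_eq_real_of_nat ennreal_mult mult.assoc)
  finally show ?thesis using True by simp
next
  case False
  then have "indicator {s<..} (index_gap b c {..<n} I i x) = (0::ennreal)" for I i x
    by (simp add: less_index_gap_iff indicator_def)
  with False show ?thesis by (simp add: gap_mass_def)
qed

lemma gap_mass_countably_additive:
  assumes A: "range A \<subseteq> sets borel" "disjoint_family (A :: nat \<Rightarrow> real set)"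
  shows "(\<Sum>k. gap_mass b c n (A k)) = gap_mass b c n (\<Union>k. A k)"
proof -
  have one: "(\<Sum>k. 2 * (\<integral>\<^sup>+x. indicator (A k) (index_gap b c {..<n} I i x) \<partial>(\<Pi>\<^sub>M i\<in>{..<n}. L))) =
    2 * (\<integral>\<^sup>+x. indicator (\<Union>k. A k) (index_gap b c {..<n} I i x) \<partial>(\<Pi>\<^sub>M i\<in>{..<n}. L))"
    if I: "I \<subseteq> {..<n}" "i \<in> {..<n} - I" for I i
  proof -
    have m: "(\<lambda>x. indicator (A k) (index_gap b c {..<n} I i x) :: ennreal) \<in> borel_measurable (\<Pi>\<^sub>M i\<in>{..<n}. L)" for k
      using A by (intro measurable_compose[OF index_gap_PiM_measurable[OF I]]) auto
    have "(\<Sum>k. 2 * (\<integral>\<^sup>+x. indicator (A k) (index_gap b c {..<n} I i x) \<partial>(\<Pi>\<^sub>M i\<in>{..<n}. L))) =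
      2 * (\<integral>\<^sup>+x. (\<Sum>k. indicator (A k) (index_gap b c {..<n} I i x)) \<partial>(\<Pi>\<^sub>M i\<in>{..<n}. L))"
      using m by (simp add: nn_integral_suminf)
    then show ?thesis using A(2) by (simp add: suminf_indicator)
  qed
  have "(\<Sum>k. gap_mass b c n (A k)) = (\<Sum>I | I \<subseteq> {..<n} \<and> card I = rank. \<Sum>i\<in>{..<n} - I.
     \<Sum>k. 2 * (\<integral>\<^sup>+x. indicator (A k) (index_gap b c {..<n} I i x) \<partial>(\<Pi>\<^sub>M i\<in>{..<n}. L)))"
    unfolding gap_mass_def by (simp add: suminf_sum[OF summableI] del: ennreal_suminf_cmult)
  also have "\<dots> = gap_mass b c n (\<Union>k. A k)"
    unfolding gap_mass_def by (intro sum.cong refl one) auto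
  finally show ?thesis .
qed

text \<open>Summed with the Poisson weights, the powers of 1 - s / pi become an exponential tail.
  Both sides are measures in \<open>B\<close>, so agreement on half-lines suffices.\<close>

lemma gap_mass_series:
  assumes bc: "b \<in> Basis" "c \<in> Basis" "b \<noteq> c" and B: "B \<in> sets borel"
  shows "(\<Sum>n. ennreal (exp (- t) / fact n) * gap_mass b c n B) =
    ennreal (2 * t ^ (rank + 1) / fact rank) * emeasure (truncated_exponential t) B"
proof -
  define C where "C = 2 * t ^ (rank + 1) / fact rank"
  have C: "C > 0" using t by (simp add: C_def)
  interpret T: prob_space "truncated_exponential t" by (rule prob_space_truncated_exponential)
  let ?F = "\<lambda>B. (\<Sum>n. ennreal (exp (- t) / fact n) * gap_mass b c n B)"
  let ?\<mu> = "scale_measure (ennreal C) (truncated_exponential t)"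
  have tail0: "?F {s<..} = emeasure ?\<mu> {s<..}" if s: "0 \<le> s" for s
  proof (cases "s < pi")
    case True
    let ?q = "1 - s / pi"
    have q: "0 \<le> ?q" using True by simp
    define X where "X n = real (n choose rank) * real (n - rank) * (2 * (t ^ n * ?q ^ (n - (rank + 1))))" for n
    have X: "0 \<le> X n" "0 \<le> exp (- t) / fact n" for n
      unfolding X_def using t q by (intro mult_nonneg_nonneg zero_le_power) auto
    have "gap_mass b c n {s<..} = ennreal (X n)" for n
      using True by (simp only: gap_mass_tail[OF bc s] X_def if_True)
    then have "?F {s<..} = (\<Sum>n. ennreal (exp (- t) / fact n * X n))"
      by (simp only: ennreal_mult[OF X(2) X(1)])
    also have "\<dots> = ennreal (C * exp (- t + t * ?q))"
    proof (rule suminf_ennreal_eq)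
      show "0 \<le> exp (- t) / fact n * X n" for n using X by (intro mult_nonneg_nonneg)
      show "(\<lambda>n. exp (- t) / fact n * X n) sums (C * exp (- t + t * ?q))"
        unfolding X_def C_def by (rule gap_series)
    qed
    \<comment> \<open>Only the lines that cross within the angle \<open>s\<close>, a fraction s / pi
      of the intensity, leave a trace in the exponent.\<close>
    also have "- t + t * ?q = - t * max 0 s / pi" using s by (simp add: field_simps)
    finally show ?thesis using True C by (simp add: truncated_exponential_tail[OF t] ennreal_mult)
  next
    case False
    then show ?thesis by (simp add: gap_mass_tail[OF bc s] truncated_exponential_tail[OF t])
  qed
  have "?F B = emeasure ?\<mu> B"
  proof (rule measure_eq_from_tails)
    show "finite_measure ?\<mu>"
      by (rule finite_measureI) (simp add: T.emeasure_space_1 space_scale_measure)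
    show "sets ?\<mu> = sets borel" by (simp add: truncated_exponential_def)
    show "?F {} = 0" by (simp add: gap_mass_def)
    show "?F {s<..} = emeasure ?\<mu> {s<..}" for s
    proof (cases "0 \<le> s")
      case False
      \<comment> \<open>Gaps are positive, so for negative \<open>s\<close> both tails equal their
        value at 0.\<close>
      have "indicator {s<..} (index_gap b c {..<n} I i x) = (indicator {0<..} (index_gap b c {..<n} I i x) :: ennreal)"
        for n I i x
        using False index_gap_pos[of "{..<n}" b c I i x] by (simp add: indicator_def)
      then have "gap_mass b c n {s<..} = gap_mass b c n {0<..}" for n
        unfolding gap_mass_def by (simp only:)
      moreover have "emeasure ?\<mu> {s<..} = emeasure ?\<mu> {0<..}"
        using False less_trans[of s 0 pi] by (simp add: truncated_exponential_tail[OF t])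
      ultimately show ?thesis using tail0[of 0] by simp
    qed (rule tail0)
    fix A :: "nat \<Rightarrow> real set" assume A: "range A \<subseteq> sets borel" "disjoint_family A"
    \<comment> \<open>The series over \<open>n\<close> is read as an integral for counting measure,
      so that it can be exchanged with the series over \<open>k\<close>.\<close>
    have "(\<Sum>k. ?F (A k)) = (\<Sum>k. \<integral>\<^sup>+n. ennreal (exp (- t) / fact n) * gap_mass b c n (A k) \<partial>count_space UNIV)"
      by (simp add: nn_integral_count_space_nat)
    also have "\<dots> = (\<integral>\<^sup>+n. (\<Sum>k. ennreal (exp (- t) / fact n) * gap_mass b c n (A k)) \<partial>count_space UNIV)"
      by (rule nn_integral_suminf[symmetric]) simp
    also have "\<dots> = ?F (\<Union>k. A k)"
      by (simp add: nn_integral_count_space_nat gap_mass_countably_additive[OF A])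
    finally show "(\<Sum>k. ?F (A k)) = ?F (\<Union>k. A k)" .
  qed fact
  then show ?thesis by (simp add: C_def)
qed

text \<open>The arcs carry the factor 2 t^(rank + 1) / rank!, and the full circle, present only for
  n = rank, the factor exp (- t) t^rank / rank!. Their common factor is split off because it cancels
  in the quotient that defines the law.\<close>

lemma expected_edge_sum:
  assumes PP: "poisson_process M L \<eta>" and B: "B \<in> sets borel"
  shows "(\<integral>\<^sup>+\<omega>. (\<Sum>e\<in>tessellation_edges (set_mset (\<eta> \<omega>)). indicator B (enn2real (hausdorff1 e))) \<partial>M) =
    ennreal (t ^ rank / fact rank) *
      (ennreal (2 * t) * emeasure (truncated_exponential t) B + ennreal (exp (- t)) * indicator B (2 * pi))"
proof -
  obtain b c :: 'a where bc: "b \<in> Basis" "c \<in> Basis" "b \<noteq> c" using exists_two_Basis[OF D] by blast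
  have mL: "measure L (space L) = t" using emeasure_L_space t by (simp add: measure_def)
  have "(\<integral>\<^sup>+\<omega>. (\<Sum>e\<in>tessellation_edges (set_mset (\<eta> \<omega>)). indicator B (enn2real (hausdorff1 e))) \<partial>M) =
    (\<Sum>n. ennreal (exp (- measure L (space L)) / fact n) * (\<integral>\<^sup>+x. edge_sum b c (indicator B) n x \<partial>(\<Pi>\<^sub>M i\<in>{..<n}. L)))"
  proof (rule sum_over_poisson_process[OF PP, where h = "\<lambda>U. \<Sum>e\<in>tessellation_edges U. indicator B (enn2real (hausdorff1 e))"])
    show "edge_sum b c (indicator B) n \<in> borel_measurable (\<Pi>\<^sub>M i\<in>{..<n}. L)" for n
      by (rule edge_sum_measurable[OF B])
    show "AE x in (\<Pi>\<^sub>M i\<in>{..<n}. L). (\<Sum>e\<in>tessellation_edges (x ` {..<n}). indicator B (enn2real (hausdorff1 e))) =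
      edge_sum b c (indicator B) n x" for n
    proof -
      have "AE x in (\<Pi>\<^sub>M i\<in>{..<n}. L). generic [] {..<n} x" "AE x in (\<Pi>\<^sub>M i\<in>{..<n}. L). generic [b, c] {..<n} x"
        by (auto intro: AE_generic)
      then show ?thesis
        by eventually_elim (rule sum_tessellation_edges_indexed[OF D bc])
    qed
  qed
  also have "\<dots> = (\<Sum>n. ennreal (exp (- t) / fact n) * gap_mass b c n B +
      ennreal (exp (- t) / fact n) * (if n = rank then ennreal (t ^ rank) * indicator B (2 * pi) else 0))"
    by (simp add: nn_integral_edge_sum[OF B] mL distrib_left)
  also have "\<dots> = (\<Sum>n. ennreal (exp (- t) / fact n) * gap_mass b c n B) +
      (\<Sum>n. ennreal (exp (- t) / fact n) * (if n = rank then ennreal (t ^ rank) * indicator B (2 * pi) else 0))"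
    by (rule suminf_add[symmetric]) auto
  also have "(\<Sum>n. ennreal (exp (- t) / fact n) * (if n = rank then ennreal (t ^ rank) * indicator B (2 * pi) else 0)) =
    ennreal (exp (- t) / fact rank) * (ennreal (t ^ rank) * indicator B (2 * pi))"
    by (subst suminf_finite[of "{rank}"]) auto
  also have "\<dots> = ennreal (t ^ rank / fact rank) * (ennreal (exp (- t)) * indicator B (2 * pi))"
  proof -
    have "ennreal (exp (- t) / fact rank) * ennreal (t ^ rank) = ennreal (t ^ rank / fact rank) * ennreal (exp (- t))"
      using t by (simp add: mult.commute flip: ennreal_mult)
    then show ?thesis by (simp only: mult.assoc[symmetric])
  qed
  also have "(\<Sum>n. ennreal (exp (- t) / fact n) * gap_mass b c n B) =
    ennreal (t ^ rank / fact rank) * (ennreal (2 * t) * emeasure (truncated_exponential t) B)"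
    unfolding gap_mass_series[OF bc B] using t
    by (simp add: mult.assoc[symmetric] ennreal_mult[symmetric]) (simp add: mult.commute mult.left_commute)
  finally show ?thesis by (simp add: distrib_left)
qed

text \<open>\<open>measure_of\<close> yields the zero measure unless its set function is countably
  additive, so this has to be verified for the explicit quotient before the law can be
  evaluated.\<close>

lemma emeasure_typical_edge_length_law:
  assumes PP: "poisson_process M L \<eta>" and B: "B \<in> sets borel"
  shows "emeasure (typical_edge_length_law M \<eta>) B =
    (ennreal (2 * t) * emeasure (truncated_exponential t) B + ennreal (exp (- t)) * indicator B (2 * pi)) /
      ennreal (2 * t + exp (- t))"
proof -
  let ?C = "ennreal (t ^ rank / fact rank)"
  let ?G = "\<lambda>B. ennreal (2 * t) * emeasure (truncated_exponential t) B + ennreal (exp (- t)) * indicator B (2 * pi)"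
  let ?T = "ennreal (2 * t + exp (- t))"
  interpret T: prob_space "truncated_exponential t" by (rule prob_space_truncated_exponential)
  define f where "f B = (\<integral>\<^sup>+\<omega>. (\<Sum>e\<in>tessellation_edges (set_mset (\<eta> \<omega>)). indicator B (enn2real (hausdorff1 e))) \<partial>M) /
            (\<integral>\<^sup>+\<omega>. of_nat (card (tessellation_edges (set_mset (\<eta> \<omega>)))) \<partial>M)" for B
  \<comment> \<open>The expected number of edges is the same formula for \<open>B = UNIV\<close>,
    where the weights add up to 2 * t + exp (- t).\<close>
  have "(\<integral>\<^sup>+\<omega>. of_nat (card (tessellation_edges (set_mset (\<eta> \<omega>)))) \<partial>M) = ?C * ?G UNIV"
    using expected_edge_sum[OF PP, of UNIV] by simp
  also have "?G UNIV = ?T"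
    using T.emeasure_space_1 t by (simp add: truncated_exponential_def ennreal_plus)
  finally have den: "(\<integral>\<^sup>+\<omega>. of_nat (card (tessellation_edges (set_mset (\<eta> \<omega>)))) \<partial>M) = ?C * ?T" .
  have f: "f B = ?G B / ?T" if "B \<in> sets borel" for B
  proof -
    have "f B = (?C * ?G B) / (?C * ?T)" unfolding f_def den expected_edge_sum[OF PP that] ..
    also have "\<dots> = ?G B / ?T"
    proof -
      have c: "0 < t ^ rank / fact rank" and T: "0 < 2 * t + exp (- t)" using t by (auto intro: add_pos_pos)
      have "?C * inverse (?C * ?T) = inverse ?T"
      proof -
        have "ennreal a * inverse (ennreal a * ennreal b) = inverse (ennreal b)" if ab: "0 < a" "0 < b" for a b
        proof -
          have ab': "0 < a * b" using ab by simp
          have "ennreal a * inverse (ennreal a * ennreal b) = ennreal a * ennreal (inverse (a * b))"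
            using ab by (simp only: ennreal_mult[symmetric] less_imp_le inverse_ennreal[OF ab'])
          also have "\<dots> = ennreal (a * inverse (a * b))"
            using ab by (intro ennreal_mult[symmetric]) auto
          also have "a * inverse (a * b) = inverse b" using ab by simp
          finally show ?thesis using ab by (simp add: inverse_ennreal)
        qed
        from this[OF c T] show ?thesis .
      qed
      moreover have "(?C * ?G B) * inverse (?C * ?T) = ?G B * (?C * inverse (?C * ?T))"
        by (subst mult.commute[of ?C "?G B"]) (rule mult.assoc)
      ultimately show ?thesis unfolding divide_ennreal_def by (simp only:)
    qed
    finally show ?thesis .
  qed
  have "emeasure (measure_of UNIV (sets borel) f) B = f B"
  proof (rule emeasure_measure_of_sigma)
    show "sigma_algebra UNIV (sets (borel :: real measure))"
      using sets.sigma_algebra_axioms[of "borel :: real measure"] by simp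
    show "positive (sets borel) f" by (simp add: positive_def f)
    show "countably_additive (sets borel) f"
      unfolding countably_additive_def
    proof safe
      fix A :: "nat \<Rightarrow> real set" assume A: "range A \<subseteq> sets borel" "disjoint_family A" "(\<Union>k. A k) \<in> sets borel"
      have sT: "sets (truncated_exponential t) = sets borel" by (simp add: truncated_exponential_def)
      have "(\<Sum>k. f (A k)) = (\<Sum>k. ?G (A k)) / ?T"
        using A by (simp add: f range_subsetD divide_ennreal_def)
      also have "(\<Sum>k. ?G (A k)) = (\<Sum>k. ennreal (2 * t) * emeasure (truncated_exponential t) (A k)) +
         (\<Sum>k. ennreal (exp (- t)) * indicator (A k) (2 * pi))"
        by (rule suminf_add[symmetric]) auto
      also have "\<dots> = ?G (\<Union>k. A k)"
        using A by (simp add: suminf_emeasure sT suminf_indicator)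
      finally show "(\<Sum>k. f (A k)) = f (\<Union>k. A k)" using A by (simp add: f)
    qed
  qed fact
  then show ?thesis unfolding f[OF B] unfolding typical_edge_length_law_def f_def[abs_def] .
qed

end

text \<open>After scaling by t / pi, the arcs have the law of min Y t for a standard exponential Y,
  and the full circle sits at 2 * t. The first differs from Y only on the event Y > t, of
  probability exp (- t); the second has relative weight of no larger order.\<close>

lemma tv_dist_typical_edge_length_law:
  fixes \<eta> :: "'w \<Rightarrow> 'a::euclidean_space multiset"
  assumes DIM2: "DIM('a) \<ge> 2" and t1: "t \<ge> 1"
    and PP: "poisson_process M (scale_measure (ennreal t) sphere_measure) \<eta>"
  shows "\<bar>tv_dist (distr (typical_edge_length_law M \<eta>) borel (\<lambda>x. t / pi * x)) (density lborel (exponential_density 1))\<bar>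
    \<le> 2 * exp (- t)"
proof -
  interpret scaled_sphere t "scale_measure (ennreal t) (sphere_measure :: 'a measure)" "DIM('a) - 2"
    by unfold_locales (use t1 DIM2 in auto)
  let ?E = "density lborel (exponential_density 1)"
  let ?law = "typical_edge_length_law M \<eta>"
  let ?P = "distr ?law borel (\<lambda>x. t / pi * x)"
  interpret E: prob_space ?E by (rule prob_space_exponential_density) simp
  have slaw: "sets ?law = sets borel"
    using sets.sigma_sets_eq[of "borel :: real measure"]
    by (simp add: typical_edge_length_law_def sets_measure_of_conv)
  have bound: "\<bar>measure ?P A - measure ?E A\<bar> \<le> 2 * exp (- t)" if A: "A \<in> sets borel" for A
  proof -
    define B where "B = (\<lambda>x. t / pi * x) -` A"
    have B: "B \<in> sets borel"
    proof -
      have "(\<lambda>x. t / pi * x) \<in> borel_measurable borel" by measurable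
      from measurable_sets[OF this A] show ?thesis by (simp only: B_def space_borel Int_UNIV_right)
    qed
    define p where "p = E.prob {y. min y t \<in> A}"
    define i where "i = (indicator B (2 * pi) :: real)"
    have A'[measurable]: "{y. min y t \<in> A} \<in> sets borel"
      using measurable_sets[of "\<lambda>y. min y t" borel borel A] A by (simp add: vimage_def)
    have "emeasure (truncated_exponential t) B = emeasure ?E {y. min y t \<in> A}"
    proof -
      have "t / pi * min (pi / t * y) pi = min y t" for y
        using t by (auto simp: min_def field_simps)
      then have "(\<lambda>y. min (pi / t * y) pi) -` B = {y. min y t \<in> A}" by (simp add: B_def vimage_def)
      then show ?thesis unfolding truncated_exponential_def using B by (subst emeasure_distr) auto
    qed
    then have trunc: "emeasure (truncated_exponential t) B = ennreal p"
      by (simp add: p_def E.emeasure_eq_measure)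
    have p: "0 \<le> p" "p \<le> 1" by (auto simp: p_def)
    have i: "0 \<le> i" "i \<le> 1" by (auto simp: i_def indicator_def)
    have "emeasure ?P A = emeasure ?law B"
    proof (subst emeasure_distr)
      show "(\<lambda>x. t / pi * x) \<in> borel_measurable ?law"
        by (subst measurable_cong_sets[OF slaw refl]) measurable
      show "emeasure ?law ((\<lambda>x. t / pi * x) -` A \<inter> space ?law) = emeasure ?law B"
        using sets_eq_imp_space_eq[OF slaw] by (simp add: B_def)
    qed (rule A)
    also have "\<dots> = (ennreal (2 * t) * ennreal p + ennreal (exp (- t)) * ennreal i) / ennreal (2 * t + exp (- t))"
      unfolding emeasure_typical_edge_length_law[OF PP B] trunc by (simp add: i_def ennreal_indicator)
    also have "\<dots> = ennreal ((2 * t * p + exp (- t) * i) / (2 * t + exp (- t)))"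
      using t p i by (simp add: divide_ennreal add_pos_pos flip: ennreal_mult ennreal_plus)
    finally have mP: "measure ?P A = (2 * t * p + exp (- t) * i) / (2 * t + exp (- t))"
      using t p i by (simp add: measure_def)
    define q where "q = E.prob A"
    have q: "0 \<le> q" "q \<le> 1" by (auto simp: q_def)
    have tailE: "E.prob {t<..} = exp (- t)"
      using exponential_tail[of 1 t] t by (simp add: measure_def)
    have pq: "\<bar>p - q\<bar> \<le> exp (- t)"
    proof -
      \<comment> \<open>Coupling: min y t and y differ only for y > t.\<close>
      have "p \<le> E.prob (A \<union> {t<..})" unfolding p_def using A by (intro E.finite_measure_mono) (auto simp: min_def split: if_splits)
      also have "\<dots> \<le> q + E.prob {t<..}" unfolding q_def using A by (intro measure_subadditive) auto
      finally have 1: "p \<le> q + exp (- t)" by (simp add: tailE)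
      have "q \<le> E.prob ({y. min y t \<in> A} \<union> {t<..})" unfolding q_def using A by (intro E.finite_measure_mono) (auto simp: min_def not_le)
      also have "\<dots> \<le> p + E.prob {t<..}" unfolding p_def by (intro measure_subadditive) auto
      finally have 2: "q \<le> p + exp (- t)" by (simp add: tailE)
      from 1 2 show ?thesis by linarith
    qed
    have T: "2 * t + exp (- t) > 0" using t by (simp add: add_pos_pos)
    have "(2 * t * p + exp (- t) * i) / (2 * t + exp (- t)) - q = (2 * t * (p - q) + exp (- t) * (i - q)) / (2 * t + exp (- t))"
      using T by (simp add: field_simps)
    then have "\<bar>(2 * t * p + exp (- t) * i) / (2 * t + exp (- t)) - q\<bar> = \<bar>2 * t * (p - q) + exp (- t) * (i - q)\<bar> / (2 * t + exp (- t))"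
      using T by (simp add: abs_divide)
    also have "\<dots> \<le> 2 * exp (- t)"
    proof -
      have "\<bar>2 * t * (p - q)\<bar> \<le> 2 * t * exp (- t)" using pq t by (simp add: abs_mult)
      moreover have "\<bar>exp (- t) * (i - q)\<bar> \<le> exp (- t) * 1" 
        unfolding abs_mult using i q by (intro mult_mono) auto
      ultimately have "\<bar>2 * t * (p - q) + exp (- t) * (i - q)\<bar> \<le> 2 * t * exp (- t) + exp (- t)" by linarith
      also have "\<dots> \<le> 2 * exp (- t) * (2 * t + exp (- t))"
      \<comment> \<open>Since t \<ge> 1, the lone exp (- t) from the full circle is absorbed by 2 *
        t * exp (- t), which gives the constant 2.\<close>
      proof -
        have "1 * exp (- t) \<le> (2 * t) * exp (- t)" using t1 by (intro mult_right_mono) auto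
        moreover have "0 \<le> 2 * exp (- t) * exp (- t)" by simp
        moreover have "2 * exp (- t) * (2 * t + exp (- t)) = 2 * (2 * t * exp (- t)) + 2 * exp (- t) * exp (- t)"
          by (simp add: algebra_simps)
        ultimately show ?thesis by linarith
      qed
      finally show ?thesis using T by (simp add: pos_divide_le_eq)
    qed
    finally show ?thesis using mP by (simp add: q_def)
  qed
  have sP: "sets ?P = sets borel" by simp
  have "tv_dist ?P ?E \<le> 2 * exp (- t)"
    unfolding tv_dist_def sP
  proof (rule cSUP_least)
    show "sets (borel :: real measure) \<noteq> {}" using sets.empty_sets by blast
  qed (rule bound)
  moreover have "0 \<le> tv_dist ?P ?E"
  proof -
    \<comment> \<open>The empty set bounds the supremum from below; for a real supremum this
      requires the set of differences to be bounded above.\<close>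
    have "\<bar>measure ?P {} - measure ?E {}\<bar> \<le> tv_dist ?P ?E"
      unfolding tv_dist_def sP
    proof (rule cSUP_upper)
      show "bdd_above ((\<lambda>A. \<bar>measure ?P A - measure ?E A\<bar>) ` sets borel)"
        by (rule bdd_aboveI2) (rule bound)
    qed simp
    then show ?thesis by simp
  qed
  ultimately show ?thesis by simp
qed

theorem corollary4p3:
  fixes d :: nat
    and M :: "real \<Rightarrow> 'w measure"
    and \<eta> :: "real \<Rightarrow> 'w \<Rightarrow> 'a::euclidean_space multiset"
  assumes "d \<ge> 2" and "DIM('a) = d + 1"
    and "\<And>t. t > 0 \<Longrightarrow> poisson_process (M t) (scale_measure (ennreal t) sphere_measure) (\<eta> t)"
  shows "((\<lambda>t. tv_dist (distr (typical_edge_length_law (M t) (\<eta> t)) borel (\<lambda>x. t / pi * x))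
                      (density lborel (exponential_density 1))) \<longlongrightarrow> 0) at_top"
proof (rule Lim_null_comparison)
  show "\<forall>\<^sub>F t in at_top. norm (tv_dist (distr (typical_edge_length_law (M t) (\<eta> t)) borel (\<lambda>x. t / pi * x))
      (density lborel (exponential_density 1))) \<le> 2 * exp (- t)"
    using eventually_ge_at_top[of 1]
  proof eventually_elim
    case (elim t)
    then show ?case
      using tv_dist_typical_edge_length_law[OF _ elim assms(3)[of t]] assms(1,2) by simp
  qed
  have "((\<lambda>t::real. exp (- t)) \<longlongrightarrow> 0) at_top"
    by (rule filterlim_compose[OF exp_at_bot filterlim_uminus_at_bot_at_top])
  then show "((\<lambda>t::real. 2 * exp (- t)) \<longlongrightarrow> 0) at_top"
    by (rule tendsto_mult_right_zero)
qed

end
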